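(* Let $n\ge1$ be the space dimension. Assume $f_N(\beta')<\infty$ for every $\beta'>0$ and every $N$, and that there is an open interval $J\subset(0,\infty)$ on which $f_N$ is four times differentiable with $\sup_N|f_N^{(j)}(\beta')|\le C_{\beta'}$ for $j=0,\dots,4$, $\beta'\in J$, where $\beta'\mapsto C_{\beta'}$ is bounded on closed bounded subintervals of $J$. Fix $\beta\in J$. Let $K=K_N({\bf p})=\sum_{j=1}^N\frac{|p_j|^2}{2}$ be the kinetic energy and suppose that each $D\in\{K,K^2\}$ satisfies: (i) $\|D\|_{2,\beta,N}<\infty$; (ii) there exists $C_\beta>0$, independent of $N$, such that $\left|\frac{d^j}{du^j}\langle D|u\rangle_N\big|_{u=u_N(\beta)}\right|\le C_\beta N^{j/2}\|D\|_{2,\beta,N}$ for $j=0,1,2$; (iii) with $\delta_N:=b\sqrt{\log N/N}$ for some $b>0$, there exists $C_\beta>0$, independent of $N$, such that $\sup_{|u-u_N(\beta)|\le\delta_N}\left|\frac{d^3}{du^3}\langle D|u\rangle_N\right|\le C_\beta\frac{N^{1/2}}{\log N}\|D\|_{2,\beta,N}$. Then, as $N\to\infty$, $$\frac1N\langle K;K|u_N(\beta)\rangle_N=\frac{n}{2\beta^2}-\frac{n^2}{4\beta^4f_N''(\beta)}+o(1)=\frac{n}{2\beta^2}\left(1-\frac{n}{2C_N(\beta)}\right)+o(1),$$ where $C_N(\beta)=\beta^2f_N''(\beta)=\frac{d}{d(\beta^{-1})}u_N(\beta)$ is the heat capacity per particle.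
   Context: For each $N$ consider $N$ particles with momenta ${\bf p}=(p_1,\dots,p_N)$, $p_i\in\mathbb R^n$, and positions ${\bf q}=(q_1,\dots,q_N)$, $q_i\in M$, where $M$ is an $n$-dimensional manifold with its volume measure; the phase space is $\Omega^N=(\mathbb R^n\times M)^N$ with reference measure $d{\bf p}\,d{\bf q}$. Write $\bar{\bf q}_i=(q_1,\dots,q_{i-1},q_{i+1},\dots,q_N)$. The Hamiltonian is $H_N=\sum_{i=1}^N X_i$ with $X_i=\frac{|p_i|^2}{2}+V(q_i,\bar{\bf q}_i)$, where $V$ is a regular (smooth) real function. Put $h_N=H_N/N$. Define $f_N(\beta)=\frac1N\log\int_{\Omega^N}e^{-\beta H_N}\,d{\bf p}\,d{\bf q}$, the canonical measure $\nu_{\beta,N}=e^{-\beta H_N-Nf_N(\beta)}\,d{\bf p}\,d{\bf q}$ with expectation $\langle\cdot\rangle_{\beta,N}$, and $u_N(\beta)=\langle h_N\rangle_{\beta,N}=-f_N'(\beta)$. $\|A\|_{2,\beta,N}=\langle A^2\rangle_{\beta,N}^{1/2}$ is the $L^2(\nu_{\beta,N})$ norm. Let $\mathcal F_{N,\beta}$ be the density of $h_N$ under $\nu_{\beta,N}$. The microcanonical average $\langle A|u\rangle_N$ is the conditional expectation of $A$ given $h_N=u$, i.e. $\langle A\,F(h_N)\rangle_{\beta,N}=\int F(u)\langle A|u\rangle_N\,\mathcal F_{N,\beta}(u)\,du$ for measurable $F$; it does not depend on $\beta$, and $V$ is assumed regular enough that (via the co-area formula) a regular version defined for every $u$ exists,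 which is the one used. The derivatives of the microcanonical averages appearing in the hypotheses are assumed to exist. The microcanonical variance is $\langle K;K|u\rangle_N=\langle K^2|u\rangle_N-\langle K|u\rangle_N^2$. *)

theory Defs
  imports "HOL-Analysis.Analysis"
begin

section \<open>Smooth functions of finitely many real coordinates\<close>

text \<open>
  Points are families \<open>'i \<Rightarrow> real\<close>, of which only the coordinates in the finite set \<open>I\<close> matter; \<open>S\<close> is
  meant to be open in these coordinates. Using coordinate families instead of a type \<open>real ^ 'm\<close>
  allows the number of coordinates to be \<open>n * N\<close> with \<open>N\<close> varying.
\<close>

primrec Ck_on :: "'i set \<Rightarrow> nat \<Rightarrow> (('i \<Rightarrow> real) \<Rightarrow> real) \<Rightarrow> ('i \<Rightarrow> real) set \<Rightarrow> bool" where
  "Ck_on I 0 F S \<longleftrightarrow> continuous_on S F"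
| "Ck_on I (Suc k) F S \<longleftrightarrow> continuous_on S F \<and>
     (\<forall>i\<in>I. (\<forall>x\<in>S. (\<lambda>t. F (x(i := t))) field_differentiable at (x i)) \<and>
            Ck_on I k (\<lambda>x. deriv (\<lambda>t. F (x(i := t))) (x i)) S)"

definition smooth_on :: "'i set \<Rightarrow> (('i \<Rightarrow> real) \<Rightarrow> real) \<Rightarrow> ('i \<Rightarrow> real) set \<Rightarrow> bool" where
  "smooth_on I F S \<longleftrightarrow> (\<forall>k. Ck_on I k F S)"

definition smooth_on_vec :: "(real ^ 'n \<Rightarrow> real) \<Rightarrow> (real ^ 'n) set \<Rightarrow> bool" where
  "smooth_on_vec f W \<longleftrightarrow> smooth_on UNIV (\<lambda>x. f (vec_lambda x)) {x. vec_lambda x \<in> W}"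

text \<open>The \<open>j\<close>-th block in \<open>\<real>\<^sup>n\<close> of a family of coordinates in \<open>(\<real>\<^sup>n)\<^sup>N\<close>.\<close>

definition block :: "(nat \<times> 'n \<Rightarrow> real) \<Rightarrow> nat \<Rightarrow> real ^ 'n" where
  "block x j = (\<chi> a. x (j, a))"


section \<open>The manifold and its volume measure\<close>

text \<open>
  The manifold is the whole (second countable Hausdorff) type \<open>'q\<close>; its dimension is \<open>CARD('n)\<close>.
  A chart is a pair of its domain and its coordinate map.
\<close>

type_synonym ('q, 'n) chart = "'q set \<times> ('q \<Rightarrow> real ^ 'n)"

definition chart_image :: "('q, 'n) chart \<Rightarrow> (real ^ 'n) set" where
  "chart_image c = snd c ` fst c"

definition chart_inv :: "('q, 'n) chart \<Rightarrow> real ^ 'n \<Rightarrow> 'q" where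
  "chart_inv c = inv_into (fst c) (snd c)"

definition smooth_atlas ::
    "('q :: {second_countable_topology, t2_space}, 'n :: finite) chart set \<Rightarrow> bool" where
  "smooth_atlas \<A> \<longleftrightarrow>
     (\<Union>c\<in>\<A>. fst c) = UNIV \<and>
     (\<forall>c\<in>\<A>. open (fst c) \<and> open (chart_image c) \<and>
        homeomorphism (fst c) (chart_image c) (snd c) (chart_inv c)) \<and>
     (\<forall>c\<in>\<A>. \<forall>d\<in>\<A>. \<forall>i.
        smooth_on_vec (\<lambda>x. snd d (chart_inv c x) $ i) (snd c ` (fst c \<inter> fst d)))"

text \<open>
  A volume measure is given in every chart by a smooth positive density. The Riemannian volume
  measures are exactly the measures of this form.
\<close>

definition volume_measure ::
    "('q :: {second_countable_topology, t2_space}, 'n :: finite) chart set \<Rightarrow> 'q measure \<Rightarrow> bool" where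
  "volume_measure \<A> vol \<longleftrightarrow>
     sets vol = sets borel \<and>
     (\<forall>c\<in>\<A>. \<exists>\<rho>. smooth_on_vec \<rho> (chart_image c) \<and> (\<forall>x\<in>chart_image c. \<rho> x > 0) \<and>
        (\<forall>A\<in>sets borel. A \<subseteq> fst c \<longrightarrow>
           emeasure vol A = (\<integral>\<^sup>+x. ennreal (\<rho> x) * indicator (snd c ` A) x \<partial>lborel)))"

text \<open>
  The potential for \<open>N\<close> particles is a function on \<open>M \<times> M\<^sup>N\<^sup>-\<^sup>1\<close>, the second argument
  being an extensional family indexed by \<open>{..<N-1}\<close>.
\<close>

definition smooth_potential ::
    "('q :: {second_countable_topology, t2_space}, 'n :: finite) chart set \<Rightarrow>
     nat \<Rightarrow> ('q \<Rightarrow> (nat \<Rightarrow> 'q) \<Rightarrow> real) \<Rightarrow> bool" where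
  "smooth_potential \<A> N V \<longleftrightarrow>
     (\<forall>c. (\<forall>j<N. c j \<in> \<A>) \<longrightarrow>
        smooth_on ({..<N} \<times> UNIV)
          (\<lambda>x. V (chart_inv (c 0) (block x 0))
                 (\<lambda>j\<in>{..<N-1}. chart_inv (c (Suc j)) (block x (Suc j))))
          {x. \<forall>j<N. block x j \<in> chart_image (c j)})"


section \<open>The particle system\<close>

text \<open>
  Particles are indexed by \<open>{..<N}\<close>. A state is a pair of momenta and positions. Potentials
  \<open>V\<close> below are families indexed by the number of particles.
\<close>

type_synonym ('n, 'q) state = "(nat \<Rightarrow> real ^ 'n) \<times> (nat \<Rightarrow> 'q)"

definition phase_measure :: "'q measure \<Rightarrow> nat \<Rightarrow> ('n :: finite, 'q) state measure" where
  "phase_measure vol N = (\<Pi>\<^sub>M i\<in>{..<N}. lborel) \<Otimes>\<^sub>M (\<Pi>\<^sub>M i\<in>{..<N}. vol)"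

definition others :: "nat \<Rightarrow> nat \<Rightarrow> (nat \<Rightarrow> 'q) \<Rightarrow> (nat \<Rightarrow> 'q)" where
  "others N i q = (\<lambda>j\<in>{..<N-1}. if j < i then q j else q (Suc j))"

definition hamiltonian ::
    "(nat \<Rightarrow> 'q \<Rightarrow> (nat \<Rightarrow> 'q) \<Rightarrow> real) \<Rightarrow> nat \<Rightarrow> ('n :: finite, 'q) state \<Rightarrow> real" where
  "hamiltonian V N = (\<lambda>(p, q). \<Sum>i<N. (norm (p i))\<^sup>2 / 2 + V N (q i) (others N i q))"

definition energy_per_particle ::
    "(nat \<Rightarrow> 'q \<Rightarrow> (nat \<Rightarrow> 'q) \<Rightarrow> real) \<Rightarrow> nat \<Rightarrow> ('n :: finite, 'q) state \<Rightarrow> real" where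
  "energy_per_particle V N \<omega> = hamiltonian V N \<omega> / real N"

definition kinetic_energy :: "nat \<Rightarrow> ('n :: finite, 'q) state \<Rightarrow> real" where
  "kinetic_energy N = (\<lambda>(p, q). \<Sum>j<N. (norm (p j))\<^sup>2 / 2)"


section \<open>Canonical measure\<close>

text \<open>
  In what follows the argument \<open>TYPE('n)\<close> fixes the momentum space \<open>\<real>\<^sup>n\<close> where it does not occur
  in the type of another argument.
\<close>

definition partition_function ::
    "'n :: finite itself \<Rightarrow> 'q measure \<Rightarrow> (nat \<Rightarrow> 'q \<Rightarrow> (nat \<Rightarrow> 'q) \<Rightarrow> real) \<Rightarrow> nat \<Rightarrow> real \<Rightarrow> ennreal" where
  "partition_function T vol V N \<beta> =
     (\<integral>\<^sup>+\<omega>. ennreal (exp (- \<beta> * hamiltonian V N \<omega>))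
        \<partial>(phase_measure vol N :: ('n, 'q) state measure))"

text \<open>
  The following is meaningful if the partition function is finite; it is positive anyway, since a
  (nonempty) manifold has positive volume.
\<close>

definition free_energy ::
    "'n :: finite itself \<Rightarrow> 'q measure \<Rightarrow> (nat \<Rightarrow> 'q \<Rightarrow> (nat \<Rightarrow> 'q) \<Rightarrow> real) \<Rightarrow> nat \<Rightarrow> real \<Rightarrow> real" where
  "free_energy T vol V N \<beta> = ln (enn2real (partition_function T vol V N \<beta>)) / real N"

definition canonical ::
    "'q measure \<Rightarrow> (nat \<Rightarrow> 'q \<Rightarrow> (nat \<Rightarrow> 'q) \<Rightarrow> real) \<Rightarrow> nat \<Rightarrow> real \<Rightarrow> ('n :: finite, 'q) state measure" where
  "canonical vol V N \<beta> = density (phase_measure vol N)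
     (\<lambda>\<omega>. ennreal (exp (- \<beta> * hamiltonian V N \<omega> - real N * free_energy TYPE('n) vol V N \<beta>)))"

definition mean_energy ::
    "'n :: finite itself \<Rightarrow> 'q measure \<Rightarrow> (nat \<Rightarrow> 'q \<Rightarrow> (nat \<Rightarrow> 'q) \<Rightarrow> real) \<Rightarrow> nat \<Rightarrow> real \<Rightarrow> real" where
  "mean_energy T vol V N \<beta> =
     (\<integral>\<omega>. energy_per_particle V N \<omega> \<partial>(canonical vol V N \<beta> :: ('n, 'q) state measure))"

definition L2_norm_canonical ::
    "'q measure \<Rightarrow> (nat \<Rightarrow> 'q \<Rightarrow> (nat \<Rightarrow> 'q) \<Rightarrow> real) \<Rightarrow> nat \<Rightarrow> real \<Rightarrow>
     (('n :: finite, 'q) state \<Rightarrow> real) \<Rightarrow> real" where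
  "L2_norm_canonical vol V N \<beta> A = sqrt (\<integral>\<omega>. (A \<omega>)\<^sup>2 \<partial>(canonical vol V N \<beta>))"

definition heat_capacity ::
    "'n :: finite itself \<Rightarrow> 'q measure \<Rightarrow> (nat \<Rightarrow> 'q \<Rightarrow> (nat \<Rightarrow> 'q) \<Rightarrow> real) \<Rightarrow> nat \<Rightarrow> real \<Rightarrow> real" where
  "heat_capacity T vol V N \<beta> = \<beta>\<^sup>2 * (deriv ^^ 2) (free_energy T vol V N) \<beta>"


section \<open>Microcanonical averages\<close>

definition energy_density ::
    "'n :: finite itself \<Rightarrow> 'q measure \<Rightarrow> (nat \<Rightarrow> 'q \<Rightarrow> (nat \<Rightarrow> 'q) \<Rightarrow> real) \<Rightarrow> nat \<Rightarrow> real \<Rightarrow> real \<Rightarrow> real" where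
  "energy_density T vol V N \<beta> u =
     enn2real (RN_deriv lborel
       (distr (canonical vol V N \<beta> :: ('n, 'q) state measure) lborel (energy_per_particle V N)) u)"

text \<open>
  \<open>g\<close> is a version of \<open>u \<mapsto> \<langle>A|u\<rangle>\<close>. Test functions \<open>F\<close> are those for which the left-hand
  side of the defining identity exists. Versions agree wherever they are continuous and the energy
  density is positive in a neighbourhood.
\<close>

definition microcanonical_average ::
    "'q measure \<Rightarrow> (nat \<Rightarrow> 'q \<Rightarrow> (nat \<Rightarrow> 'q) \<Rightarrow> real) \<Rightarrow> nat \<Rightarrow> real \<Rightarrow>
     (('n :: finite, 'q) state \<Rightarrow> real) \<Rightarrow> (real \<Rightarrow> real) \<Rightarrow> bool" where
  "microcanonical_average vol V N \<beta> A g \<longleftrightarrow>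
     g \<in> borel_measurable borel \<and>
     (\<forall>F \<in> borel_measurable borel.
        integrable (canonical vol V N \<beta>) (\<lambda>\<omega>. A \<omega> * F (energy_per_particle V N \<omega>)) \<longrightarrow>
        integrable lborel (\<lambda>u. F u * g u * energy_density TYPE('n) vol V N \<beta> u) \<and>
        (\<integral>\<omega>. A \<omega> * F (energy_per_particle V N \<omega>) \<partial>(canonical vol V N \<beta>)) =
          (\<integral>u. F u * g u * energy_density TYPE('n) vol V N \<beta> u \<partial>lborel))"

text \<open>\<open>mc N A u\<close> stands for \<open>\<langle>A|u\<rangle>\<^sub>N\<close>.\<close>

definition microcanonical_variance ::
    "(nat \<Rightarrow> (('n :: finite, 'q) state \<Rightarrow> real) \<Rightarrow> real \<Rightarrow> real) \<Rightarrow>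
     nat \<Rightarrow> (('n, 'q) state \<Rightarrow> real) \<Rightarrow> real \<Rightarrow> real" where
  "microcanonical_variance mc N A u = mc N (\<lambda>\<omega>. (A \<omega>)\<^sup>2) u - (mc N A u)\<^sup>2"

text \<open>
  Existence of the \<open>k\<close>-th derivative \<open>(deriv ^^ k) g x\<close> at a point.
\<close>

primrec times_differentiable_at :: "nat \<Rightarrow> (real \<Rightarrow> real) \<Rightarrow> real \<Rightarrow> bool" where
  "times_differentiable_at 0 g x \<longleftrightarrow> True"
| "times_differentiable_at (Suc k) g x \<longleftrightarrow>
     (\<forall>\<^sub>F y in nhds x. times_differentiable_at k g y) \<and> (deriv ^^ k) g field_differentiable at x"

end

theory Submission
  imports Defs
begin

text \<open>
  Write \<open>H = K + U\<close>, \<open>h = H / N\<close>, \<open>m = n N / 2\<close>, \<open>g = \<langle>K|\<cdot>\<rangle>\<close> and \<open>G = \<langle>K\<^sup>2|\<cdot>\<rangle>\<close>.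
  Dilating the momenta multiplies \<open>K\<close> by \<open>s\<close> and the reference measure by \<open>s\<close> to the power \<open>m\<close>,
  independently of the positions. Differentiating this invariance gives
  \<open>\<langle>K\<^sup>j\<^sup>+\<^sup>1 \<phi>'(H)\<rangle> = \<langle>(\<beta> K\<^sup>j\<^sup>+\<^sup>1 - (m + j) K\<^sup>j) \<phi>(H)\<rangle>\<close>. For \<open>\<phi> = 1\<close> these are the moments of \<open>K\<close>;
  with \<open>\<phi>\<close> concentrated near \<open>u = \<langle>h\<rangle>\<close>, eliminating the density of \<open>h\<close> between \<open>j = 0\<close> and \<open>j = 1\<close>
  leaves the exact relation
  \<open>(g G' - G g') / N + m G - (m + 1) g\<^sup>2 = 0\<close> at \<open>u\<close>, so that the microcanonical variance \<open>G - g\<^sup>2\<close>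
  follows to leading order from the leading orders of \<open>g\<close>, \<open>G\<close>, \<open>g'\<close>, \<open>G'\<close> at \<open>u\<close>.

  For these, expand \<open>g\<close> (or \<open>G\<close>) to second order in \<open>X = \<surd>N (h - u)\<close> and test against \<open>exp (t X)\<close>
  with \<open>t = -1, 0, 1\<close>. This test function merely shifts the inverse temperature to
  \<open>\<beta> - t / \<surd>N\<close>, where the canonical means are explicit and \<open>X\<close> has mean close to \<open>t f''(\<beta>)\<close> and
  variance close to \<open>f''(\<beta>)\<close>. The three equations determine the three Taylor coefficients. Since
  \<open>K - \<langle>K\<rangle>\<close> is smaller than \<open>K\<close> in \<open>L\<^sup>2\<close> by a factor \<open>\<surd>N\<close>, the tails \<open>|X| > b \<surd>(log N)\<close> need only
  have vanishing weight, so that any \<open>b > 0\<close> will do.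
\<close>

section \<open>Thermodynamics of a system whose kinetic energy can be rescaled\<close>

text \<open>Expanding \<open>g\<close> and \<open>G\<close> alone cannot give the variance: they are
  of order N and N^2 and are found only up to a relative error o(1), whereas \<open>G - g^2\<close>
  is of order N. The exact relation repairs this. It reads
  \<open>m (G - g^2) = g^2 - (g G' - G g') / N\<close>, where \<open>m\<close> is of order N and
  each term on the right is of order N^2, so that a relative error o(1) on the right becomes an
  error o(N) in the variance. To leading order \<open>g' = m / (\<beta>^2 f'')\<close> and
  \<open>G' = 2 m^2 / (\<beta>^3 f'')\<close>, the chain rule for \<open>m / \<beta>\<close> and
  \<open>m^2 / \<beta>^2\<close> along \<open>du / d\<beta> = - f''\<close>; hence
  \<open>g G' - G g'\<close> is \<open>m^3 / (\<beta>^4 f'')\<close>, the source of the heat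
  capacity term. Averages at the single energy \<open>u\<close> are therefore reached only through
  integrals against test functions of \<open>H\<close>: bumps for the exact relation, exponentials
  for the expansions.\<close>

lemma has_real_derivative_integral:
  fixes F F' :: "real \<Rightarrow> 'a \<Rightarrow> real"
  assumes U: "open U" "convex U" "s \<in> U"
    and F: "\<And>t. t \<in> U \<Longrightarrow> integrable M (F t)"
    and D: "\<And>t x. t \<in> U \<Longrightarrow> x \<in> space M \<Longrightarrow> ((\<lambda>t. F t x) has_real_derivative F' t x) (at t)"
    and F'[measurable]: "F' s \<in> borel_measurable M"
    and G: "integrable M G"
    and bound: "\<And>t x. t \<in> U \<Longrightarrow> x \<in> space M \<Longrightarrow> \<bar>F' t x\<bar> \<le> G x"
  shows "((\<lambda>t. \<integral>x. F t x \<partial>M) has_real_derivative (\<integral>x. F' s x \<partial>M)) (at s)"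
    and "integrable M (F' s)"
proof -
  show "integrable M (F' s)"
    by (rule Bochner_Integration.integrable_bound[OF G]) (use bound[OF U(3)] in fastforce)+
  \<comment> \<open>By the mean value inequality \<open>G\<close> dominates all difference
    quotients; dominated convergence then applies along every sequence tending to
    \<open>s\<close>.\<close>
  have lip: "\<bar>F t x - F s x\<bar> \<le> G x * \<bar>t - s\<bar>" if t: "t \<in> U" and x: "x \<in> space M" for t x
    using field_differentiable_bound[OF \<open>convex U\<close>, of "\<lambda>t. F t x" "\<lambda>t. F' t x" "G x" t s]
      D[OF _ x] bound[OF _ x] t U by (auto intro: has_field_derivative_at_within)
  show "((\<lambda>t. \<integral>x. F t x \<partial>M) has_real_derivative (\<integral>x. F' s x \<partial>M)) (at s)"
    unfolding has_field_derivative_iff tendsto_at_iff_sequentially comp_def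
  proof safe
    fix X assume X: "\<forall>i. X i \<in> UNIV - {s}" "X \<longlonglongrightarrow> s"
    have ev: "eventually (\<lambda>i. X i \<in> U) sequentially"
      using X(2) U by (auto simp: tendsto_def)
    then obtain k where k: "\<And>i. X (i + k) \<in> U"
      unfolding eventually_sequentially by (metis le_add2)
    let ?q = "\<lambda>i x. (F (X (i + k)) x - F s x) / (X (i + k) - s)"
    have ne: "X (i + k) \<noteq> s" for i using X(1) by auto
    have "(\<lambda>i. \<integral>x. ?q i x \<partial>M) \<longlonglongrightarrow> (\<integral>x. F' s x \<partial>M)"
    proof (rule integral_dominated_convergence[where w = G])
      show "?q i \<in> borel_measurable M" for i
        using F[OF k[of i]] F[OF U(3)] by auto
      show "AE x in M. (\<lambda>i. ?q i x) \<longlonglongrightarrow> F' s x"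
      proof (rule AE_I2)
        fix x assume x: "x \<in> space M"
        have "((\<lambda>t. (F t x - F s x) / (t - s)) \<longlongrightarrow> F' s x) (at s)"
          using D[OF U(3) x] by (simp add: has_field_derivative_iff)
        moreover have "(\<lambda>i. X (i + k)) \<longlonglongrightarrow> s" using X(2) by (rule LIMSEQ_ignore_initial_segment)
        ultimately show "(\<lambda>i. ?q i x) \<longlonglongrightarrow> F' s x"
          unfolding tendsto_at_iff_sequentially comp_def using ne by auto
      qed
      show "AE x in M. norm (?q i x) \<le> G x" for i
        using lip[OF k] ne[of i] by (auto simp: field_simps)
    qed (use G in auto)
    also have "(\<lambda>i. \<integral>x. ?q i x \<partial>M)
        = (\<lambda>i. ((\<integral>x. F (X (i + k)) x \<partial>M) - (\<integral>x. F s x \<partial>M)) / (X (i + k) - s))"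
      using F[OF k] F[OF U(3)] by (simp add: Bochner_Integration.integral_diff)
    finally show "(\<lambda>i. ((\<integral>x. F (X i) x \<partial>M) - (\<integral>x. F s x \<partial>M)) / (X i - s)) \<longlonglongrightarrow> (\<integral>x. F' s x \<partial>M)"
      by (rule LIMSEQ_offset)
  qed
qed

lemma power_le_exp:
  fixes x c :: real
  assumes "0 \<le> x" "0 < c"
  shows "x ^ j \<le> fact j / c ^ j * exp (c * x)"
proof -
  have "(c * x) ^ j /\<^sub>R fact j \<le> (\<Sum>k. (c * x) ^ k /\<^sub>R fact k)"
    using assms sum_le_suminf[OF summable_exp_generic[of "c * x"], of "{j}"]
    by auto
  then have "(c * x) ^ j / fact j \<le> exp (c * x)"
    by (simp add: exp_def divide_inverse mult.commute)
  then show ?thesis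
    using assms by (simp add: field_simps power_mult_distrib)
qed

text \<open>The number \<open>m\<close> stands for half the number of momentum coordinates: \<open>K\<close> is quadratic in them, so
  scaling \<open>K\<close> by \<open>s\<close> scales each of them by \<open>\<surd>s\<close>.\<close>

locale scaled_energy =
  fixes M :: "'a measure" and K U :: "'a \<Rightarrow> real" and m :: real
  assumes K_measurable[measurable]: "K \<in> borel_measurable M"
    and U_measurable[measurable]: "U \<in> borel_measurable M"
    and K_nonneg: "\<And>x. 0 \<le> K x"
    and m_pos: "0 < m"
    and scaling: "\<And>s. 0 < s \<Longrightarrow> distr M borel (\<lambda>x. (s * K x, U x)) =
        density (distr M borel (\<lambda>x. (K x, U x))) (\<lambda>_. ennreal (s powr - m))"
    and finite_partition: "\<And>b. 0 < b \<Longrightarrow> (\<integral>\<^sup>+x. ennreal (exp (- b * (K x + U x))) \<partial>M) < \<infinity>"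
    and nonzero: "emeasure M (space M) \<noteq> 0"
begin

definition H :: "'a \<Rightarrow> real" where "H x = K x + U x"

abbreviation "w b x \<equiv> exp (- b * H x)"

lemma H_measurable[measurable]: "H \<in> borel_measurable M"
  unfolding H_def by measurable

lemma pair_measurable[measurable]: "(\<lambda>x. (s * K x, U x)) \<in> borel_measurable M"
   "(\<lambda>x. (K x, U x)) \<in> borel_measurable M"
  unfolding borel_prod[symmetric] by measurable

lemma scaled_nn_integral:
  assumes [measurable]: "\<Phi> \<in> borel_measurable borel" and s: "0 < s"
  shows "(\<integral>\<^sup>+x. \<Phi> (s * K x, U x) \<partial>M) = ennreal (s powr - m) * (\<integral>\<^sup>+x. \<Phi> (K x, U x) \<partial>M)"
proof -
  have "(\<integral>\<^sup>+x. \<Phi> (s * K x, U x) \<partial>M) = (\<integral>\<^sup>+y. \<Phi> y \<partial>distr M borel (\<lambda>x. (s * K x, U x)))"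
    by (simp add: nn_integral_distr)
  also have "\<dots> = ennreal (s powr - m) * (\<integral>\<^sup>+x. \<Phi> (K x, U x) \<partial>M)"
    unfolding scaling[OF s] by (simp add: nn_integral_density nn_integral_cmult nn_integral_distr)
  finally show ?thesis .
qed

lemma scaled_integrable:
  fixes \<Phi> :: "real \<times> real \<Rightarrow> real"
  assumes [measurable]: "\<Phi> \<in> borel_measurable borel" and s: "0 < s"
    and "integrable M (\<lambda>x. \<Phi> (K x, U x))"
  shows "integrable M (\<lambda>x. \<Phi> (s * K x, U x))"
proof -
  have "integrable (distr M borel (\<lambda>x. (s * K x, U x))) \<Phi>"
    unfolding scaling[OF s] using assms(3)
    by (subst integrable_density) (auto simp: integrable_distr_eq)
  then show ?thesis by (simp add: integrable_distr_eq)
qed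

lemma scaled_integral:
  fixes \<Phi> :: "real \<times> real \<Rightarrow> real"
  assumes [measurable]: "\<Phi> \<in> borel_measurable borel" and s: "0 < s"
  shows "(\<integral>x. \<Phi> (s * K x, U x) \<partial>M) = s powr - m * (\<integral>x. \<Phi> (K x, U x) \<partial>M)"
proof -
  have "(\<integral>x. \<Phi> (s * K x, U x) \<partial>M) = (\<integral>y. \<Phi> y \<partial>distr M borel (\<lambda>x. (s * K x, U x)))"
    by (simp add: integral_distr)
  also have "\<dots> = s powr - m * (\<integral>x. \<Phi> (K x, U x) \<partial>M)"
    unfolding scaling[OF s] by (simp add: integral_density integral_distr)
  finally show ?thesis .
qed

text \<open>Finiteness is assumed only for equal rates in \<open>K\<close> and \<open>U\<close>.
  Dilating \<open>K\<close> by \<open>b / a\<close> separates the two rates at the price of a finite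
  factor. This freedom is needed when \<open>K\<close> is dilated inside an integral and when a
  power of \<open>K\<close> has to be absorbed.\<close>

lemma integrable_exp:
  assumes a: "0 < a" and b: "0 < b"
  shows "integrable M (\<lambda>x. exp (- (b * K x) - a * U x))"
proof -
  have "integrable M (\<lambda>x. exp (- (a * (K x + U x))))"
    using finite_partition[OF a] by (intro integrableI_bounded) auto
  moreover have "(\<lambda>y :: real \<times> real. exp (- (a * (fst y + snd y)))) \<in> borel_measurable borel"
    unfolding borel_prod[symmetric] by measurable
  ultimately have "integrable M (\<lambda>x. exp (- (a * (b / a * K x + U x))))"
    using scaled_integrable[of "\<lambda>y. exp (- (a * (fst y + snd y)))", OF _ divide_pos_pos[OF b a]] by simp
  also have "(\<lambda>x. exp (- (a * (b / a * K x + U x)))) = (\<lambda>x. exp (- (b * K x) - a * U x))"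
    using a by (auto simp: fun_eq_iff algebra_simps)
  finally show ?thesis .
qed

lemma integrable_K_power_exp:
  assumes a: "0 < a" and b: "0 < b"
  shows "integrable M (\<lambda>x. K x ^ j * exp (- (b * K x) - a * U x))"
proof (rule Bochner_Integration.integrable_bound)
  \<comment> \<open>Half of the rate in \<open>K\<close> is given up to absorb the power.\<close>
  show "integrable M (\<lambda>x. fact j / (b / 2) ^ j * exp (- (b / 2 * K x) - a * U x))"
    using integrable_exp[OF a half_gt_zero[OF b]] by (intro integrable_mult_right) simp
  show "AE x in M. norm (K x ^ j * exp (- (b * K x) - a * U x))
      \<le> norm (fact j / (b / 2) ^ j * exp (- (b / 2 * K x) - a * U x))"
  proof (rule AE_I2)
    fix x
    have "K x ^ j * exp (- (b * K x) - a * U x)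
        \<le> fact j / (b / 2) ^ j * exp (b / 2 * K x) * exp (- (b * K x) - a * U x)"
      by (intro mult_right_mono power_le_exp K_nonneg) (use b in auto)
    also have "\<dots> = fact j / (b / 2) ^ j * exp (- (b / 2 * K x) - a * U x)"
      by (simp add: mult_exp_exp)
    finally show "norm (K x ^ j * exp (- (b * K x) - a * U x))
      \<le> norm (fact j / (b / 2) ^ j * exp (- (b / 2 * K x) - a * U x))"
      using b by (simp add: K_nonneg abs_mult)
  qed
qed simp

lemma integrable_K_power_expH:
  assumes "0 < b"
  shows "integrable M (\<lambda>x. K x ^ j * w b x)"
  using integrable_K_power_exp[OF assms assms, of j] by (simp add: H_def algebra_simps)

definition Z :: "real \<Rightarrow> real" where "Z b = (\<integral>x. w b x \<partial>M)"

lemma integrable_expH: "0 < b \<Longrightarrow> integrable M (\<lambda>x. w b x)"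
  using integrable_K_power_expH[of b 0] by simp

lemma Z_pos:
  assumes b: "0 < b"
  shows "0 < Z b"
proof -
  have "Z b \<noteq> 0"
  proof
    assume "Z b = 0"
    then have "AE x in M. w b x = 0"
      unfolding Z_def using integrable_expH[OF b] by (subst (asm) integral_nonneg_eq_0_iff_AE) auto
    then have "emeasure M (space M) = 0"
      by (simp add: AE_iff_measurable[OF _ refl])
    with nonzero show False by simp
  qed
  moreover have "0 \<le> Z b" unfolding Z_def by simp
  ultimately show ?thesis by simp
qed

text \<open>Each derivative in the inverse temperature brings down a factor \<open>- H\<close>. The
  hypothesis is made at all temperatures so that the conclusion can be fed back in, which yields the
  integrability of \<open>H\<close>, \<open>H^2\<close> and \<open>K H\<close>.\<close>

lemma exp_family:
  assumes A[measurable]: "A \<in> borel_measurable M"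
    and int: "\<And>b. 0 < b \<Longrightarrow> integrable M (\<lambda>x. A x * w b x)" and b: "0 < b"
  shows "integrable M (\<lambda>x. A x * H x * w b x)"
    and "((\<lambda>b. \<integral>x. A x * w b x \<partial>M) has_real_derivative
        - (\<integral>x. A x * H x * w b x \<partial>M)) (at b)"
proof -
  define F where "F t x = A x * exp (- t * H x)" for t x
  define F' where "F' t x = - (A x * H x * exp (- t * H x))" for t x
  \<comment> \<open>For \<open>t\<close> within \<open>b / 2\<close> of \<open>b\<close> the factor
    \<open>|H|\<close> costs \<open>exp (b |H| / 4)\<close>. The result is at most
    \<open>exp (- b H / 4)\<close> where \<open>H \<ge> 0\<close> and at most
    \<open>exp (- 2 b H)\<close> where \<open>H < 0\<close>; two exponentials occur because
    \<open>H\<close> may have either sign.\<close>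
  define G where "G x = 1 / (b / 4) * (\<bar>A x\<bar> * exp (- (b / 4) * H x) + \<bar>A x\<bar> * exp (- (2 * b) * H x))" for x
  have G: "integrable M G"
    unfolding G_def using int[of "b / 4"] int[of "2 * b"] b
    by (intro integrable_mult_right Bochner_Integration.integrable_add)
       (auto dest: integrable_abs simp: abs_mult)
  have bd: "\<bar>F' t x\<bar> \<le> G x" if "t \<in> {b / 2 <..< 3 * b / 2}" for t x
  proof -
    have "\<bar>H x\<bar> * exp (- t * H x) \<le> 1 / (b / 4) * exp (b / 4 * \<bar>H x\<bar>) * exp (- t * H x)"
      using power_le_exp[of "\<bar>H x\<bar>" "b / 4" 1] b by (intro mult_right_mono) auto
    also have "\<dots> = 1 / (b / 4) * exp (b / 4 * \<bar>H x\<bar> - t * H x)"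
      by (simp add: mult_exp_exp)
    also have "exp (b / 4 * \<bar>H x\<bar> - t * H x) \<le> exp (- (b / 4) * H x) + exp (- (2 * b) * H x)"
    proof (cases "H x \<ge> 0")
      case True
      then have "b / 4 * \<bar>H x\<bar> - t * H x \<le> - (b / 4) * H x"
        using that mult_right_mono[of "b / 2" t "H x"] by (simp add: algebra_simps)
      then have "exp (b / 4 * \<bar>H x\<bar> - t * H x) \<le> exp (- (b / 4) * H x)" by simp
      then show ?thesis by (smt (verit) exp_ge_zero)
    next
      case False
      then have "b / 4 * \<bar>H x\<bar> - t * H x \<le> - (2 * b) * H x"
        using that mult_right_mono_neg[of t "3 * b / 2" "H x"]
           mult_nonneg_nonpos[of b "H x"] b by (simp add: algebra_simps)
      then have "exp (b / 4 * \<bar>H x\<bar> - t * H x) \<le> exp (- (2 * b) * H x)" by simp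
      then show ?thesis by (smt (verit) exp_ge_zero)
    qed
    finally have *: "\<bar>H x\<bar> * exp (- t * H x) \<le> 1 / (b / 4) * (exp (- (b / 4) * H x) + exp (- (2 * b) * H x))"
      using mult_left_mono[of _ _ "1 / (b / 4)"] b by force
    have "\<bar>A x\<bar> * (\<bar>H x\<bar> * exp (- t * H x))
        \<le> \<bar>A x\<bar> * (1 / (b / 4) * (exp (- (b / 4) * H x) + exp (- (2 * b) * H x)))"
      by (rule mult_left_mono[OF *]) simp
    then show ?thesis by (simp add: F'_def G_def abs_mult algebra_simps)
  qed
  have "((\<lambda>t. F t x) has_real_derivative F' t x) (at t)" for t x
    unfolding F_def F'_def by (auto intro!: derivative_eq_intros)
  moreover have "integrable M (F t)" if "t \<in> {b / 2 <..< 3 * b / 2}" for t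
    unfolding F_def using that b by (intro int) auto
  moreover have "F' b \<in> borel_measurable M"
    unfolding F'_def by measurable
  ultimately have "((\<lambda>t. \<integral>x. F t x \<partial>M) has_real_derivative (\<integral>x. F' b x \<partial>M)) (at b)"
    and "integrable M (\<lambda>x. - F' b x)"
    by (intro Bochner_Integration.integrable_minus has_real_derivative_integral[of "{b / 2 <..< 3 * b / 2}" b M F F' G];
        use bd G b in simp)+
  then show "integrable M (\<lambda>x. A x * H x * w b x)"
    and "((\<lambda>b. \<integral>x. A x * w b x \<partial>M) has_real_derivative
        - (\<integral>x. A x * H x * w b x \<partial>M)) (at b)"
    by (simp_all add: F_def F'_def)
qed

lemma integrable_K_power_bounded:
  assumes b: "0 < b" and [measurable]: "f \<in> borel_measurable M" and f: "\<And>x. \<bar>f x\<bar> \<le> B"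
  shows "integrable M (\<lambda>x. K x ^ i * f x * w b x)"
proof (rule Bochner_Integration.integrable_bound)
  show "integrable M (\<lambda>x. B * (K x ^ i * w b x))"
    by (intro integrable_mult_right integrable_K_power_expH b)
  have "\<bar>f x\<bar> * (K x ^ i * w b x) \<le> B * (K x ^ i * w b x)" for x
    using f[of x] K_nonneg[of x] by (intro mult_right_mono) auto
  moreover have "0 \<le> B" using f[of undefined] by linarith
  ultimately show "AE x in M. norm (K x ^ i * f x * w b x) \<le> norm (B * (K x ^ i * w b x))"
    by (auto simp: abs_mult K_nonneg mult_ac)
qed simp

text \<open>This is the derivative at \<open>s = 1\<close> of the scaling relation for the integral of \<open>K\<^sup>j \<phi>(H) e\<^sup>-\<^sup>b\<^sup>H\<close>.\<close>

lemma weak_identity: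
  assumes D: "\<And>y. (\<phi> has_real_derivative \<phi>' y) (at y)"
    and bd: "\<And>y. \<bar>\<phi> y\<bar> \<le> B" "\<And>y. \<bar>\<phi>' y\<bar> \<le> B"
    and [measurable]: "\<phi>' \<in> borel_measurable borel" and b: "0 < b"
  shows "(\<integral>x. K x ^ Suc j * \<phi>' (H x) * w b x \<partial>M)
      = b * (\<integral>x. K x ^ Suc j * \<phi> (H x) * w b x \<partial>M) - (m + j) * (\<integral>x. K x ^ j * \<phi> (H x) * w b x \<partial>M)"
proof -
  have [measurable]: "\<phi> \<in> borel_measurable borel"
    using D by (intro borel_measurable_continuous_onI) (meson DERIV_isCont continuous_at_imp_continuous_on)
  have B: "0 \<le> B" using bd(1)[of 0] by simp
  define \<Phi> where "\<Phi> y = fst y ^ j * \<phi> (fst y + snd y) * exp (- b * (fst y + snd y))" for y :: "real \<times> real"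
  have [measurable]: "\<Phi> \<in> borel_measurable borel"
    unfolding \<Phi>_def borel_prod[symmetric] by measurable
  define F where "F s x = \<Phi> (s * K x, U x)" for s x
  define F' where "F' s x = (real j * s ^ (j - 1) * K x ^ j * \<phi> (s * K x + U x)
      + (s * K x) ^ j * K x * \<phi>' (s * K x + U x) - b * (s * K x) ^ j * K x * \<phi> (s * K x + U x))
      * exp (- b * (s * K x + U x))" for s x
  \<comment> \<open>A dominating function for \<open>1/2 < s < 2\<close>: there
    \<open>exp (- b s K)\<close> is at most \<open>exp (- b K / 2)\<close>, while the rate in
    \<open>U\<close> stays \<open>b\<close>. This is where unequal rates arise.\<close>
  define G where "G x = (j * 2 ^ (j - 1) * B) * (K x ^ j * exp (- (b / 2 * K x) - b * U x))
     + (2 ^ j * (1 + b) * B) * (K x ^ Suc j * exp (- (b / 2 * K x) - b * U x))" for x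
  note int_bd = integrable_K_power_bounded[OF b, where B = B]
  have F1: "integrable M (\<lambda>x. \<Phi> (K x, U x))"
    unfolding \<Phi>_def using int_bd[of "\<lambda>x. \<phi> (H x)" j] bd by (simp add: H_def)
  have Fint: "integrable M (F s)" if "0 < s" for s
    unfolding F_def using scaled_integrable[OF _ that F1] by simp
  have DF: "((\<lambda>s. F s x) has_real_derivative F' s x) (at s)" if "0 < s" for s x
  proof -
    have "((\<lambda>s. K x ^ j * (s ^ j * (\<phi> (s * K x + U x) * exp (- b * (s * K x + U x)))))
        has_real_derivative F' s x) (at s)"
      unfolding F'_def
      by (auto intro!: derivative_eq_intros DERIV_chain2[where g = "\<lambda>s. s * K x + U x", OF D])
         (simp add: algebra_simps power_mult_distrib)
    then show ?thesis by (simp add: F_def \<Phi>_def power_mult_distrib algebra_simps)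
  qed
  have G: "integrable M G"
    unfolding G_def by (intro Bochner_Integration.integrable_add integrable_mult_right integrable_K_power_exp) (use b in auto)
  have F'_bd: "\<bar>F' s x\<bar> \<le> G x" if s: "s \<in> {1/2 <..< 2}" for s x
  proof -
    have 1: "\<bar>real j * s ^ (j - 1) * K x ^ j * \<phi> (s * K x + U x)\<bar> \<le> real j * 2 ^ (j - 1) * K x ^ j * B"
      unfolding abs_mult using s bd K_nonneg[of x]
      by (intro mult_mono) (auto intro!: power_mono)
    have p: "(s * K x) ^ j \<le> (2 * K x) ^ j"
      using s K_nonneg[of x] by (intro power_mono mult_right_mono) auto
    have p': "(s * K x) ^ j * (K x * \<bar>y\<bar>) \<le> (2 * K x) ^ j * (K x * B)" if "\<bar>y\<bar> \<le> B" for y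
      using p that K_nonneg[of x] by (intro mult_mono mult_left_mono) auto
    have 2: "\<bar>(s * K x) ^ j * K x * \<phi>' (s * K x + U x)\<bar> \<le> (2 * K x) ^ j * K x * B"
      using p'[OF bd(2)] s K_nonneg[of x] by (simp add: abs_mult mult.assoc)
    have 3: "\<bar>b * (s * K x) ^ j * K x * \<phi> (s * K x + U x)\<bar> \<le> b * (2 * K x) ^ j * K x * B"
      using mult_left_mono[OF p'[OF bd(1)], of b] s K_nonneg[of x] b by (simp add: abs_mult mult.assoc)
    have 4: "exp (- b * (s * K x + U x)) \<le> exp (- (b / 2 * K x) - b * U x)"
      using s b K_nonneg[of x] mult_right_mono[of "1/2" s "b * K x"] by (simp add: algebra_simps)
    have "\<bar>F' s x\<bar> \<le> (real j * 2 ^ (j - 1) * K x ^ j * B + (2 * K x) ^ j * K x * B + b * (2 * K x) ^ j * K x * B)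
        * exp (- (b / 2 * K x) - b * U x)"
      unfolding F'_def abs_mult abs_exp_cancel using 1 2 3 4 K_nonneg[of x] B b
      by (intro mult_mono) auto
    also have "\<dots> = G x" by (simp add: G_def algebra_simps power_mult_distrib)
    finally show ?thesis .
  qed
  have "((\<lambda>s. \<integral>x. F s x \<partial>M) has_real_derivative (\<integral>x. F' 1 x \<partial>M)) (at 1)"
  proof (rule has_real_derivative_integral(1)[where U = "{1/2 <..< 2}" and G = G])
    show "F' 1 \<in> borel_measurable M" unfolding F'_def by measurable
  qed (use Fint DF F'_bd G in auto)
  moreover have "((\<lambda>s. \<integral>x. F s x \<partial>M) has_real_derivative (- m * (\<integral>x. \<Phi> (K x, U x) \<partial>M))) (at 1)"
  proof (rule has_field_derivative_transform_within_open[where S = "{0<..}"])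
    show "((\<lambda>s. s powr - m * (\<integral>x. \<Phi> (K x, U x) \<partial>M)) has_real_derivative (- m * (\<integral>x. \<Phi> (K x, U x) \<partial>M))) (at 1)"
      by (auto intro!: derivative_eq_intros)
  qed (auto simp: F_def scaled_integral)
  ultimately have eq: "(\<integral>x. F' 1 x \<partial>M) = - m * (\<integral>x. \<Phi> (K x, U x) \<partial>M)"
    by (rule DERIV_unique)
  have i1: "integrable M (\<lambda>x. K x ^ j * \<phi> (H x) * w b x)"
    and i2: "integrable M (\<lambda>x. K x ^ Suc j * \<phi>' (H x) * w b x)"
    and i3: "integrable M (\<lambda>x. K x ^ Suc j * \<phi> (H x) * w b x)"
    using bd by (intro int_bd; simp)+
  have "(\<integral>x. F' 1 x \<partial>M) = (\<integral>x. real j * (K x ^ j * \<phi> (H x) * w b x)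
      + K x ^ Suc j * \<phi>' (H x) * w b x - b * (K x ^ Suc j * \<phi> (H x) * w b x) \<partial>M)"
    by (simp add: F'_def H_def algebra_simps)
  also have "\<dots> = real j * (\<integral>x. K x ^ j * \<phi> (H x) * w b x \<partial>M)
      + (\<integral>x. K x ^ Suc j * \<phi>' (H x) * w b x \<partial>M)
      - b * (\<integral>x. K x ^ Suc j * \<phi> (H x) * w b x \<partial>M)"
    using i1 i2 i3 by (simp del: power_Suc)
  finally show ?thesis using eq by (simp add: \<Phi>_def H_def algebra_simps)
qed

section \<open>Canonical expectations, their derivatives and second moments\<close>

definition E :: "real \<Rightarrow> ('a \<Rightarrow> real) \<Rightarrow> real" where
  "E b A = (\<integral>x. A x * w b x \<partial>M) / Z b"

lemma E_K_power:
  assumes b: "0 < b"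
  shows "E b (\<lambda>x. K x ^ Suc j) = (m + j) / b * E b (\<lambda>x. K x ^ j)"
proof -
  have "b * (\<integral>x. K x ^ Suc j * w b x \<partial>M) = (m + j) * (\<integral>x. K x ^ j * w b x \<partial>M)"
    using weak_identity[of "\<lambda>_. 1" "\<lambda>_. 0" 1 b j] b by simp
  then show ?thesis
    using b Z_pos[OF b] by (simp add: E_def field_simps del: power_Suc)
qed

lemma E_one: "0 < b \<Longrightarrow> E b (\<lambda>_. 1) = 1"
  using Z_pos[of b] by (simp add: E_def Z_def)

lemma E_K: "0 < b \<Longrightarrow> E b K = m / b"
  using E_K_power[of b 0] by (simp add: E_one)

lemma E_K2: "0 < b \<Longrightarrow> E b (\<lambda>x. (K x)\<^sup>2) = m * (m + 1) / b\<^sup>2"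
  using E_K_power[of b 1] by (simp add: E_K numeral_2_eq_2 field_simps)

lemma E_K4: "0 < b \<Longrightarrow> E b (\<lambda>x. (K x) ^ 4) = m * (m + 1) * (m + 2) * (m + 3) / b ^ 4"
  using E_K_power[of b 3] E_K_power[of b 2]
  by (simp add: E_K2 del: power_Suc) (simp add: power2_eq_square power4_eq_xxxx ac_simps)

lemma DERIV_E:
  assumes A[measurable]: "A \<in> borel_measurable M"
    and int: "\<And>b. 0 < b \<Longrightarrow> integrable M (\<lambda>x. A x * w b x)" and b: "0 < b"
  shows "((\<lambda>b. E b A) has_real_derivative - (E b (\<lambda>x. A x * H x) - E b A * E b H)) (at b)"
proof -
  have *: "(Z has_real_derivative - (\<integral>x. H x * w b x \<partial>M)) (at b)"
    using exp_family(2)[of "\<lambda>_. 1", OF _ _ b] integrable_expH by (simp add: Z_def[abs_def])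
  show ?thesis
    unfolding E_def using Z_pos[OF b]
    by (intro DERIV_cong[OF DERIV_divide[OF exp_family(2)[OF A int b] *]]) (auto simp: field_simps)
qed

lemma DERIV_ln_Z:
  assumes b: "0 < b"
  shows "((\<lambda>b. ln (Z b)) has_real_derivative - E b H) (at b)"
proof -
  have *: "(Z has_real_derivative - (\<integral>x. H x * w b x \<partial>M)) (at b)"
    using exp_family(2)[of "\<lambda>_. 1", OF _ _ b] integrable_expH by (simp add: Z_def[abs_def])
  show ?thesis
    unfolding E_def using Z_pos[OF b] by (auto intro!: derivative_eq_intros *)
qed

lemma integrable_H_expH: "0 < b \<Longrightarrow> integrable M (\<lambda>x. H x * w b x)"
  using exp_family(1)[of "\<lambda>_. 1"] integrable_expH by simp

lemma integrable_H2_expH: "0 < b \<Longrightarrow> integrable M (\<lambda>x. H x * H x * w b x)"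
  using exp_family(1)[of H] integrable_H_expH by simp

lemma integrable_K_expH: "0 < b \<Longrightarrow> integrable M (\<lambda>x. K x * w b x)"
  using integrable_K_power_expH[of b 1] by simp

lemma DERIV_E_H:
  "0 < b \<Longrightarrow> ((\<lambda>b. E b H) has_real_derivative - (E b (\<lambda>x. H x * H x) - (E b H)\<^sup>2)) (at b)"
  using DERIV_E[of H b] integrable_H_expH by (simp add: power2_eq_square)

text \<open>The covariance is minus the derivative of \<open>E b K\<close>, and
  \<open>E b K = m / b\<close> is explicit. It equals the variance of \<open>K\<close>, that is,
  \<open>K\<close> and \<open>U\<close> are uncorrelated.\<close>

lemma covariance_K_H:
  assumes b: "0 < b"
  shows "E b (\<lambda>x. K x * H x) - E b K * E b H = m / b\<^sup>2"
proof -
  have "((\<lambda>b. E b K) has_real_derivative - (E b (\<lambda>x. K x * H x) - E b K * E b H)) (at b)"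
    using b integrable_K_expH by (intro DERIV_E) auto
  moreover have "((\<lambda>b. E b K) has_real_derivative - (m / b\<^sup>2)) (at b)"
  proof (rule has_field_derivative_transform_within_open[where S = "{0<..}"])
    show "((\<lambda>b. m / b) has_real_derivative - (m / b\<^sup>2)) (at b)"
      using b by (auto intro!: derivative_eq_intros simp: power2_eq_square)
  qed (use b in \<open>auto simp: E_K\<close>)
  ultimately show ?thesis using DERIV_unique by fastforce
qed

lemma variance_K: "0 < b \<Longrightarrow> E b (\<lambda>x. (K x)\<^sup>2) - (E b K)\<^sup>2 = m / b\<^sup>2"
  unfolding E_K E_K2 by (simp add: power2_eq_square field_simps)

text \<open>As \<open>K\<close> is uncorrelated with \<open>U\<close>, the variance of \<open>H\<close> is at least that of \<open>K\<close>; this keeps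
  \<open>f''\<close> away from \<open>0\<close>.\<close>

lemma variance_H_ge:
  assumes b: "0 < b"
  shows "m / b\<^sup>2 \<le> E b (\<lambda>x. H x * H x) - (E b H)\<^sup>2"
proof -
  have KH: "integrable M (\<lambda>x. K x * H x * w b x)"
    using b integrable_K_expH by (intro exp_family(1)) auto
  have K2: "integrable M (\<lambda>x. (K x)\<^sup>2 * w b x)"
    using b by (rule integrable_K_power_expH)
  \<comment> \<open>With this \<open>c\<close> the function \<open>H - K - c\<close> is
    \<open>U\<close> minus its mean; the estimate says that the variance of \<open>U\<close> is
    nonnegative.\<close>
  define c where "c = E b H - E b K"
  have "0 \<le> (\<integral>x. (H x - K x - c)\<^sup>2 * w b x \<partial>M)" by simp
  also have "\<dots> = (\<integral>x. H x * H x * w b x + (K x)\<^sup>2 * w b x + c\<^sup>2 * w b x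
      - 2 * (K x * H x * w b x) - (2 * c) * (H x * w b x) + (2 * c) * (K x * w b x) \<partial>M)"
    by (simp add: power2_eq_square algebra_simps)
  also have "\<dots> = (\<integral>x. H x * H x * w b x \<partial>M) + (\<integral>x. (K x)\<^sup>2 * w b x \<partial>M)
      + c\<^sup>2 * (\<integral>x. w b x \<partial>M) - 2 * (\<integral>x. K x * H x * w b x \<partial>M)
      - (2 * c) * (\<integral>x. H x * w b x \<partial>M) + (2 * c) * (\<integral>x. K x * w b x \<partial>M)"
    using KH K2 integrable_expH[OF b] integrable_H_expH[OF b] integrable_H2_expH[OF b] integrable_K_expH[OF b]
    by simp
  also have "\<dots> = Z b * (E b (\<lambda>x. H x * H x) + E b (\<lambda>x. (K x)\<^sup>2) + c\<^sup>2
      - 2 * E b (\<lambda>x. K x * H x) - 2 * c * E b H + 2 * c * E b K)"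
    using Z_pos[OF b] unfolding E_def by (simp add: Z_def field_simps)
  finally have "0 \<le> E b (\<lambda>x. H x * H x) + E b (\<lambda>x. (K x)\<^sup>2) + c\<^sup>2
      - 2 * E b (\<lambda>x. K x * H x) - 2 * c * E b H + 2 * c * E b K"
    using Z_pos[OF b] by (simp add: zero_le_mult_iff)
  also have "\<dots> = (E b (\<lambda>x. H x * H x) - (E b H)\<^sup>2) + (E b (\<lambda>x. (K x)\<^sup>2) - (E b K)\<^sup>2)
      - 2 * (E b (\<lambda>x. K x * H x) - E b K * E b H)"
    unfolding c_def by (simp add: power2_eq_square algebra_simps)
  also have "\<dots> = (E b (\<lambda>x. H x * H x) - (E b H)\<^sup>2) + m / b\<^sup>2 - 2 * (m / b\<^sup>2)"
    unfolding covariance_K_H[OF b] variance_K[OF b] ..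
  finally show ?thesis by simp
qed

end

section \<open>The differential relation between the microcanonical moments\<close>

context scaled_energy
begin

text \<open>The set where \<open>K\<close> vanishes is unchanged by a dilation of \<open>K\<close>,
  while the scaling law multiplies its measure by \<open>2 powr - m < 1\<close>. The weight
  \<open>exp (- U)\<close> equals \<open>exp (- H)\<close> there, so the weighted measure is finite
  and hence zero.\<close>

lemma AE_K_pos: "AE x in M. 0 < K x"
proof -
  define \<Phi> where "\<Phi> y = indicator {0} (fst y) * ennreal (exp (- snd y))" for y :: "real \<times> real"
  have [measurable]: "\<Phi> \<in> borel_measurable borel"
    unfolding \<Phi>_def borel_prod[symmetric] by measurable
  define I where "I = (\<integral>\<^sup>+x. \<Phi> (K x, U x) \<partial>M)"
  have "\<Phi> (2 * K x, U x) = \<Phi> (K x, U x)" for x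
    by (auto simp: \<Phi>_def indicator_def)
  then have "I = ennreal (2 powr - m) * I"
    using scaled_nn_integral[of \<Phi> 2] by (simp add: I_def)
  moreover have "I < \<infinity>"
  proof -
    have "I \<le> (\<integral>\<^sup>+x. ennreal (exp (- 1 * (K x + U x))) \<partial>M)"
      unfolding I_def \<Phi>_def by (intro nn_integral_mono) (auto simp: indicator_def)
    with finite_partition[of 1] show ?thesis by simp
  qed
  ultimately have "I = 0"
  proof (cases I)
    case (real r)
    with \<open>I = ennreal (2 powr - m) * I\<close> have "r = 2 powr - m * r"
      by (metis ennreal_inj ennreal_mult mult_nonneg_nonneg powr_ge_zero)
    moreover have "2 powr - m < 1" using m_pos powr_less_mono[of "- m" 0 2] by simp
    ultimately show ?thesis using real by auto
  qed auto
  then have "AE x in M. \<Phi> (K x, U x) = 0"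
    unfolding I_def by (subst (asm) nn_integral_0_iff_AE) auto
  then show ?thesis
    by eventually_elim (use K_nonneg in \<open>auto simp: \<Phi>_def indicator_def less_le\<close>)
qed

text \<open>A gap in the energy distribution around its mean would, by rescaling \<open>K\<close>, force
  \<open>U\<close> and hence \<open>H\<close> to stay above the mean.\<close>

lemma mean_energy_in_support:
  assumes b: "0 < b" and \<epsilon>: "0 < \<epsilon>"
  shows "\<not> (AE x in M. \<epsilon> \<le> \<bar>H x - E b H\<bar>)"
proof
  assume gap: "AE x in M. \<epsilon> \<le> \<bar>H x - E b H\<bar>"
  define e where "e = E b H"
  define \<Phi> where "\<Phi> y = (indicator {v. \<bar>v - e\<bar> < \<epsilon>} (fst y + snd y) :: ennreal)" for y :: "real \<times> real"
  have [measurable]: "\<Phi> \<in> borel_measurable borel"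
    unfolding \<Phi>_def borel_prod[symmetric] by measurable
  have "(\<integral>\<^sup>+x. \<Phi> (K x, U x) \<partial>M) = 0"
    using gap by (subst nn_integral_0_iff_AE) (auto simp: \<Phi>_def H_def e_def indicator_def)
  then have "AE x in M. \<Phi> (s * K x, U x) = 0" if "0 < s" for s
    using scaled_nn_integral[OF _ that, of \<Phi>] by (subst nn_integral_0_iff_AE[symmetric]) auto
  \<comment> \<open>Rational factors keep the exceptional sets countable in number, and they suffice
    because the factors that move \<open>s K + U\<close> into the gap form an open interval.\<close>
  then have "AE x in M. \<forall>s\<in>\<rat> \<inter> {0<..}. \<Phi> (s * K x, U x) = 0"
    by (subst AE_ball_countable) (auto simp: countable_rat)
  with AE_K_pos have above: "AE x in M. e < H x"
  proof eventually_elim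
    case (elim x)
    have "e \<le> U x"
    proof (rule ccontr)
      assume "\<not> e \<le> U x"
      moreover have "(e - U x) / K x < (e - U x + \<epsilon>) / K x"
        using elim \<epsilon> by (simp add: divide_strict_right_mono)
      then obtain s where s: "s \<in> \<rat>" "(e - U x) / K x < s" "s < (e - U x + \<epsilon>) / K x"
        using Rats_dense_in_real by blast
      ultimately have "0 < s" using elim by (smt (verit) divide_pos_pos)
      then have "\<Phi> (s * K x, U x) = 0" using elim s by blast
      moreover have "\<bar>s * K x + U x - e\<bar> < \<epsilon>"
        using s elim by (simp add: field_simps)
      ultimately show False by (simp add: \<Phi>_def)
    qed
    then show ?case using elim by (simp add: H_def)
  qed
  \<comment> \<open>The weighted integral of \<open>H - e\<close> is 0, which is incompatible with
    \<open>e < H\<close> almost everywhere on a nonzero measure.\<close>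
  have int: "integrable M (\<lambda>x. (H x - e) * w b x)"
    using integrable_H_expH[OF b] integrable_expH[OF b] by (simp add: algebra_simps)
  have "(\<integral>x. (H x - e) * w b x \<partial>M)
      = (\<integral>x. H x * w b x - e * w b x \<partial>M)"
    by (simp add: algebra_simps)
  also have "\<dots> = 0"
    using integrable_H_expH[OF b] integrable_expH[OF b] Z_pos[OF b]
    by (simp add: e_def E_def Z_def)
  finally have "AE x in M. (H x - e) * w b x = 0"
    using above int
    by (subst (asm) integral_nonneg_eq_0_iff_AE) (auto elim!: eventually_mono)
  with above have "AE x in M. False" by eventually_elim auto
  then show False using nonzero by (simp add: AE_iff_measurable[OF _ refl])
qed

text \<open>The conditional expectation is stated on phase space instead of against the density of
  \<open>H / c\<close>, so that this density drops out of the argument. Integrability of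
  \<open>g F\<close> is part of the notion because the weak identities are split into
  summands.\<close>

definition conditional_version :: "real \<Rightarrow> real \<Rightarrow> ('a \<Rightarrow> real) \<Rightarrow> (real \<Rightarrow> real) \<Rightarrow> bool" where
  "conditional_version b c A g \<longleftrightarrow> g \<in> borel_measurable borel \<and>
     (\<forall>F \<in> borel_measurable borel. (\<exists>B. \<forall>y. \<bar>F y\<bar> \<le> B) \<longrightarrow>
        integrable M (\<lambda>x. g (H x / c) * F (H x / c) * w b x) \<and>
        (\<integral>x. A x * F (H x / c) * w b x \<partial>M)
          = (\<integral>x. g (H x / c) * F (H x / c) * w b x \<partial>M))"

end

text \<open>Squaring the positive part of the parabola glues it to 0 with a continuous first
  derivative, the smoothness asked of a test function here.\<close>

definition bump :: "real \<Rightarrow> real \<Rightarrow> real \<Rightarrow> real" where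
  "bump u r y = (max 0 (r\<^sup>2 - (y - u)\<^sup>2))\<^sup>2"

definition bump' :: "real \<Rightarrow> real \<Rightarrow> real \<Rightarrow> real" where
  "bump' u r y = - 4 * (y - u) * max 0 (r\<^sup>2 - (y - u)\<^sup>2)"

lemma DERIV_bump: "(bump u r has_real_derivative bump' u r y) (at y)"
proof -
  have pos: "((\<lambda>z :: real. (max 0 z)\<^sup>2) has_real_derivative 2 * max 0 z) (at z)" for z
  proof -
    consider "z < 0" | "z = 0" | "z > 0" by linarith
    then show ?thesis
    proof cases
      case 1
      have "((\<lambda>z :: real. 0) has_real_derivative 2 * max 0 z) (at z)" using 1 by simp
      then show ?thesis
        by (rule has_field_derivative_transform_within_open[where S = "{..<0}"]) (use 1 in auto)
    next
      case 2
      have "((\<lambda>h :: real. (max 0 h)\<^sup>2 / h) \<longlongrightarrow> 0) (at 0)"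
      proof (rule Lim_null_comparison)
        show "\<forall>\<^sub>F h in at 0. norm ((max 0 h)\<^sup>2 / h) \<le> \<bar>h :: real\<bar>"
          by (intro always_eventually) (auto simp: max_def power2_eq_square)
        show "((\<lambda>h. \<bar>h :: real\<bar>) \<longlongrightarrow> 0) (at 0)" by (auto intro!: tendsto_eq_intros)
      qed
      then show ?thesis using 2 by (simp add: DERIV_def)
    next
      case 3
      have "((\<lambda>z :: real. z\<^sup>2) has_real_derivative 2 * max 0 z) (at z)"
        using 3 by (auto intro!: derivative_eq_intros)
      then show ?thesis
        by (rule has_field_derivative_transform_within_open[where S = "{0<..}"]) (use 3 in auto)
    qed
  qed
  have "((\<lambda>y. r\<^sup>2 - (y - u)\<^sup>2) has_real_derivative - 2 * (y - u)) (at y)"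
    by (auto intro!: derivative_eq_intros)
  then show ?thesis
    unfolding bump_def[abs_def] by (rule DERIV_cong[OF DERIV_chain2[OF pos]]) (simp add: bump'_def)
qed

lemma bump_eq_0: "0 \<le> r \<Longrightarrow> r \<le> \<bar>y - u\<bar> \<Longrightarrow> bump u r y = 0 \<and> bump' u r y = 0"
  using power_mono[of r "\<bar>y - u\<bar>" 2] by (simp add: bump_def bump'_def)

lemma bump_pos: "\<bar>y - u\<bar> < r \<Longrightarrow> 0 < bump u r y"
  using power_strict_mono[of "\<bar>y - u\<bar>" r 2] by (simp add: bump_def)

text \<open>The weak identity asks for a bounded test function that is differentiable everywhere
  with bounded derivative, whereas \<open>g\<close> is differentiable only near \<open>u\<close>. A
  bump of radius \<open>r < \<delta>\<close> as a factor provides one; compactness of its support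
  gives the bounds.\<close>

lemma localised_test_function:
  fixes g g' :: "real \<Rightarrow> real"
  assumes r: "0 < r" "r < \<delta>"
    and D: "\<And>y. \<bar>y - u\<bar> < \<delta> \<Longrightarrow> (g has_real_derivative g' y) (at y)"
    and C: "continuous_on {y. \<bar>y - u\<bar> < \<delta>} g'"
  defines "F \<equiv> \<lambda>y. g y * bump u r y"
    and "F' \<equiv> \<lambda>y. if \<bar>y - u\<bar> < \<delta> then g' y * bump u r y + g y * bump' u r y else 0"
  shows "(F has_real_derivative F' y) (at y)"
    and "\<exists>B. \<forall>y. \<bar>F y\<bar> \<le> B \<and> \<bar>F' y\<bar> \<le> B"
    and "F \<in> borel_measurable borel" and "F' \<in> borel_measurable borel"
proof -
  let ?O = "{y. \<bar>y - u\<bar> < \<delta>}"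
  have open_O: "open ?O" by (intro open_Collect_less continuous_intros)
  have open_P: "open {y. r < \<bar>y - u\<bar>}" by (intro open_Collect_less continuous_intros)
  show D_F: "(F has_real_derivative F' y) (at y)" for y
  proof (cases "\<bar>y - u\<bar> < \<delta>")
    case True
    then show ?thesis
      unfolding F_def F'_def by (auto intro!: derivative_eq_intros D DERIV_bump)
  next
    case False
    have "((\<lambda>_. 0) has_real_derivative F' y) (at y)" using False by (simp add: F'_def)
    then show ?thesis
      by (rule has_field_derivative_transform_within_open[OF _ open_P])
         (use False r bump_eq_0 in \<open>auto simp: F_def\<close>)
  qed
  have cont_bump: "continuous_on S (bump u r)" "continuous_on S (bump' u r)" for S
    unfolding bump_def[abs_def] bump'_def[abs_def] by (intro continuous_intros)+
  have cont_g: "continuous_on ?O g"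
    using D by (auto intro!: DERIV_continuous_on intro: has_field_derivative_at_within)
  have cF: "continuous_on ?O (\<lambda>y. g y * bump u r y)"
    and cF': "continuous_on ?O (\<lambda>y. g' y * bump u r y + g y * bump' u r y)"
    by (intro continuous_intros cont_g cont_bump C)+
  show "F \<in> borel_measurable borel"
    using D_F by (intro borel_measurable_continuous_onI) (meson DERIV_isCont continuous_at_imp_continuous_on)
  show "F' \<in> borel_measurable borel"
    unfolding F'_def using borel_measurable_continuous_on_if[OF _ cF' continuous_on_const[of _ 0]] open_O
    by simp
  have K: "compact {u - r..u + r}" "{u - r..u + r} \<subseteq> ?O" using r by auto
  have "bounded ((\<lambda>y. g y * bump u r y) ` {u - r..u + r})"
    "bounded ((\<lambda>y. g' y * bump u r y + g y * bump' u r y) ` {u - r..u + r})"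
    using K by (auto intro!: compact_imp_bounded compact_continuous_image
        intro: continuous_on_subset[OF cF] continuous_on_subset[OF cF'])
  then obtain B1 B2 where
    B1: "\<And>y. y \<in> {u - r..u + r} \<Longrightarrow> \<bar>g y * bump u r y\<bar> \<le> B1" and
    B2: "\<And>y. y \<in> {u - r..u + r} \<Longrightarrow> \<bar>g' y * bump u r y + g y * bump' u r y\<bar> \<le> B2"
    unfolding bounded_iff ball_simps real_norm_def by meson
  have "\<bar>F y\<bar> \<le> max 0 (max B1 B2) \<and> \<bar>F' y\<bar> \<le> max 0 (max B1 B2)" for y
  proof (cases "y \<in> {u - r..u + r}")
    case True
    with B1[OF True] B2[OF True] r show ?thesis by (auto simp: F_def F'_def)
  next
    case False
    then have "r \<le> \<bar>y - u\<bar>" by auto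
    with bump_eq_0[of r y u] r show ?thesis by (auto simp: F_def F'_def)
  qed
  then show "\<exists>B. \<forall>y. \<bar>F y\<bar> \<le> B \<and> \<bar>F' y\<bar> \<le> B" by blast
qed

context scaled_energy
begin

text \<open>The test functions depend on \<open>H\<close> only, so the powers of \<open>K\<close> in
  \<open>weak_identity\<close> may be replaced by their conditional averages. The factor
  \<open>1 / c\<close> is the chain rule for \<open>F (H / c)\<close>.\<close>

lemma conditional_weak_identity:
  assumes b: "0 < b" and c: "0 < c"
    and g1: "conditional_version b c (\<lambda>x. K x ^ Suc j) g1"
    and g0: "conditional_version b c (\<lambda>x. K x ^ j) g0"
    and D: "\<And>y. (F has_real_derivative F' y) (at y)" and B: "\<And>y. \<bar>F y\<bar> \<le> B \<and> \<bar>F' y\<bar> \<le> B"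
    and [measurable]: "F \<in> borel_measurable borel" "F' \<in> borel_measurable borel"
  shows "integrable M (\<lambda>x. (g1 (H x / c) * F' (H x / c) / c
       - (b * g1 (H x / c) - (m + j) * g0 (H x / c)) * F (H x / c)) * w b x)"
    (is "integrable M ?I")
    and "(\<integral>x. (g1 (H x / c) * F' (H x / c) / c
       - (b * g1 (H x / c) - (m + j) * g0 (H x / c)) * F (H x / c)) * w b x \<partial>M) = 0"
proof -
  have bF: "\<exists>B. \<forall>y. \<bar>F y\<bar> \<le> B" "\<exists>B. \<forall>y. \<bar>F' y\<bar> \<le> B" using B by blast+
  have int: "integrable M (\<lambda>x. g1 (H x / c) * F' (H x / c) * w b x)"
     "integrable M (\<lambda>x. g1 (H x / c) * F (H x / c) * w b x)"
     "integrable M (\<lambda>x. g0 (H x / c) * F (H x / c) * w b x)"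
    and eq: "(\<integral>x. K x ^ Suc j * F' (H x / c) * w b x \<partial>M)
        = (\<integral>x. g1 (H x / c) * F' (H x / c) * w b x \<partial>M)"
     "(\<integral>x. K x ^ Suc j * F (H x / c) * w b x \<partial>M)
        = (\<integral>x. g1 (H x / c) * F (H x / c) * w b x \<partial>M)"
     "(\<integral>x. K x ^ j * F (H x / c) * w b x \<partial>M)
        = (\<integral>x. g0 (H x / c) * F (H x / c) * w b x \<partial>M)"
    using g1 g0 bF unfolding conditional_version_def by auto
  have *: "?I
     = (\<lambda>x. 1 / c * (g1 (H x / c) * F' (H x / c) * w b x)
       - b * (g1 (H x / c) * F (H x / c) * w b x)
       + (m + j) * (g0 (H x / c) * F (H x / c) * w b x))"
    by (auto simp: algebra_simps)
  show "integrable M ?I"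
    unfolding * using int by simp
  have "(\<integral>x. K x ^ Suc j * (F' (H x / c) / c) * w b x \<partial>M)
      = b * (\<integral>x. K x ^ Suc j * F (H x / c) * w b x \<partial>M)
      - (m + j) * (\<integral>x. K x ^ j * F (H x / c) * w b x \<partial>M)"
  proof (rule weak_identity[where \<phi> = "\<lambda>y. F (y / c)" and B = "max B (B / c)"])
    show "((\<lambda>y. F (y / c)) has_real_derivative F' (y / c) / c) (at y)" for y
      by (rule DERIV_cong[OF DERIV_chain2[OF D DERIV_cdivide[OF DERIV_ident]]]) simp
    show "\<bar>F (y / c)\<bar> \<le> max B (B / c)" for y using B by (simp add: le_max_iff_disj)
    show "\<bar>F' (y / c) / c\<bar> \<le> max B (B / c)" for y
      using B[of "y / c"] c by (simp add: le_max_iff_disj divide_right_mono)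
  qed (use b in auto)
  then have "1 / c * (\<integral>x. K x ^ Suc j * F' (H x / c) * w b x \<partial>M)
      = b * (\<integral>x. K x ^ Suc j * F (H x / c) * w b x \<partial>M)
      - (m + j) * (\<integral>x. K x ^ j * F (H x / c) * w b x \<partial>M)"
    by (simp add: mult_ac del: power_Suc)
  then show "(\<integral>x. ?I x \<partial>M) = 0"
    unfolding * eq using int by simp
qed

lemma conditional_version_one: "0 < b \<Longrightarrow> conditional_version b c (\<lambda>x. K x ^ 0) (\<lambda>_. 1)"
  unfolding conditional_version_def
proof (intro conjI ballI impI)
  fix F :: "real \<Rightarrow> real" assume b: "0 < b" and [measurable]: "F \<in> borel_measurable borel"
    and "\<exists>B. \<forall>y. \<bar>F y\<bar> \<le> B"
  then obtain B where B: "\<And>y. \<bar>F y\<bar> \<le> B" by blast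
  show "integrable M (\<lambda>x. 1 * F (H x / c) * w b x)"
    using integrable_K_power_bounded[OF b, of "\<lambda>x. F (H x / c)" B 0] B by simp
qed auto

text \<open>Both weak identities are tested against \<open>G \<psi>\<close> and \<open>g \<psi>\<close> respectively, so that the
  unknown density of the energy and the derivative of \<open>\<psi>\<close> cancel in the difference.\<close>

lemma microcanonical_ode:
  assumes b: "0 < b" and c: "0 < c"
    and g: "conditional_version b c K g" and G: "conditional_version b c (\<lambda>x. (K x)\<^sup>2) G"
    and \<delta>: "0 < \<delta>" and u: "u = E b H / c"
    and Dg: "\<And>y. \<bar>y - u\<bar> < \<delta> \<Longrightarrow> (g has_real_derivative g' y) (at y)"
    and DG: "\<And>y. \<bar>y - u\<bar> < \<delta> \<Longrightarrow> (G has_real_derivative G' y) (at y)"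
    and Cg: "continuous_on {y. \<bar>y - u\<bar> < \<delta>} g'" and CG: "continuous_on {y. \<bar>y - u\<bar> < \<delta>} G'"
  shows "(g u * G' u - G u * g' u) / c + m * G u - (m + 1) * (g u)\<^sup>2 = 0"
proof (rule ccontr)
  define \<Theta> where "\<Theta> y = (g y * G' y - G y * g' y) / c + m * G y - (m + 1) * (g y)\<^sup>2" for y
  assume "\<not> ?thesis"
  then have ne: "\<Theta> u \<noteq> 0" by (simp add: \<Theta>_def)
  \<comment> \<open>If the relation fails at \<open>u\<close>, its defect \<open>\<Theta>\<close>
    keeps the sign \<open>\<sigma>\<close> in a neighbourhood by continuity.\<close>
  define \<sigma> where "\<sigma> = sgn (\<Theta> u)"
  have "open {y. \<bar>y - u\<bar> < \<delta>}" by (intro open_Collect_less continuous_intros)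
  moreover have "continuous_on {y. \<bar>y - u\<bar> < \<delta>} g" "continuous_on {y. \<bar>y - u\<bar> < \<delta>} G"
    using Dg DG by (auto intro!: DERIV_continuous_on intro: has_field_derivative_at_within)
  then have "continuous_on {y. \<bar>y - u\<bar> < \<delta>} (\<lambda>y. \<sigma> * \<Theta> y)"
    unfolding \<Theta>_def using c by (intro continuous_intros Cg CG) auto
  ultimately have "isCont (\<lambda>y. \<sigma> * \<Theta> y) u"
    using \<delta> by (simp add: continuous_on_eq_continuous_at)
  moreover have "0 < \<sigma> * \<Theta> u" using ne by (simp add: \<sigma>_def sgn_mult_self_eq abs_sgn mult.commute flip: abs_sgn)
  ultimately have "\<forall>\<^sub>F y in nhds u. 0 < \<sigma> * \<Theta> y"
    unfolding isCont_def tendsto_at_iff_tendsto_nhds[of "\<lambda>y. \<sigma> * \<Theta> y" u] by (rule order_tendstoD(1))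
  then obtain d where d: "0 < d" "\<And>y. \<bar>y - u\<bar> < d \<Longrightarrow> 0 < \<sigma> * \<Theta> y"
    by (auto simp: eventually_nhds_metric dist_real_def)
  define r where "r = min d (\<delta> / 2)"
  have r: "0 < r" "r < \<delta>" "r \<le> d" using d \<delta> by (auto simp: r_def)
  note tG = localised_test_function[OF r(1,2) DG CG]
  note tg = localised_test_function[OF r(1,2) Dg Cg]
  let ?F1 = "\<lambda>y. G y * bump u r y"
  let ?F1' = "\<lambda>y. if \<bar>y - u\<bar> < \<delta> then G' y * bump u r y + G y * bump' u r y else 0"
  let ?F2 = "\<lambda>y. g y * bump u r y"
  let ?F2' = "\<lambda>y. if \<bar>y - u\<bar> < \<delta> then g' y * bump u r y + g y * bump' u r y else 0"
  obtain B1 where B1: "\<And>y. \<bar>?F1 y\<bar> \<le> B1 \<and> \<bar>?F1' y\<bar> \<le> B1" using tG(2) by blast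
  obtain B2 where B2: "\<And>y. \<bar>?F2 y\<bar> \<le> B2 \<and> \<bar>?F2' y\<bar> \<le> B2" using tg(2) by blast
  have g': "conditional_version b c (\<lambda>x. K x ^ Suc 0) g" using g by simp
  have G': "conditional_version b c (\<lambda>x. K x ^ Suc (Suc 0)) G" using G by (simp add: power2_eq_square)
  note w1 = conditional_weak_identity[OF b c g' conditional_version_one[OF b] tG(1) B1 tG(3,4)]
  note w2 = conditional_weak_identity[OF b c G' g' tg(1) B2 tg(3,4)]
  define L1 where "L1 y = g y * ?F1' y / c - (b * g y - (m + real 0) * 1) * ?F1 y" for y
  define L2 where "L2 y = G y * ?F2' y / c - (b * G y - (m + real (Suc 0)) * g y) * ?F2 y" for y
  \<comment> \<open>The terms with the derivative of the bump and those with the factor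
    \<open>b\<close> are the same in \<open>L1\<close> and \<open>L2\<close>; only the defect times
    the bump survives.\<close>
  have L: "L1 y - L2 y = \<Theta> y * bump u r y" for y
  proof (cases "\<bar>y - u\<bar> < \<delta>")
    case True
    then show ?thesis using c by (simp add: L1_def L2_def \<Theta>_def field_simps power2_eq_square)
  next
    case False
    then show ?thesis using bump_eq_0[of r y u] r by (simp add: L1_def L2_def)
  qed
  have wL1: "integrable M (\<lambda>x. L1 (H x / c) * w b x)" "(\<integral>x. L1 (H x / c) * w b x \<partial>M) = 0"
    using w1 unfolding L1_def by blast+
  have wL2: "integrable M (\<lambda>x. L2 (H x / c) * w b x)" "(\<integral>x. L2 (H x / c) * w b x \<partial>M) = 0"
    using w2 unfolding L2_def by blast+
  define W where "W x = \<sigma> * (L1 (H x / c) - L2 (H x / c)) * w b x" for x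
  have W: "W x = \<sigma> * (L1 (H x / c) * w b x - L2 (H x / c) * w b x)" for x
    by (simp add: W_def algebra_simps)
  have "integrable M W" "(\<integral>x. W x \<partial>M) = 0"
    unfolding W using wL1 wL2 by auto
  moreover have nonneg: "0 \<le> W x" and pos: "\<bar>H x / c - u\<bar> < r \<Longrightarrow> 0 < W x" for x
    using d(2)[of "H x / c"] bump_pos[of "H x / c" u r] bump_eq_0[of r "H x / c" u] r
    by (cases "\<bar>H x / c - u\<bar> < r"; simp add: W_def L mult.assoc[symmetric])+
  ultimately have "AE x in M. W x = 0"
    by (subst (asm) integral_nonneg_eq_0_iff_AE) auto
  \<comment> \<open>\<open>W\<close> is positive wherever \<open>H / c\<close> is within
    \<open>r\<close> of \<open>u\<close>. Its vanishing almost everywhere leaves a gap in the energy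
    around its mean, which \<open>mean_energy_in_support\<close> excludes.\<close>
  then have "AE x in M. c * r \<le> \<bar>H x - E b H\<bar>"
  proof eventually_elim
    case (elim x)
    then have "r \<le> \<bar>H x / c - u\<bar>" using pos[of x] by fastforce
    also have "H x / c - u = (H x - E b H) / c" using u by (simp add: diff_divide_distrib)
    finally show ?case using c by (simp add: field_simps)
  qed
  with mean_energy_in_support[OF b, of "c * r"] c r show False by simp
qed

end

section \<open>Testing against exponentials\<close>

lemma abs_power_le_exp:
  fixes x :: real
  shows "\<bar>x\<bar> ^ j \<le> fact j * exp \<bar>x\<bar>"
  using power_le_exp[of "\<bar>x\<bar>" 1 j] by simp

lemma abs_mult_le_sum_squares:
  fixes a b :: real
  assumes "0 \<le> b"
  shows "\<bar>a\<bar> * b \<le> a\<^sup>2 + b\<^sup>2"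
proof -
  have "2 * (\<bar>a\<bar> * b) \<le> a\<^sup>2 + b\<^sup>2" using sum_squares_bound[of "\<bar>a\<bar>" b] by simp
  moreover have "0 \<le> \<bar>a\<bar> * b" using assms by simp
  ultimately show ?thesis by linarith
qed

text \<open>Inside the window \<open>|X| \<le> r\<close> the conditional property exchanges
  \<open>A\<close> for \<open>\<gamma> (X)\<close>, where the expansion holds. Outside,
  \<open>A\<close> itself is kept and controlled by its second moment, since no estimate of
  \<open>\<gamma>\<close> is available there. The coefficients enter the bound because none is
  assumed for them at this point.\<close>

lemma local_expansion_residual:
  fixes X A :: "'a \<Rightarrow> real" and \<gamma> :: "real \<Rightarrow> real"
  assumes [measurable]: "X \<in> borel_measurable P" "A \<in> borel_measurable P" "\<gamma> \<in> borel_measurable borel"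
    and iX: "integrable P (\<lambda>x. exp (3 * \<bar>X x\<bar>))" and Q: "(\<integral>x. exp (3 * \<bar>X x\<bar>) \<partial>P) \<le> Q"
    and iA: "integrable P (\<lambda>x. (A x)\<^sup>2)" and V: "(\<integral>x. (A x)\<^sup>2 \<partial>P) \<le> V"
    and cond: "\<And>F. F \<in> borel_measurable borel \<Longrightarrow> \<exists>B. \<forall>y. \<bar>F y\<bar> \<le> B \<Longrightarrow>
      integrable P (\<lambda>x. \<gamma> (X x) * F (X x)) \<and> (\<integral>x. A x * F (X x) \<partial>P) = (\<integral>x. \<gamma> (X x) * F (X x) \<partial>P)"
    and win: "\<And>y. \<bar>y\<bar> \<le> r \<Longrightarrow> \<bar>\<gamma> y - (x0 + x1 * y + x2 * y\<^sup>2)\<bar> \<le> \<epsilon> * \<bar>y\<bar> ^ 3"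
    and \<epsilon>: "0 \<le> \<epsilon>" and r: "0 \<le> r" and t: "\<bar>t\<bar> \<le> 1"
  shows "\<bar>(\<integral>x. A x * exp (t * X x) \<partial>P) - (x0 * (\<integral>x. exp (t * X x) \<partial>P)
      + x1 * (\<integral>x. X x * exp (t * X x) \<partial>P) + x2 * (\<integral>x. (X x)\<^sup>2 * exp (t * X x) \<partial>P))\<bar>
    \<le> (exp (- (r / 2)) * (V + Q) + 6 * \<epsilon> * Q + 2 * exp (- r) * Q) * (1 + \<bar>x0\<bar> + \<bar>x1\<bar> + \<bar>x2\<bar>)"
proof -
  let ?e = "\<lambda>x. exp (t * X x)" and ?q = "\<lambda>x. exp (3 * \<bar>X x\<bar>)"
  define S where "S = \<bar>x0\<bar> + \<bar>x1\<bar> + \<bar>x2\<bar>"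
  define p where "p y = x0 + x1 * y + x2 * y\<^sup>2" for y
  have Q0: "0 \<le> Q" using Q by (rule order_trans[OF integral_nonneg_AE, rotated]) auto
  have V0: "0 \<le> V" using V by (rule order_trans[OF integral_nonneg_AE, rotated]) auto
  have et: "exp (t * y) \<le> exp \<bar>y\<bar>" for y :: real
    using mult_right_mono[OF t, of "\<bar>y\<bar>"] by (simp add: abs_mult[symmetric])
  have pow: "\<bar>y\<bar> ^ j * exp (t * y) \<le> fact j * exp (3 * \<bar>y\<bar>)" for y :: real and j
  proof -
    have "\<bar>y\<bar> ^ j * exp (t * y) \<le> (fact j * exp \<bar>y\<bar>) * exp \<bar>y\<bar>"
      by (intro mult_mono abs_power_le_exp et) auto
    also have "\<dots> = fact j * exp (2 * \<bar>y\<bar>)" by (simp add: exp_add[symmetric])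
    also have "\<dots> \<le> fact j * exp (3 * \<bar>y\<bar>)" by simp
    finally show ?thesis .
  qed
  have ipow: "integrable P (\<lambda>x. X x ^ j * ?e x)" for j
    by (rule Bochner_Integration.integrable_bound[OF integrable_mult_right[OF iX, of "fact j"]])
       (auto simp: abs_mult power_abs intro!: AE_I2 pow)
  have iAe: "integrable P (\<lambda>x. A x * ?e x)"
  proof (rule Bochner_Integration.integrable_bound)
    show "integrable P (\<lambda>x. (A x)\<^sup>2 + ?q x)" using iA iX by simp
    have "\<bar>A x\<bar> * ?e x \<le> (A x)\<^sup>2 + ?q x" for x
    proof -
      have "\<bar>A x\<bar> * ?e x \<le> \<bar>A x\<bar> * exp \<bar>X x\<bar>" by (intro mult_left_mono et) simp
      also have "\<dots> \<le> (A x)\<^sup>2 + (exp \<bar>X x\<bar>)\<^sup>2"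
        by (rule abs_mult_le_sum_squares) simp
      also have "(exp \<bar>X x\<bar>)\<^sup>2 = exp (2 * \<bar>X x\<bar>)" by (simp add: exp_double)
      also have "\<dots> \<le> ?q x" by simp
      finally show ?thesis by simp
    qed
    then show "AE x in P. norm (A x * ?e x) \<le> norm ((A x)\<^sup>2 + ?q x)"
      by (auto simp: abs_mult)
  qed simp
  \<comment> \<open>The cut-off also makes \<open>exp (t y)\<close> bounded, as \<open>cond\<close>
    requires.\<close>
  define w where "w y = (indicator {- r..r} y :: real)" for y
  have [measurable]: "w \<in> borel_measurable borel" unfolding w_def by measurable
  have "\<bar>exp (t * y) * w y\<bar> \<le> exp r" for y
  proof (cases "\<bar>y\<bar> \<le> r")
    case True
    have "exp (t * y) \<le> exp r" using et[of y] True by (smt (verit) exp_le_cancel_iff)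
    then show ?thesis by (simp add: w_def indicator_def)
  qed (auto simp: w_def indicator_def)
  then have c: "integrable P (\<lambda>x. \<gamma> (X x) * (?e x * w (X x)))"
      "(\<integral>x. A x * (?e x * w (X x)) \<partial>P) = (\<integral>x. \<gamma> (X x) * (?e x * w (X x)) \<partial>P)"
    using cond[of "\<lambda>y. exp (t * y) * w y"] by auto
  have iw: "integrable P (\<lambda>x. A x * ?e x * (1 - w (X x)))"
    by (rule Bochner_Integration.integrable_bound[OF iAe]) (auto simp: w_def indicator_def abs_mult)
  have iw': "integrable P (\<lambda>x. A x * (?e x * w (X x)))"
    by (rule Bochner_Integration.integrable_bound[OF iAe]) (auto simp: w_def indicator_def abs_mult)
  have ip: "integrable P (\<lambda>x. p (X x) * ?e x)"
    using ipow[of 0] ipow[of 1] ipow[of 2] by (simp add: p_def algebra_simps)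
  define D where "D x = A x * ?e x * (1 - w (X x))
      + \<gamma> (X x) * (?e x * w (X x)) - p (X x) * ?e x" for x
  have "(\<integral>x. A x * ?e x \<partial>P)
      = (\<integral>x. A x * ?e x * (1 - w (X x)) + A x * (?e x * w (X x)) \<partial>P)"
    by (simp add: algebra_simps)
  also have "\<dots> = (\<integral>x. A x * ?e x * (1 - w (X x)) \<partial>P) + (\<integral>x. \<gamma> (X x) * (?e x * w (X x)) \<partial>P)"
    using iw iw' c by simp
  also have "\<dots> = (\<integral>x. D x \<partial>P) + (\<integral>x. p (X x) * ?e x \<partial>P)"
    unfolding D_def using iw c ip by simp
  also have "(\<integral>x. p (X x) * ?e x \<partial>P) = (\<integral>x. x0 * (X x ^ 0 * ?e x)
      + x1 * (X x ^ 1 * ?e x) + x2 * (X x ^ 2 * ?e x) \<partial>P)"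
    by (simp add: p_def algebra_simps)
  also have "\<dots> = x0 * (\<integral>x. ?e x \<partial>P)
      + x1 * (\<integral>x. X x * ?e x \<partial>P) + x2 * (\<integral>x. (X x)\<^sup>2 * ?e x \<partial>P)"
    using ipow[of 0] ipow[of 1] ipow[of 2] by simp
  finally have eq: "(\<integral>x. A x * ?e x \<partial>P) - (x0 * (\<integral>x. ?e x \<partial>P)
      + x1 * (\<integral>x. X x * ?e x \<partial>P) + x2 * (\<integral>x. (X x)\<^sup>2 * ?e x \<partial>P)) = (\<integral>x. D x \<partial>P)"
    by simp
  define R where "R x = exp (- (r / 2)) * ((A x)\<^sup>2 + ?q x) + 6 * \<epsilon> * ?q x
      + S * (2 * exp (- r) * ?q x)" for x
  have DR: "\<bar>D x\<bar> \<le> R x" for x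
  proof (cases "\<bar>X x\<bar> \<le> r")
    case True
    then have "D x = (\<gamma> (X x) - p (X x)) * ?e x"
      by (auto simp: D_def w_def indicator_def algebra_simps)
    also have "\<bar>\<dots>\<bar> \<le> \<epsilon> * \<bar>X x\<bar> ^ 3 * ?e x"
      unfolding abs_mult p_def using win[OF True] by (simp add: mult_right_mono)
    also have "\<dots> \<le> \<epsilon> * (6 * ?q x)"
      using pow[of "X x" 3] \<epsilon> by (simp add: mult.assoc mult_left_mono fact_numeral)
    also have "\<dots> \<le> R x" by (simp add: R_def S_def)
    finally show ?thesis .
  next
    case False
    then have D: "D x = A x * ?e x - p (X x) * ?e x"
      by (auto simp: D_def w_def indicator_def)
    \<comment> \<open>Beyond the window \<open>exp ((|X| - r) / 2) \<ge> 1\<close>. Splitting the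
      product into squares then turns the exponent 3/2 into the 3 of the assumed exponential
      moment.\<close>
    have "\<bar>A x\<bar> * ?e x \<le> \<bar>A x\<bar> * (exp (- (r / 2)) * exp (3 / 2 * \<bar>X x\<bar>))"
    proof (rule mult_left_mono)
      have "?e x \<le> exp \<bar>X x\<bar>" by (rule et)
      also have "\<dots> \<le> exp (- (r / 2) + 3 / 2 * \<bar>X x\<bar>)" using False by simp
      also have "\<dots> = exp (- (r / 2)) * exp (3 / 2 * \<bar>X x\<bar>)" by (simp only: exp_add)
      finally show "?e x \<le> exp (- (r / 2)) * exp (3 / 2 * \<bar>X x\<bar>)" .
    qed simp
    also have "\<dots> = exp (- (r / 2)) * (\<bar>A x\<bar> * exp (3 / 2 * \<bar>X x\<bar>))" by simp
    also have "\<bar>A x\<bar> * exp (3 / 2 * \<bar>X x\<bar>) \<le> (A x)\<^sup>2 + (exp (3 / 2 * \<bar>X x\<bar>))\<^sup>2"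
      by (rule abs_mult_le_sum_squares) simp
    also have "(exp (3 / 2 * \<bar>X x\<bar>))\<^sup>2 = ?q x" by (simp add: exp_double[symmetric])
    finally have 1: "\<bar>A x\<bar> * ?e x \<le> exp (- (r / 2)) * ((A x)\<^sup>2 + ?q x)" by simp
    have "\<bar>X x\<bar> ^ j \<le> 2 * exp \<bar>X x\<bar>" if "j \<in> {0, 1, 2}" for j
      using abs_power_le_exp[of "X x" j] that by (auto simp: fact_numeral intro: order_trans)
    from this[of 0] this[of 1] this[of 2] have x0: "1 \<le> 2 * exp \<bar>X x\<bar>" and x12: "\<bar>X x\<bar> \<le> 2 * exp \<bar>X x\<bar>" "(X x)\<^sup>2 \<le> 2 * exp \<bar>X x\<bar>" by auto
    have "\<bar>p (X x)\<bar> \<le> \<bar>x0\<bar> * 1 + \<bar>x1\<bar> * \<bar>X x\<bar> + \<bar>x2\<bar> * (X x)\<^sup>2"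
      unfolding p_def by (rule order_trans[OF abs_triangle_ineq add_mono[OF order_trans[OF abs_triangle_ineq]]])
        (auto simp: abs_mult)
    also have "\<dots> \<le> \<bar>x0\<bar> * (2 * exp \<bar>X x\<bar>) + \<bar>x1\<bar> * (2 * exp \<bar>X x\<bar>) + \<bar>x2\<bar> * (2 * exp \<bar>X x\<bar>)"
      using x0 x12 by (intro add_mono mult_left_mono) auto
    also have "\<dots> = S * (2 * exp \<bar>X x\<bar>)" by (simp add: S_def algebra_simps)
    finally have "\<bar>p (X x)\<bar> * ?e x \<le> S * (2 * exp \<bar>X x\<bar>) * exp \<bar>X x\<bar>"
      using et[of "X x"] by (intro mult_mono) (auto simp: S_def)
    also have "\<dots> = S * (2 * exp (2 * \<bar>X x\<bar>))" by (simp add: exp_add[symmetric])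
    also have "\<dots> \<le> S * (2 * exp (- r + 3 * \<bar>X x\<bar>))"
      using False by (intro mult_left_mono) (auto simp: S_def)
    also have "\<dots> = S * (2 * exp (- r) * ?q x)" by (simp add: mult_exp_exp mult.assoc)
    finally have 2: "\<bar>p (X x)\<bar> * ?e x \<le> S * (2 * exp (- r) * ?q x)" .
    have "\<bar>D x\<bar> \<le> \<bar>A x\<bar> * ?e x + \<bar>p (X x)\<bar> * ?e x"
      unfolding D by (rule order_trans[OF abs_triangle_ineq4]) (simp add: abs_mult)
    also have "\<dots> \<le> R x"
    proof -
      have "0 \<le> 6 * \<epsilon> * ?q x" using \<epsilon> by simp
      then show ?thesis unfolding R_def using 1 2 by linarith
    qed
    finally show ?thesis .
  qed
  have iR: "integrable P R" unfolding R_def using iX iA by simp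
  have "\<bar>\<integral>x. D x \<partial>P\<bar> \<le> (\<integral>x. R x \<partial>P)"
  proof -
    have "integrable P D" using iw c ip by (simp add: D_def[abs_def])
    then have "(\<integral>x. \<bar>D x\<bar> \<partial>P) \<le> (\<integral>x. R x \<partial>P)" using iR DR by (intro integral_mono) auto
    then show ?thesis using integral_abs_bound[of P D] by linarith
  qed
  also have "\<dots> = exp (- (r / 2)) * ((\<integral>x. (A x)\<^sup>2 \<partial>P) + (\<integral>x. ?q x \<partial>P))
      + 6 * \<epsilon> * (\<integral>x. ?q x \<partial>P) + S * (2 * exp (- r) * (\<integral>x. ?q x \<partial>P))"
    unfolding R_def using iX iA by simp
  also have "\<dots> \<le> exp (- (r / 2)) * (V + Q) + 6 * \<epsilon> * Q + S * (2 * exp (- r) * Q)"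
    using Q V \<epsilon> by (intro add_mono mult_left_mono) (auto simp: S_def)
  also have "\<dots> \<le> (exp (- (r / 2)) * (V + Q) + 6 * \<epsilon> * Q + 2 * exp (- r) * Q) * (1 + S)"
  proof -
    have "0 \<le> S * (exp (- (r / 2)) * (V + Q) + 6 * \<epsilon> * Q) + 2 * exp (- r) * Q"
      using Q0 V0 \<epsilon> by (simp add: S_def)
    then show ?thesis by (simp add: algebra_simps)
  qed
  finally show ?thesis unfolding eq S_def by (simp only: add.assoc)
qed

section \<open>Exponential tilting as a shift of the inverse temperature\<close>

context scaled_energy
begin

definition canon :: "real \<Rightarrow> 'a measure" where
  "canon b = density M (\<lambda>x. ennreal (w b x / Z b))"

lemma integrable_canon:
  assumes [measurable]: "A \<in> borel_measurable M" and b: "0 < b"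
  shows "integrable (canon b) A \<longleftrightarrow> integrable M (\<lambda>x. A x * w b x)"
proof -
  have "integrable (canon b) A \<longleftrightarrow> integrable M (\<lambda>x. (1 / Z b) * (A x * w b x))"
    unfolding canon_def using Z_pos[OF b] by (subst integrable_density) (auto simp: mult_ac)
  then show ?thesis unfolding integrable_mult_left_iff using Z_pos[OF b] by simp
qed

lemma E_eq_canon:
  assumes [measurable]: "A \<in> borel_measurable M" and b: "0 < b"
  shows "E b A = (\<integral>x. A x \<partial>canon b)"
  unfolding canon_def E_def using Z_pos[OF b] by (subst integral_density) (auto simp: mult_ac)

lemma integrable_canon_const: "0 < b \<Longrightarrow> integrable (canon b) (\<lambda>_. a :: real)"
  using integrable_canon[of "\<lambda>_. a" b] integrable_expH[of b] by simp

lemma integral_canon_const: "0 < b \<Longrightarrow> (\<integral>x. a \<partial>canon b) = (a :: real)"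
  using E_eq_canon[of "\<lambda>_. a" b] Z_pos[of b] by (simp add: E_def Z_def)

lemma measurable_canon[measurable_cong]: "sets (canon b) = sets M"
  by (simp add: canon_def)

definition X :: "real \<Rightarrow> real \<Rightarrow> 'a \<Rightarrow> real" where
  "X c b x = (H x - E b H) / sqrt c"

text \<open>This is the second derivative of \<open>ln Z / c\<close> in the inverse temperature;
  with \<open>c = N\<close> it is \<open>f_N''\<close>.\<close>

definition v :: "real \<Rightarrow> real \<Rightarrow> real" where
  "v c b = (E b (\<lambda>x. H x * H x) - (E b H)\<^sup>2) / c"

lemma X_measurable[measurable]: "X c b \<in> borel_measurable M"
  unfolding X_def by measurable

text \<open>Since \<open>X\<close> is affine in \<open>H\<close>, its moment generating function is
  a ratio of partition functions. Writing it through \<open>ln Z\<close> prepares a Taylor expansion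
  in which the term with \<open>E b H\<close> cancels the first order.\<close>

definition mgf :: "real \<Rightarrow> real \<Rightarrow> real \<Rightarrow> real" where
  "mgf c b t = exp (ln (Z (b - t / sqrt c)) - ln (Z b) - t / sqrt c * E b H)"

lemma exp_X:
  "exp (t * X c b x) * w b x = exp (- (t / sqrt c * E b H)) * exp (- (b - t / sqrt c) * H x)"
  by (simp add: X_def mult_exp_exp algebra_simps diff_divide_distrib)

lemma tilt:
  assumes "0 < b" "0 < b - t / sqrt c"
  shows "E b (\<lambda>x. A x * exp (t * X c b x)) = mgf c b t * E (b - t / sqrt c) A"
proof -
  have "(\<integral>x. A x * exp (t * X c b x) * w b x \<partial>M)
      = (\<integral>x. exp (- (t / sqrt c * E b H)) * (A x * exp (- (b - t / sqrt c) * H x)) \<partial>M)"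
    by (simp only: mult.assoc exp_X mult.left_commute)
  also have "\<dots> = exp (- (t / sqrt c * E b H)) * (\<integral>x. A x * exp (- (b - t / sqrt c) * H x) \<partial>M)"
    by (rule integral_mult_right_zero)
  finally show ?thesis
    using assms[THEN Z_pos]
    by (simp add: E_def[of b "\<lambda>x. A x * exp (t * X c b x)"] E_def[of _ A] mgf_def exp_diff)
       (simp add: exp_minus divide_inverse)
qed

lemma integrable_exp_X:
  assumes "0 < b - t / sqrt c"
  shows "integrable M (\<lambda>x. exp (t * X c b x) * w b x)"
  unfolding exp_X using assms by (intro integrable_mult_right integrable_expH)

lemma DERIV_mean: "0 < b \<Longrightarrow> c \<noteq> 0 \<Longrightarrow> ((\<lambda>b. E b H / c) has_real_derivative - v c b) (at b)"
  unfolding v_def by (rule DERIV_cong[OF DERIV_cdivide[OF DERIV_E_H]]) (auto simp: diff_divide_distrib)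

text \<open>Second-order Taylor formula for \<open>ln Z\<close> at \<open>b\<close>: the centring of
  \<open>X\<close> removes the linear term, and the second derivative \<open>c v\<close> meets the
  squared shift \<open>t^2 / c\<close>. The value is that of a Gaussian with the variance taken at
  an intermediate temperature.\<close>

lemma mgf_eq:
  assumes \<rho>: "0 < \<rho>" "\<rho> < b" and c: "0 < c" and t: "\<bar>t\<bar> \<le> \<rho> * sqrt c"
  shows "\<exists>\<xi>. \<bar>\<xi> - b\<bar> \<le> \<rho> \<and> mgf c b t = exp (t\<^sup>2 * v c \<xi> / 2)"
proof (cases "t = 0")
  case True
  then show ?thesis using \<rho> by (intro exI[of _ b]) (simp add: mgf_def)
next
  case False
  define s where "s = t / sqrt c"
  have s: "\<bar>s\<bar> \<le> \<rho>" "s \<noteq> 0" using t c False by (auto simp: s_def field_simps)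
  define diff where "diff k = (if k = 0 then (\<lambda>b. ln (Z b)) else if k = 1 then (\<lambda>b. - E b H)
     else (\<lambda>b. c * v c b))" for k :: nat
  have D: "(diff k has_real_derivative diff (Suc k) t) (at t)"
    if "k < 2" "b - \<rho> \<le> t" for k t
  proof -
    have "k = 0 \<or> k = 1" "0 < t" using that \<rho> by auto
    then show ?thesis
      using DERIV_ln_Z[of t] DERIV_minus[OF DERIV_E_H[of t]] c by (auto simp: diff_def v_def)
  qed
  have "\<exists>\<xi>. (if b - s < b then b - s < \<xi> \<and> \<xi> < b else b < \<xi> \<and> \<xi> < b - s) \<and>
     ln (Z (b - s)) = (\<Sum>k<2. diff k b / fact k * (b - s - b) ^ k) + diff 2 \<xi> / fact 2 * (b - s - b)\<^sup>2"
    by (rule Taylor[where a = "b - \<rho>" and b = "b + \<rho>" and f = "\<lambda>b. ln (Z b)"])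
       (use s(1) s(2) \<rho>(1) D in \<open>simp_all add: diff_def abs_le_iff\<close>)
  then obtain \<xi> where \<xi>: "if b - s < b then b - s < \<xi> \<and> \<xi> < b else b < \<xi> \<and> \<xi> < b - s"
    "ln (Z (b - s)) = (\<Sum>k<2. diff k b / fact k * (b - s - b) ^ k) + diff 2 \<xi> / fact 2 * (b - s - b)\<^sup>2"
    by blast
  from \<xi>(2) have "ln (Z (b - s)) = ln (Z b) + s * E b H + c * v c \<xi> * s\<^sup>2 / 2"
    by (simp add: diff_def numeral_2_eq_2 lessThan_Suc)
  moreover have "c * s\<^sup>2 = t\<^sup>2" using c by (simp add: s_def power_divide)
  ultimately have "mgf c b t = exp (t\<^sup>2 * v c \<xi> / 2)"
    unfolding mgf_def s_def[symmetric] by (simp add: algebra_simps)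
  moreover have "\<bar>\<xi> - b\<bar> \<le> \<rho>" using \<xi>(1) s by (auto split: if_splits)
  ultimately show ?thesis by blast
qed

lemma v_pos: "0 < b \<Longrightarrow> 0 < c \<Longrightarrow> 0 < v c b"
  using variance_H_ge[of b] m_pos by (auto simp: v_def intro!: divide_pos_pos elim!: less_le_trans[rotated])

text \<open>The lower bound comes from the positivity of the variance and permits division by
  \<open>mgf\<close>; the upper bound supplies exponential moments of \<open>X\<close> that do not
  depend on the size of the system.\<close>

lemma mgf_bounds:
  assumes \<rho>: "0 < \<rho>" "\<rho> < b" and c: "0 < c" and t: "\<bar>t\<bar> \<le> \<rho> * sqrt c"
    and B: "\<And>b'. \<bar>b' - b\<bar> \<le> \<rho> \<Longrightarrow> v c b' \<le> B"
  shows "1 \<le> mgf c b t" "mgf c b t \<le> exp (t\<^sup>2 * B / 2)"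
proof -
  obtain \<xi> where \<xi>: "\<bar>\<xi> - b\<bar> \<le> \<rho>" "mgf c b t = exp (t\<^sup>2 * v c \<xi> / 2)"
    using mgf_eq[OF \<rho> c t] by blast
  then have "0 \<le> v c \<xi>" using v_pos[of \<xi> c] \<rho> c by linarith
  then show "1 \<le> mgf c b t" "mgf c b t \<le> exp (t\<^sup>2 * B / 2)"
    using \<xi> B[OF \<xi>(1)] by (auto simp: mult_left_mono)
qed

text \<open>The mean energy per \<open>c\<close> has slope \<open>- v\<close>, and over a shift of
  size \<open>|t| / sqrt c\<close> the Lipschitz bound allows \<open>v\<close> to be frozen at
  \<open>b\<close>.\<close>

lemma tilted_mean:
  assumes \<rho>: "0 < \<rho>" "\<rho> < b" and c: "0 < c" and t: "\<bar>t\<bar> \<le> \<rho> * sqrt c"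
    and lip: "\<And>b'. \<bar>b' - b\<bar> \<le> \<rho> \<Longrightarrow> \<bar>v c b' - v c b\<bar> \<le> B * \<bar>b' - b\<bar>" and B: "0 \<le> B"
  shows "\<bar>(E (b - t / sqrt c) H - E b H) / sqrt c - t * v c b\<bar> \<le> B * t\<^sup>2 / sqrt c"
proof (cases "t = 0")
  case False
  define s where "s = t / sqrt c"
  have s: "\<bar>s\<bar> \<le> \<rho>" "s \<noteq> 0" using t c False by (auto simp: s_def field_simps)
  have D: "((\<lambda>b. E b H / c) has_real_derivative - v c y) (at y)" if "\<bar>y - b\<bar> \<le> \<rho>" for y
    using that \<rho> c by (intro DERIV_mean) auto
  obtain \<xi> where \<xi>: "\<bar>\<xi> - b\<bar> \<le> \<bar>s\<bar>" "E (b - s) H / c - E b H / c = s * v c \<xi>"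
  proof (cases "s > 0")
    case True
    with MVT2[of "b - s" b "\<lambda>b. E b H / c" "\<lambda>b. - v c b"] D s obtain \<xi> where
      "b - s < \<xi>" "\<xi> < b" "E b H / c - E (b - s) H / c = s * - v c \<xi>" by fastforce
    with that[of \<xi>] show ?thesis by auto
  next
    case False
    with MVT2[of b "b - s" "\<lambda>b. E b H / c" "\<lambda>b. - v c b"] D s obtain \<xi> where
      "b < \<xi>" "\<xi> < b - s" "E (b - s) H / c - E b H / c = (- s) * - v c \<xi>" by fastforce
    with that[of \<xi>] show ?thesis by auto
  qed
  have "(E (b - s) H - E b H) / sqrt c = sqrt c * (E (b - s) H / c - E b H / c)"
  proof -
    have "sqrt c * (E (b - s) H / c - E b H / c) = (E (b - s) H - E b H) * (sqrt c / c)"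
      by (simp add: diff_divide_distrib algebra_simps)
    also have "sqrt c / c = 1 / sqrt c" using c by (simp add: sqrt_divide_self_eq inverse_eq_divide)
    finally show ?thesis by simp
  qed
  also have "\<dots> = t * v c \<xi>" unfolding \<xi>(2) using c by (simp add: s_def)
  finally have "\<bar>(E (b - s) H - E b H) / sqrt c - t * v c b\<bar> = \<bar>t\<bar> * \<bar>v c \<xi> - v c b\<bar>"
    by (simp add: abs_mult[symmetric] algebra_simps)
  also have "\<dots> \<le> \<bar>t\<bar> * (B * \<bar>s\<bar>)"
    using lip[of \<xi>] \<xi>(1) s B mult_left_mono[OF \<xi>(1) B] by (intro mult_left_mono) auto
  also have "\<dots> = B * t\<^sup>2 / sqrt c" using c by (simp add: s_def power2_eq_square abs_mult_self_eq)
  finally show ?thesis by (simp add: s_def)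
qed (simp add: B)

lemma E_X:
  assumes b': "0 < b'"
  shows "E b' (X c b) = (E b' H - E b H) / sqrt c"
    and "0 < c \<Longrightarrow> E b' (\<lambda>x. (X c b x)\<^sup>2) = v c b' + (E b' (X c b))\<^sup>2"
proof -
  have int: "integrable (canon b') H" "integrable (canon b') (\<lambda>x. H x * H x)"
    using b' integrable_H_expH integrable_H2_expH by (auto simp: integrable_canon)
  note const = integrable_canon_const[OF b'] integral_canon_const[OF b']
  have "E b' (X c b) = (\<integral>x. (H x - E b H) / sqrt c \<partial>canon b')"
    using E_eq_canon[OF X_measurable[of c b] b'] by (simp only: X_def[abs_def])
  also have "\<dots> = ((\<integral>x. H x \<partial>canon b') - (\<integral>x. E b H \<partial>canon b')) / sqrt c"
    by (simp only: integral_divide_zero Bochner_Integration.integral_diff[OF int(1) const(1)])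
  finally show 1: "E b' (X c b) = (E b' H - E b H) / sqrt c"
    by (simp only: const(2) E_eq_canon[OF H_measurable b'])
  assume c: "0 < c"
  have "E b' (\<lambda>x. (X c b x)\<^sup>2) = (\<integral>x. (H x * H x - 2 * E b H * H x + (E b H)\<^sup>2) / c \<partial>canon b')"
    using c b' by (subst E_eq_canon) (auto simp: X_def power_divide power2_eq_square algebra_simps)
  also have "\<dots> = ((\<integral>x. H x * H x \<partial>canon b') - 2 * E b H * (\<integral>x. H x \<partial>canon b') + (\<integral>x. (E b H)\<^sup>2 \<partial>canon b')) / c"
    by (simp only: integral_divide_zero integral_mult_right_zero Bochner_Integration.integral_diff[OF int(2) integrable_mult_right[OF int(1)]]
        Bochner_Integration.integral_add[OF Bochner_Integration.integrable_diff[OF int(2) integrable_mult_right[OF int(1)]] const(1)])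
  also have "\<dots> = (E b' (\<lambda>x. H x * H x) - 2 * E b H * E b' H + (E b H)\<^sup>2) / c"
    using b' by (simp only: const(2) E_eq_canon[OF H_measurable b'] E_eq_canon[OF borel_measurable_times[OF H_measurable H_measurable] b'])
  also have "\<dots> = v c b' + (E b' (X c b))\<^sup>2"
    unfolding 1 using c by (simp add: v_def power_divide power2_eq_square diff_divide_distrib add_divide_distrib algebra_simps)
  finally show "E b' (\<lambda>x. (X c b x)\<^sup>2) = v c b' + (E b' (X c b))\<^sup>2" .
qed

text \<open>For fixed \<open>t\<close> this is one approximate linear equation for
  \<open>x0\<close>, \<open>x1\<close>, \<open>x2\<close>. Its coefficients are moments of
  \<open>X\<close> and its other side is the change of the mean of \<open>A\<close>, both at the
  shifted temperature \<open>b'\<close>. Condition \<open>c\<rho>\<close> keeps the shifts by up to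
  3, needed for \<open>exp (3 |X|)\<close>, inside the interval where \<open>v\<close> is
  bounded.\<close>

lemma tilted_row:
  assumes \<rho>: "0 < \<rho>" "\<rho> < b" and c: "0 < c" and c\<rho>: "3 \<le> \<rho> * sqrt c"
    and B: "\<And>b'. \<bar>b' - b\<bar> \<le> \<rho> \<Longrightarrow> v c b' \<le> B"
    and A[measurable]: "A \<in> borel_measurable M"
    and iA: "\<And>b. 0 < b \<Longrightarrow> integrable M (\<lambda>x. A x * w b x)"
    and iA2: "integrable M (\<lambda>x. (A x)\<^sup>2 * w b x)"
    and g: "conditional_version b c A g"
    and V: "l\<^sup>2 * (E b (\<lambda>x. (A x)\<^sup>2) - (E b A)\<^sup>2) \<le> V"
    and win: "\<And>y. \<bar>y\<bar> \<le> r \<Longrightarrow>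
      \<bar>l * (g (E b H / c + y / sqrt c) - E b A) - (x0 + x1 * y + x2 * y\<^sup>2)\<bar> \<le> \<epsilon> * \<bar>y\<bar> ^ 3"
    and \<epsilon>: "0 \<le> \<epsilon>" and r: "0 \<le> r" and t: "\<bar>t\<bar> \<le> 1"
    and Q: "Q = 2 * exp (9 * B / 2)" and b': "b' = b - t / sqrt c"
  shows "\<bar>l * (E b' A - E b A) - (x0 + x1 * E b' (X c b) + x2 * E b' (\<lambda>x. (X c b x)\<^sup>2))\<bar>
    \<le> (exp (- (r / 2)) * (V + Q) + 6 * \<epsilon> * Q + 2 * exp (- r) * Q) * (1 + \<bar>x0\<bar> + \<bar>x1\<bar> + \<bar>x2\<bar>)"
    (is "\<bar>?D\<bar> \<le> ?R")
proof -
  have b: "0 < b" using \<rho> by simp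
  have small: "\<bar>a\<bar> \<le> \<rho> * sqrt c" "0 < b - a / sqrt c" if "\<bar>a\<bar> \<le> 3" for a
  proof -
    show 1: "\<bar>a\<bar> \<le> \<rho> * sqrt c" using that c\<rho> by linarith
    then have "a / sqrt c \<le> \<rho>" using c by (simp add: divide_le_eq)
    then show "0 < b - a / sqrt c" using \<rho> by linarith
  qed
  have b'0: "0 < b'" using small(2)[of t] t b' by simp
  have mgf: "E b (\<lambda>x. exp (a * X c b x)) = mgf c b a" "integrable (canon b) (\<lambda>x. exp (a * X c b x))"
    if "\<bar>a\<bar> \<le> 3" for a
    using tilt[of b a c "\<lambda>_. 1"] small(2)[OF that] b integrable_exp_X[of b a c]
    by (simp_all add: E_one integrable_canon)
  let ?P = "canon b"
  \<comment> \<open>The origin of \<open>Q\<close>: the two exponentials contribute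
    \<open>mgf\<close> at 3 and at -3, each at most \<open>exp (9 B / 2)\<close>.\<close>
  have exp_abs: "exp (3 * \<bar>y\<bar>) \<le> exp (3 * y) + exp (-3 * y)" for y :: real
    by (cases "0 \<le> y") auto
  have iX: "integrable ?P (\<lambda>x. exp (3 * \<bar>X c b x\<bar>))"
  proof (rule Bochner_Integration.integrable_bound)
    show "integrable ?P (\<lambda>x. exp (3 * X c b x) + exp (-3 * X c b x))"
      using mgf(2)[of 3] mgf(2)[of "-3"] by (intro Bochner_Integration.integrable_add) auto
    show "AE x in ?P. norm (exp (3 * \<bar>X c b x\<bar>)) \<le> norm (exp (3 * X c b x) + exp (-3 * X c b x))"
      by (intro AE_I2) (use exp_abs in \<open>smt (verit) real_norm_def exp_ge_zero\<close>)
  qed simp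
  have QQ: "(\<integral>x. exp (3 * \<bar>X c b x\<bar>) \<partial>?P) \<le> Q"
  proof -
    have "(\<integral>x. exp (3 * \<bar>X c b x\<bar>) \<partial>?P) \<le> (\<integral>x. exp (3 * X c b x) + exp (-3 * X c b x) \<partial>?P)"
      using iX mgf(2)[of 3] mgf(2)[of "-3"] exp_abs by (intro integral_mono) auto
    also have "\<dots> = mgf c b 3 + mgf c b (-3)"
      using mgf[of 3] mgf[of "-3"] b by (simp add: E_eq_canon)
    also have "\<dots> \<le> exp (9 * B / 2) + exp (9 * B / 2)"
      using mgf_bounds(2)[OF \<rho> c small(1) B, of 3] mgf_bounds(2)[OF \<rho> c small(1) B, of "-3"]
      by (intro add_mono) auto
    finally show ?thesis by (simp add: Q)
  qed
  have iA': "integrable ?P A" "integrable ?P (\<lambda>x. (A x)\<^sup>2)"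
    using iA[OF b] iA2 b by (auto simp: integrable_canon)
  note const = integrable_canon_const[OF b] integral_canon_const[OF b]
  define A' where "A' x = l * (A x - E b A)" for x
  have [measurable]: "A' \<in> borel_measurable M" unfolding A'_def by measurable
  have A'2: "(\<lambda>x. (A' x)\<^sup>2) = (\<lambda>x. l\<^sup>2 * ((A x)\<^sup>2 - 2 * E b A * A x + (E b A)\<^sup>2))"
    by (auto simp: A'_def power2_eq_square algebra_simps)
  have iA'2: "integrable ?P (\<lambda>x. (A' x)\<^sup>2)"
    unfolding A'2 by (intro integrable_mult_right Bochner_Integration.integrable_add
        Bochner_Integration.integrable_diff iA' const(1))
  have "(\<integral>x. (A' x)\<^sup>2 \<partial>?P) = l\<^sup>2 * ((\<integral>x. (A x)\<^sup>2 \<partial>?P) - 2 * E b A * (\<integral>x. A x \<partial>?P) + (\<integral>x. (E b A)\<^sup>2 \<partial>?P))"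
    unfolding A'2
    by (simp only: integral_mult_right_zero Bochner_Integration.integral_diff[OF iA'(2) integrable_mult_right[OF iA'(1)]]
        Bochner_Integration.integral_add[OF Bochner_Integration.integrable_diff[OF iA'(2) integrable_mult_right[OF iA'(1)]] const(1)])
  also have "\<dots> = l\<^sup>2 * (E b (\<lambda>x. (A x)\<^sup>2) - (E b A)\<^sup>2)"
    using b by (simp only: const(2) E_eq_canon[OF A b] E_eq_canon[OF borel_measurable_power[OF A] b])
      (simp add: power2_eq_square)
  finally have VV: "(\<integral>x. (A' x)\<^sup>2 \<partial>?P) \<le> V" using V by simp
  define \<gamma> where "\<gamma> y = l * (g (E b H / c + y / sqrt c) - E b A)" for y
  have [measurable]: "g \<in> borel_measurable borel" using g by (simp add: conditional_version_def)
  have [measurable]: "\<gamma> \<in> borel_measurable borel" unfolding \<gamma>_def by measurable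
  have HX: "E b H / c + X c b x / sqrt c = H x / c" for x
    using c by (simp add: X_def field_simps)
  have HX': "(H x / c - E b H / c) * sqrt c = X c b x" for x
  proof -
    have "H x / c - E b H / c = X c b x / sqrt c" using HX[of x] by linarith
    then show ?thesis using c by simp
  qed
  have cond: "integrable ?P (\<lambda>x. \<gamma> (X c b x) * F (X c b x)) \<and>
      (\<integral>x. A' x * F (X c b x) \<partial>?P) = (\<integral>x. \<gamma> (X c b x) * F (X c b x) \<partial>?P)"
    if [measurable]: "F \<in> borel_measurable borel" and bd: "\<exists>B. \<forall>y. \<bar>F y\<bar> \<le> B" for F
  proof -
    define F' where "F' y = F ((y - E b H / c) * sqrt c)" for y
    have F': "F' (H x / c) = F (X c b x)" for x by (simp only: F'_def HX')
    have F'm: "F' \<in> borel_measurable borel" unfolding F'_def by measurable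
    have "\<exists>B. \<forall>y. \<bar>F' y\<bar> \<le> B" using bd unfolding F'_def by blast
    with g F'm have "integrable M (\<lambda>x. g (H x / c) * F' (H x / c) * w b x)"
      "(\<integral>x. A x * F' (H x / c) * w b x \<partial>M) = (\<integral>x. g (H x / c) * F' (H x / c) * w b x \<partial>M)"
      unfolding conditional_version_def by blast+
    then have 1: "integrable ?P (\<lambda>x. g (H x / c) * F (X c b x))"
      "(\<integral>x. A x * F (X c b x) \<partial>?P) = (\<integral>x. g (H x / c) * F (X c b x) \<partial>?P)"
      unfolding F' using E_eq_canon[of "\<lambda>x. A x * F (X c b x)" b] E_eq_canon[of "\<lambda>x. g (H x / c) * F (X c b x)" b] b
      by (auto simp: integrable_canon E_def)
    obtain B' where B': "\<And>y. \<bar>F y\<bar> \<le> B'" using bd by blast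
    have 2: "integrable ?P (\<lambda>x. F (X c b x))"
      by (rule Bochner_Integration.integrable_bound[OF const(1)[of B']]) (auto intro!: AE_I2 order_trans[OF B'])
    have 3: "integrable ?P (\<lambda>x. A x * F (X c b x))"
      by (rule Bochner_Integration.integrable_bound[OF integrable_mult_left[OF iA'(1), of B']])
         (auto intro!: AE_I2 mult_left_mono order_trans[OF B'] simp: abs_mult)
    have "(\<lambda>x. \<gamma> (X c b x) * F (X c b x)) = (\<lambda>x. l * (g (H x / c) * F (X c b x) - E b A * F (X c b x)))"
      unfolding \<gamma>_def HX by (simp add: algebra_simps)
    moreover have "(\<lambda>x. A' x * F (X c b x)) = (\<lambda>x. l * (A x * F (X c b x) - E b A * F (X c b x)))"
      by (simp add: A'_def algebra_simps)
    ultimately show ?thesis using 1 2 3 by simp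
  qed
  have t3: "\<bar>t\<bar> \<le> 3" using t by simp
  have "\<bar>(\<integral>x. A' x * exp (t * X c b x) \<partial>?P) - (x0 * (\<integral>x. exp (t * X c b x) \<partial>?P)
      + x1 * (\<integral>x. X c b x * exp (t * X c b x) \<partial>?P) + x2 * (\<integral>x. (X c b x)\<^sup>2 * exp (t * X c b x) \<partial>?P))\<bar>
    \<le> ?R"
    by (rule local_expansion_residual[OF _ _ _ iX QQ iA'2 VV cond _ \<epsilon> r t])
       (use win in \<open>auto simp: \<gamma>_def\<close>)
  moreover have "(\<integral>x. D x * exp (t * X c b x) \<partial>?P) = mgf c b t * E b' D"
    if [measurable]: "D \<in> borel_measurable M" for D
    using tilt[OF b small(2)[OF t3], of D] b E_eq_canon[of "\<lambda>x. D x * exp (t * X c b x)" b] by (simp add: b')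
  moreover have "E b' A' = l * (E b' A - E b A)"
  proof -
    have 1: "integrable (canon b') A" using iA[OF b'0] b'0 by (simp add: integrable_canon)
    have "E b' A' = (\<integral>x. l * (A x - E b A) \<partial>canon b')"
      using E_eq_canon[of A' b'] b'0 by (simp add: A'_def[abs_def])
    also have "\<dots> = l * ((\<integral>x. A x \<partial>canon b') - (\<integral>x. E b A \<partial>canon b'))"
      by (simp only: integral_mult_right_zero Bochner_Integration.integral_diff[OF 1 integrable_canon_const[OF b'0]])
    finally show ?thesis by (simp only: integral_canon_const[OF b'0] E_eq_canon[OF A b'0])
  qed
  moreover have "(\<integral>x. exp (t * X c b x) \<partial>?P) = mgf c b t"
    using mgf(1)[OF t3] b by (simp add: E_eq_canon)
  ultimately have "\<bar>mgf c b t * (l * (E b' A - E b A)) - (x0 * mgf c b t + x1 * (mgf c b t * E b' (X c b))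
      + x2 * (mgf c b t * E b' (\<lambda>x. (X c b x)\<^sup>2)))\<bar>
    \<le> ?R" by simp
  also have "mgf c b t * (l * (E b' A - E b A)) - (x0 * mgf c b t + x1 * (mgf c b t * E b' (X c b))
      + x2 * (mgf c b t * E b' (\<lambda>x. (X c b x)\<^sup>2)))
    = mgf c b t * (?D)"
    by (simp add: algebra_simps)
  \<comment> \<open>All terms of the row carry the factor \<open>mgf\<close>; as it is at least 1,
    removing it only decreases the left side.\<close>
  finally have "\<bar>mgf c b t\<bar> * \<bar>?D\<bar> \<le> ?R"
    by (simp only: abs_mult)
  moreover have "1 * \<bar>?D\<bar>
      \<le> \<bar>mgf c b t\<bar> * \<bar>?D\<bar>"
    using mgf_bounds(1)[OF \<rho> c small(1)[OF t3] B] by (intro mult_right_mono) auto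
  ultimately show ?thesis by linarith
qed

end

text \<open>Without errors the row \<open>t = 0\<close> gives \<open>x0 = - s x2\<close>, the
  difference of the rows 1 and -1 gives \<open>x1 = \<kappa> / s\<close>, and their sum then gives
  \<open>x2 = 0\<close>. The error \<open>\<delta>\<close> involves the unknowns themselves, so they
  are first estimated in terms of \<open>\<delta>\<close> and the result is put back into its
  definition.\<close>

lemma row_system_bound:
  fixes s \<kappa> x0 x1 x2 \<theta> \<sigma> \<kappa>0 C :: real
  defines "\<delta> \<equiv> \<theta> * (1 + \<bar>x0\<bar> + \<bar>x1\<bar> + \<bar>x2\<bar>)"
  assumes rows: "\<And>t. t \<in> {-1, 0, 1} \<Longrightarrow> \<bar>t * \<kappa> - (x0 + t * s * x1 + (s + t\<^sup>2 * s\<^sup>2) * x2)\<bar> \<le> \<delta>"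
    and \<sigma>: "0 < \<sigma>" "\<sigma> \<le> s" and \<kappa>: "\<bar>\<kappa>\<bar> \<le> \<kappa>0" and \<theta>: "0 \<le> \<theta>" "C * \<theta> \<le> 1 / 2"
    and C: "C = 1 + 3 / \<sigma> + 2 / \<sigma>\<^sup>2"
  shows "\<bar>x1 - \<kappa> / s\<bar> \<le> C * (2 * \<theta> * (1 + \<kappa>0 / \<sigma>))" "\<bar>x0\<bar> \<le> C * (2 * \<theta> * (1 + \<kappa>0 / \<sigma>))"
proof -
  have s: "0 < s" using \<sigma> by linarith
  have \<delta>0: "0 \<le> \<delta>" unfolding \<delta>_def using \<theta> by simp
  have r: "\<bar>x0 + s * x2\<bar> \<le> \<delta>" "\<bar>\<kappa> - (x0 + s * x1 + (s + s\<^sup>2) * x2)\<bar> \<le> \<delta>"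
    "\<bar>- \<kappa> - (x0 - s * x1 + (s + s\<^sup>2) * x2)\<bar> \<le> \<delta>"
    using rows[of 0] rows[of 1] rows[of "-1"] by auto
  have "\<bar>s * x1 - \<kappa>\<bar> \<le> \<delta>" using r by (simp add: algebra_simps abs_le_iff)
  moreover have "\<bar>x1 - \<kappa> / s\<bar> = \<bar>s * x1 - \<kappa>\<bar> / s"
  proof -
    have "x1 - \<kappa> / s = (s * x1 - \<kappa>) / s" using s by (simp add: field_simps)
    then show ?thesis using s by (simp add: abs_divide)
  qed
  moreover have inv: "\<delta> / s \<le> \<delta> / \<sigma>" using \<sigma> \<delta>0 by (simp add: frac_le)
  ultimately have 1: "\<bar>x1 - \<kappa> / s\<bar> \<le> \<delta> / \<sigma>" using s by (smt (verit) divide_right_mono)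
  have "\<bar>s * x2 * s\<bar> \<le> 2 * \<delta>" using r by (simp add: algebra_simps power2_eq_square abs_le_iff)
  then have "\<bar>s * x2\<bar> \<le> 2 * \<delta> / s" using s by (simp add: abs_mult field_simps)
  then have sx2: "\<bar>s * x2\<bar> \<le> 2 * \<delta> / \<sigma>" using inv by simp
  then have 2: "\<bar>x0\<bar> \<le> \<delta> + 2 * \<delta> / \<sigma>" using r(1) by linarith
  have "\<sigma> * \<bar>x2\<bar> \<le> s * \<bar>x2\<bar>" using \<sigma> by (intro mult_right_mono) auto
  then have "\<sigma> * \<bar>x2\<bar> \<le> 2 * \<delta> / \<sigma>" using sx2 s by (simp add: abs_mult)
  then have 3: "\<bar>x2\<bar> \<le> 2 * \<delta> / \<sigma>\<^sup>2" using \<sigma> by (simp add: field_simps power2_eq_square)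
  have "\<bar>\<kappa> / s\<bar> \<le> \<kappa>0 / \<sigma>"
    using \<kappa> \<sigma> s by (simp add: abs_divide frac_le)
  then have "\<bar>x1\<bar> \<le> \<kappa>0 / \<sigma> + \<delta> / \<sigma>" using 1 by linarith
  \<comment> \<open>\<open>C\<close> is the sum of the coefficients of \<open>\<delta>\<close> in
    the bounds on \<open>x0\<close>, on \<open>x1 - \<kappa> / s\<close> and on
    \<open>x2\<close>.\<close>
  moreover have C\<delta>: "C * \<delta> = \<delta> + 3 * (\<delta> / \<sigma>) + 2 * (\<delta> / \<sigma>\<^sup>2)"
    by (simp add: C distrib_right)
  ultimately have "\<bar>x0\<bar> + \<bar>x1\<bar> + \<bar>x2\<bar> \<le> \<kappa>0 / \<sigma> + C * \<delta>"
    using 2 3 C\<delta> by simp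
  then have "\<delta> \<le> \<theta> * (1 + \<kappa>0 / \<sigma> + C * \<delta>)"
    unfolding \<delta>_def using \<theta> by (intro mult_left_mono) auto
  also have "\<dots> = \<theta> * (1 + \<kappa>0 / \<sigma>) + (C * \<theta>) * \<delta>" by (simp add: algebra_simps)
  \<comment> \<open>Because of \<open>C \<theta> \<le> 1 / 2\<close> the term with
    \<open>\<delta>\<close> can be absorbed on the left.\<close>
  also have "\<dots> \<le> \<theta> * (1 + \<kappa>0 / \<sigma>) + 1 / 2 * \<delta>"
    using \<theta> \<delta>0 by (intro add_left_mono mult_right_mono) auto
  finally have \<delta>: "\<delta> \<le> 2 * \<theta> * (1 + \<kappa>0 / \<sigma>)" by simp
  have C0: "0 \<le> C" using \<sigma> by (simp add: C)
  have "\<delta> / \<sigma> \<le> C * \<delta>" "\<delta> + 2 * \<delta> / \<sigma> \<le> C * \<delta>"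
  proof -
    have "0 \<le> \<delta> / \<sigma>" "0 \<le> \<delta> / \<sigma>\<^sup>2" using \<delta>0 \<sigma> by simp_all
    then show "\<delta> / \<sigma> \<le> C * \<delta>" "\<delta> + 2 * \<delta> / \<sigma> \<le> C * \<delta>"
      using C\<delta> \<delta>0 unfolding times_divide_eq_right[symmetric] by linarith+
  qed
  moreover have "C * \<delta> \<le> C * (2 * \<theta> * (1 + \<kappa>0 / \<sigma>))" by (rule mult_left_mono[OF \<delta> C0])
  ultimately show "\<bar>x1 - \<kappa> / s\<bar> \<le> C * (2 * \<theta> * (1 + \<kappa>0 / \<sigma>))" "\<bar>x0\<bar> \<le> C * (2 * \<theta> * (1 + \<kappa>0 / \<sigma>))"
    using 1 2 by linarith+
qed

text \<open>Replacing the true coefficients of the rows by the Gaussian ones \<open>t s\<close> and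
  \<open>s + t^2 s^2\<close> costs null factors times \<open>1 + |x0| + |x1| + |x2|\<close>. These
  factors join \<open>\<eta>\<close> in \<open>\<theta>\<close>, which is summed over
  \<open>t\<close> to serve all three rows at once.\<close>

lemma row_system_limit:
  fixes s \<kappa> x0 x1 x2 \<eta> :: "nat \<Rightarrow> real" and a p q :: "real \<Rightarrow> nat \<Rightarrow> real"
  assumes rows: "\<And>t. t \<in> {-1, 0, 1} \<Longrightarrow> \<forall>\<^sub>F N in sequentially.
      \<bar>a t N - (x0 N + x1 N * p t N + x2 N * q t N)\<bar> \<le> \<eta> N * (1 + \<bar>x0 N\<bar> + \<bar>x1 N\<bar> + \<bar>x2 N\<bar>)"
    and \<eta>: "\<eta> \<longlonglongrightarrow> 0"
    and a: "\<And>t. t \<in> {-1, 0, 1} \<Longrightarrow> (\<lambda>N. a t N - t * \<kappa> N) \<longlonglongrightarrow> 0"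
    and p: "\<And>t. t \<in> {-1, 0, 1} \<Longrightarrow> (\<lambda>N. p t N - t * s N) \<longlonglongrightarrow> 0"
    and q: "\<And>t. t \<in> {-1, 0, 1} \<Longrightarrow> (\<lambda>N. q t N - (s N + t\<^sup>2 * (s N)\<^sup>2)) \<longlonglongrightarrow> 0"
    and s: "0 < \<sigma>" "\<forall>\<^sub>F N in sequentially. \<sigma> \<le> s N" and \<kappa>: "\<forall>\<^sub>F N in sequentially. \<bar>\<kappa> N\<bar> \<le> \<kappa>0"
  shows "(\<lambda>N. x1 N - \<kappa> N / s N) \<longlonglongrightarrow> 0" "x0 \<longlonglongrightarrow> 0"
proof -
  let ?T = "{-1, 0, 1 :: real}"
  let ?r = "\<lambda>t N. a t N - (x0 N + x1 N * p t N + x2 N * q t N)" and ?a = "\<lambda>t N. a t N - t * \<kappa> N"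
    and ?p = "\<lambda>t N. p t N - t * s N" and ?q = "\<lambda>t N. q t N - (s N + t\<^sup>2 * (s N)\<^sup>2)"
  define \<theta> where "\<theta> N = (\<Sum>t\<in>?T. \<bar>\<eta> N\<bar> + \<bar>?a t N\<bar> + \<bar>?p t N\<bar>
      + \<bar>?q t N\<bar>)" for N
  have "\<theta> \<longlonglongrightarrow> (\<Sum>t\<in>?T. 0 + 0 + 0 + 0)"
    unfolding \<theta>_def
    by (intro tendsto_sum tendsto_add tendsto_rabs_zero \<eta> a p q)
  then have \<theta>: "\<theta> \<longlonglongrightarrow> 0" by simp
  have \<theta>0: "0 \<le> \<theta> N" for N unfolding \<theta>_def by (intro sum_nonneg) simp
  define C where "C = 1 + 3 / \<sigma> + 2 / \<sigma>\<^sup>2"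
  have "\<forall>\<^sub>F N in sequentially. C * \<theta> N < 1 / 2"
    using tendsto_mult_right_zero[OF \<theta>, of C] by (rule order_tendstoD) simp
  moreover have "\<forall>\<^sub>F N in sequentially. \<forall>t\<in>?T.
      \<bar>?r t N\<bar> \<le> \<eta> N * (1 + \<bar>x0 N\<bar> + \<bar>x1 N\<bar> + \<bar>x2 N\<bar>)"
    using rows by (intro eventually_ball_finite) auto
  ultimately have ev: "\<forall>\<^sub>F N in sequentially. \<bar>x1 N - \<kappa> N / s N\<bar> \<le> C * (2 * \<theta> N * (1 + \<kappa>0 / \<sigma>))
      \<and> \<bar>x0 N\<bar> \<le> C * (2 * \<theta> N * (1 + \<kappa>0 / \<sigma>))"
    using s(2) \<kappa>
  proof eventually_elim
    case (elim N)
    define S where "S = 1 + \<bar>x0 N\<bar> + \<bar>x1 N\<bar> + \<bar>x2 N\<bar>"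
    have row: "\<bar>t * \<kappa> N - (x0 N + t * s N * x1 N + (s N + t\<^sup>2 * (s N)\<^sup>2) * x2 N)\<bar> \<le> \<theta> N * S" if t: "t \<in> ?T" for t
    proof -
      have "\<bar>t * \<kappa> N - (x0 N + t * s N * x1 N + (s N + t\<^sup>2 * (s N)\<^sup>2) * x2 N)\<bar>
        = \<bar>(?r t N) - (?a t N)
          + (?p t N) * x1 N + (?q t N) * x2 N\<bar>"
        by (simp add: algebra_simps)
      also have "\<dots> \<le> \<bar>?r t N\<bar> + \<bar>?a t N\<bar>
          + \<bar>?p t N\<bar> * \<bar>x1 N\<bar> + \<bar>?q t N\<bar> * \<bar>x2 N\<bar>"
        by (simp add: abs_mult[symmetric])
      also have "\<dots> \<le> \<bar>\<eta> N\<bar> * S + \<bar>?a t N\<bar> * S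
          + \<bar>?p t N\<bar> * S + \<bar>?q t N\<bar> * S"
      proof (intro add_mono)
        show "\<bar>?r t N\<bar> \<le> \<bar>\<eta> N\<bar> * S"
          using elim(2) t by (smt (verit) S_def mult_right_mono abs_ge_self)
        show "\<bar>?a t N\<bar> \<le> \<bar>?a t N\<bar> * S"
          using mult_left_mono[of 1 S "\<bar>?a t N\<bar>"] by (simp add: S_def)
      qed (auto intro!: mult_left_mono simp: S_def)
      also have "\<dots> = (\<bar>\<eta> N\<bar> + \<bar>?a t N\<bar> + \<bar>?p t N\<bar>
          + \<bar>?q t N\<bar>) * S"
        by (simp add: algebra_simps)
      also have "\<dots> \<le> \<theta> N * S"
        unfolding \<theta>_def using t by (intro mult_right_mono member_le_sum) (auto simp: S_def)
      finally show ?thesis .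
    qed
    show ?case
      using row_system_bound[of "\<kappa> N" "x0 N" "s N" "x1 N" "x2 N" "\<theta> N" \<sigma> \<kappa>0 C] row elim s(1) \<theta>0
      by (simp add: S_def C_def)
  qed
  have lim: "(\<lambda>N. C * (2 * \<theta> N * (1 + \<kappa>0 / \<sigma>))) \<longlonglongrightarrow> 0"
    by (intro tendsto_mult_right_zero tendsto_mult_left_zero \<theta>)
  show "(\<lambda>N. x1 N - \<kappa> N / s N) \<longlonglongrightarrow> 0"
    by (rule Lim_null_comparison[OF _ lim]) (use ev in \<open>auto elim: eventually_mono\<close>)
  show "x0 \<longlonglongrightarrow> 0"
    by (rule Lim_null_comparison[OF _ lim]) (use ev in \<open>auto elim: eventually_mono\<close>)
qed

section \<open>Sequences of systems\<close>

text \<open>\<open>\<nu>\<close> is half the dimension. The bounds on \<open>v\<close> stand for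
  those on \<open>f_N''\<close> and \<open>f_N'''\<close> near \<open>\<beta>\<close>; the Lipschitz
  bound is taken from the centre \<open>\<beta>\<close>, where all tilts start.\<close>

locale energy_family =
  fixes M :: "nat \<Rightarrow> 'a measure" and K U :: "nat \<Rightarrow> 'a \<Rightarrow> real" and \<nu> \<beta> \<rho> B :: real
  assumes system: "\<And>N. 1 \<le> N \<Longrightarrow> scaled_energy (M N) (K N) (U N) (\<nu> * real N)"
    and \<nu>_pos: "0 < \<nu>" and \<rho>: "0 < \<rho>" "\<rho> < \<beta>"
    and v_le: "\<And>N b. 1 \<le> N \<Longrightarrow> \<bar>b - \<beta>\<bar> \<le> \<rho> \<Longrightarrow> scaled_energy.v (M N) (K N) (U N) (real N) b \<le> B"
    and v_lip: "\<And>N b. 1 \<le> N \<Longrightarrow> \<bar>b - \<beta>\<bar> \<le> \<rho> \<Longrightarrow>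
      \<bar>scaled_energy.v (M N) (K N) (U N) (real N) b - scaled_energy.v (M N) (K N) (U N) (real N) \<beta>\<bar> \<le> B * \<bar>b - \<beta>\<bar>"
begin

abbreviation "E N \<equiv> scaled_energy.E (M N) (K N) (U N)"
abbreviation "H N \<equiv> scaled_energy.H (K N) (U N)"
abbreviation "v N \<equiv> scaled_energy.v (M N) (K N) (U N) (real N)"
abbreviation "X N \<equiv> scaled_energy.X (M N) (K N) (U N) (real N) \<beta>"
abbreviation "conditional N \<equiv> scaled_energy.conditional_version (M N) (K N) (U N) \<beta> (real N)"
abbreviation "u N \<equiv> E N \<beta> (H N) / real N"
abbreviation "\<beta>\<^sub>t t N \<equiv> \<beta> - t / sqrt (real N)"

lemma \<beta>_pos: "0 < \<beta>" using \<rho> by simp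

lemma v_ge: "1 \<le> N \<Longrightarrow> \<nu> / \<beta>\<^sup>2 \<le> v N \<beta>"
  using scaled_energy.variance_H_ge[OF system \<beta>_pos, of N]
  by (simp add: scaled_energy.v_def[OF system] field_simps)

lemma v_\<beta>_le: "1 \<le> N \<Longrightarrow> v N \<beta> \<le> B"
  using v_le[of N \<beta>] \<rho> by simp

lemma B_pos: "0 < B"
proof -
  have "0 < \<nu> / \<beta>\<^sup>2" using \<nu>_pos \<beta>_pos by simp
  then show ?thesis using v_ge[of 1] v_\<beta>_le[of 1] by simp
qed

lemma sqrt_real_at_top: "filterlim (\<lambda>N. sqrt (real N)) at_top sequentially"
  by (rule filterlim_compose[OF sqrt_at_top filterlim_real_sequentially])

lemma const_over_sqrt: "(\<lambda>N. a / sqrt (real N)) \<longlonglongrightarrow> 0"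
  by (rule real_tendsto_divide_at_top[OF tendsto_const sqrt_real_at_top])

lemma eventually_temperature_window:
  "\<forall>\<^sub>F N in sequentially. 1 \<le> N \<and> a \<le> \<rho> * sqrt (real N)"
proof -
  have "\<forall>\<^sub>F N in sequentially. a / \<rho> \<le> sqrt (real N)"
    using sqrt_real_at_top by (simp add: filterlim_at_top)
  then show ?thesis
    using eventually_ge_at_top[of 1] by eventually_elim (use \<rho> in \<open>simp add: field_simps\<close>)
qed

lemma tilted_first_moment:
  "(\<lambda>N. E N (\<beta>\<^sub>t t N) (X N) - t * v N \<beta>) \<longlonglongrightarrow> 0"
proof (rule Lim_null_comparison[OF _ const_over_sqrt])
  show "\<forall>\<^sub>F N in sequentially. norm (E N (\<beta>\<^sub>t t N) (X N) - t * v N \<beta>) \<le> (B * t\<^sup>2) / sqrt (real N)"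
    using eventually_temperature_window[of "\<bar>t\<bar>"]
  proof eventually_elim
    case (elim N)
    interpret S: scaled_energy "M N" "K N" "U N" "\<nu> * real N" using elim system by blast
    have "\<bar>t / sqrt (real N)\<bar> \<le> \<rho>" using elim by (simp add: field_simps)
    then have "0 < \<beta> - t / sqrt (real N)" using \<rho> by linarith
    moreover have "\<bar>t\<bar> \<le> \<rho> * sqrt (real N)" "0 < real N" using elim by simp_all
    ultimately show ?case
      using S.tilted_mean[OF \<rho>, of "real N" t B] v_lip[of N] B_pos elim
      by (simp add: S.E_X(1))
  qed
qed

text \<open>The second moment splits into the variance at the shifted temperature, moved back to
  \<open>\<beta>\<close> by \<open>v_lip\<close>, and the square of the mean from
  \<open>tilted_first_moment\<close>.\<close>

lemma tilted_second_moment: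
  "(\<lambda>N. E N (\<beta>\<^sub>t t N) (\<lambda>x. (X N x)\<^sup>2) - (v N \<beta> + t\<^sup>2 * (v N \<beta>)\<^sup>2)) \<longlonglongrightarrow> 0"
proof -
  define d where "d N = E N (\<beta>\<^sub>t t N) (X N) - t * v N \<beta>" for N
  have d: "d \<longlonglongrightarrow> 0" unfolding d_def by (rule tilted_first_moment)
  have "(\<lambda>N. d N * d N + 2 * \<bar>t\<bar> * B * \<bar>d N\<bar> + (B * \<bar>t\<bar>) / sqrt (real N)) \<longlonglongrightarrow> 0 * 0 + 2 * \<bar>t\<bar> * B * 0 + 0"
    by (intro tendsto_intros d tendsto_rabs_zero const_over_sqrt)
  then have lim: "(\<lambda>N. d N * d N + 2 * \<bar>t\<bar> * B * \<bar>d N\<bar> + (B * \<bar>t\<bar>) / sqrt (real N)) \<longlonglongrightarrow> 0" by simp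
  show ?thesis
  proof (rule Lim_null_comparison[OF _ lim])
    show "\<forall>\<^sub>F N in sequentially. norm (E N (\<beta>\<^sub>t t N) (\<lambda>x. (X N x)\<^sup>2) - (v N \<beta> + t\<^sup>2 * (v N \<beta>)\<^sup>2))
        \<le> d N * d N + 2 * \<bar>t\<bar> * B * \<bar>d N\<bar> + (B * \<bar>t\<bar>) / sqrt (real N)"
      using eventually_temperature_window[of "\<bar>t\<bar>"]
    proof eventually_elim
      case (elim N)
      interpret S: scaled_energy "M N" "K N" "U N" "\<nu> * real N" using elim system by blast
      let ?b = "\<beta> - t / sqrt (real N)"
      have small: "\<bar>t / sqrt (real N)\<bar> \<le> \<rho>" using elim by (simp add: field_simps)
      then have b: "0 < ?b" using \<rho> by linarith
      have N: "0 < real N" "1 \<le> N" using elim by simp_all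
      have "E N ?b (\<lambda>x. (X N x)\<^sup>2) = v N ?b + (d N + t * v N \<beta>)\<^sup>2"
        using S.E_X(2)[OF b N(1)] by (simp add: d_def)
      then have eq: "E N ?b (\<lambda>x. (X N x)\<^sup>2) - (v N \<beta> + t\<^sup>2 * (v N \<beta>)\<^sup>2)
          = (v N ?b - v N \<beta>) + d N * d N + 2 * t * v N \<beta> * d N"
        by (simp add: power2_eq_square algebra_simps)
      have 1: "\<bar>v N ?b - v N \<beta>\<bar> \<le> B * \<bar>t\<bar> / sqrt (real N)"
        using v_lip[OF N(2), of ?b] small by simp
      have "\<bar>v N \<beta>\<bar> \<le> B" using S.v_pos[OF \<beta>_pos N(1)] v_\<beta>_le[OF N(2)] by simp
      then have "2 * \<bar>t\<bar> * \<bar>v N \<beta>\<bar> * \<bar>d N\<bar> \<le> 2 * \<bar>t\<bar> * B * \<bar>d N\<bar>"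
        by (intro mult_right_mono mult_left_mono) auto
      then have 2: "\<bar>2 * t * v N \<beta> * d N\<bar> \<le> 2 * \<bar>t\<bar> * B * \<bar>d N\<bar>" by (simp add: abs_mult)
      have "0 \<le> d N * d N" by simp
      then show ?case unfolding real_norm_def eq using 1 2 by linarith
    qed
  qed
qed

text \<open>The factor \<open>l N\<close> normalises the fluctuations of \<open>A N\<close> to
  bounded variance, and \<open>t \<kappa> N\<close> is the linear response of its mean to the shift
  of temperature. The limiting slope \<open>\<kappa> / v\<close> is the ratio of the responses of
  \<open>A\<close> and of \<open>X\<close>.\<close>

lemma conditional_expansion:
  fixes A :: "nat \<Rightarrow> 'a \<Rightarrow> real" and g :: "nat \<Rightarrow> real \<Rightarrow> real" and l \<kappa> x0 x1 x2 r \<epsilon> :: "nat \<Rightarrow> real"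
  assumes A: "\<And>N. 1 \<le> N \<Longrightarrow> A N \<in> borel_measurable (M N)"
    and iA: "\<And>N b. 1 \<le> N \<Longrightarrow> 0 < b \<Longrightarrow> integrable (M N) (\<lambda>x. A N x * exp (- b * H N x))"
    and iA2: "\<And>N. 1 \<le> N \<Longrightarrow> integrable (M N) (\<lambda>x. (A N x)\<^sup>2 * exp (- \<beta> * H N x))"
    and g: "\<And>N. 1 \<le> N \<Longrightarrow> conditional N (A N) (g N)"
    and V: "\<And>N. 1 \<le> N \<Longrightarrow> (l N)\<^sup>2 * (E N \<beta> (\<lambda>x. (A N x)\<^sup>2) - (E N \<beta> (A N))\<^sup>2) \<le> V"
    and tilt: "\<And>t. (\<lambda>N. l N * (E N (\<beta>\<^sub>t t N) (A N) - E N \<beta> (A N)) - t * \<kappa> N) \<longlonglongrightarrow> 0"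
    and \<kappa>: "\<forall>\<^sub>F N in sequentially. \<bar>\<kappa> N\<bar> \<le> \<kappa>0"
    and win: "\<forall>\<^sub>F N in sequentially. \<forall>y. \<bar>y\<bar> \<le> r N \<longrightarrow>
      \<bar>l N * (g N (u N + y / sqrt (real N)) - E N \<beta> (A N)) - (x0 N + x1 N * y + x2 N * y\<^sup>2)\<bar> \<le> \<epsilon> N * \<bar>y\<bar> ^ 3"
    and \<epsilon>: "\<epsilon> \<longlonglongrightarrow> 0" "\<forall>\<^sub>F N in sequentially. 0 \<le> \<epsilon> N" and r: "filterlim r at_top sequentially"
  shows "(\<lambda>N. x1 N - \<kappa> N / v N \<beta>) \<longlonglongrightarrow> 0" "x0 \<longlonglongrightarrow> 0"
proof -
  define Q where "Q = 2 * exp (9 * B / 2)"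
  define \<eta> where "\<eta> N = exp (- (r N / 2)) * (V + Q) + 6 * \<epsilon> N * Q + 2 * exp (- r N) * Q" for N
  have "(\<lambda>N. exp (- r N)) \<longlonglongrightarrow> 0"
    by (rule filterlim_compose[OF exp_at_bot]) (use r in \<open>simp add: filterlim_uminus_at_bot\<close>)
  moreover have "(\<lambda>N. exp (- (r N / 2))) \<longlonglongrightarrow> 0"
  proof (rule filterlim_compose[OF exp_at_bot])
    have "filterlim (\<lambda>N. r N * (1 / 2)) at_top sequentially"
      by (rule filterlim_at_top_mult_tendsto_pos[OF tendsto_const _ r, of "1/2"]) simp
    then show "filterlim (\<lambda>N. - (r N / 2)) at_bot sequentially"
      by (simp add: filterlim_uminus_at_bot)
  qed
  ultimately have "\<eta> \<longlonglongrightarrow> 0 * (V + Q) + 6 * 0 * Q + 2 * 0 * Q"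
    unfolding \<eta>_def by (intro tendsto_intros \<epsilon>(1))
  then have \<eta>: "\<eta> \<longlonglongrightarrow> 0" by simp
  have rows: "\<forall>\<^sub>F N in sequentially. \<bar>l N * (E N (\<beta>\<^sub>t t N) (A N) - E N \<beta> (A N))
      - (x0 N + x1 N * E N (\<beta>\<^sub>t t N) (X N) + x2 N * E N (\<beta>\<^sub>t t N) (\<lambda>x. (X N x)\<^sup>2))\<bar>
      \<le> \<eta> N * (1 + \<bar>x0 N\<bar> + \<bar>x1 N\<bar> + \<bar>x2 N\<bar>)" if t: "t \<in> {-1, 0, 1}" for t
    using eventually_temperature_window[of 3] win \<epsilon>(2) r[unfolded filterlim_at_top, rule_format, of 0]
  proof eventually_elim
    case (elim N)
    then have N: "1 \<le> N" "0 < real N" "3 \<le> \<rho> * sqrt (real N)" by simp_all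
    interpret S: scaled_energy "M N" "K N" "U N" "\<nu> * real N" using N system by blast
    show ?case
      unfolding \<eta>_def
    proof (rule S.tilted_row[OF \<rho> N(2,3) v_le[OF N(1)] A[OF N(1)] iA[OF N(1)] iA2[OF N(1)] g[OF N(1)] V[OF N(1)]
          _ elim(3,4) _ Q_def refl])
      show "\<bar>t\<bar> \<le> 1" using t by auto
    qed (use elim(2) in blast)+
  qed
  have pos: "0 < \<nu> / \<beta>\<^sup>2" using \<nu>_pos \<beta>_pos by simp
  have ge: "\<forall>\<^sub>F N in sequentially. \<nu> / \<beta>\<^sup>2 \<le> v N \<beta>"
    using eventually_ge_at_top[of 1] by eventually_elim (rule v_ge)
  note lim = row_system_limit[of "\<lambda>t N. l N * (E N (\<beta>\<^sub>t t N) (A N) - E N \<beta> (A N))" x0 x1 "\<lambda>t N. E N (\<beta>\<^sub>t t N) (X N)" x2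
      "\<lambda>t N. E N (\<beta>\<^sub>t t N) (\<lambda>x. (X N x)\<^sup>2)", OF rows \<eta> tilt tilted_first_moment tilted_second_moment pos ge \<kappa>]
  show "(\<lambda>N. x1 N - \<kappa> N / v N \<beta>) \<longlonglongrightarrow> 0" by (rule lim(1))
  show "x0 \<longlonglongrightarrow> 0" by (rule lim(2))
qed

end

definition regular_near :: "real \<Rightarrow> real \<Rightarrow> real \<Rightarrow> (real \<Rightarrow> real) \<Rightarrow> bool" where
  "regular_near u \<delta> T g \<longleftrightarrow> (\<forall>e. \<bar>e - u\<bar> \<le> \<delta> \<longrightarrow>
     (\<forall>k<3. ((deriv ^^ k) g has_real_derivative (deriv ^^ Suc k) g e) (at e)) \<and> \<bar>(deriv ^^ 3) g e\<bar> \<le> T)"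

lemma taylor2_bound:
  assumes g: "regular_near u \<delta> T g" and e: "\<bar>e - u\<bar> \<le> \<delta>"
  shows "\<bar>g e - (g u + deriv g u * (e - u) + (deriv ^^ 2) g u / 2 * (e - u)\<^sup>2)\<bar> \<le> T / 6 * \<bar>e - u\<bar> ^ 3"
proof (cases "e = u")
  case False
  have "\<exists>\<xi>. (if e < u then e < \<xi> \<and> \<xi> < u else u < \<xi> \<and> \<xi> < e) \<and>
     g e = (\<Sum>k<3. (deriv ^^ k) g u / fact k * (e - u) ^ k) + (deriv ^^ 3) g \<xi> / fact 3 * (e - u) ^ 3"
  proof (rule Taylor[where a = "u - \<delta>" and b = "u + \<delta>" and diff = "\<lambda>k. (deriv ^^ k) g"])
    show "\<forall>k t. k < 3 \<and> u - \<delta> \<le> t \<and> t \<le> u + \<delta> \<longrightarrow>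
        ((deriv ^^ k) g has_real_derivative (deriv ^^ Suc k) g t) (at t)"
      using g by (auto simp: regular_near_def abs_le_iff)
  qed (use e False in auto)
  then obtain \<xi> where \<xi>: "if e < u then e < \<xi> \<and> \<xi> < u else u < \<xi> \<and> \<xi> < e"
    "g e = (\<Sum>k<3. (deriv ^^ k) g u / fact k * (e - u) ^ k) + (deriv ^^ 3) g \<xi> / fact 3 * (e - u) ^ 3"
    by blast
  have "\<bar>\<xi> - u\<bar> \<le> \<delta>" using \<xi>(1) e by (auto split: if_splits)
  then have T\<xi>: "\<bar>(deriv ^^ 3) g \<xi>\<bar> \<le> T" using g by (simp add: regular_near_def)
  have "(\<Sum>k<3. (deriv ^^ k) g u / fact k * (e - u) ^ k)
      = g u + deriv g u * (e - u) + (deriv ^^ 2) g u / 2 * (e - u)\<^sup>2"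
    by (simp add: eval_nat_numeral lessThan_Suc)
  then have eq: "g e - (g u + deriv g u * (e - u) + (deriv ^^ 2) g u / 2 * (e - u)\<^sup>2)
      = (deriv ^^ 3) g \<xi> / 6 * (e - u) ^ 3"
    using \<xi>(2) by (simp add: fact_numeral)
  show ?thesis unfolding eq using T\<xi> by (simp add: abs_mult power_abs mult_right_mono)
qed simp

section \<open>Microcanonical averages and their first derivatives at the mean energy\<close>

context energy_family
begin

abbreviation "regular N a T g \<equiv>
  regular_near (u N) (a * sqrt (ln (real N) / real N)) (T * (sqrt (real N) / ln (real N))) g"

text \<open>To leading order \<open>g\<close> and its slope are those of \<open>c N \<phi>\<close>
  composed with the inverse of the map from temperature to mean energy, whose slope is
  \<open>- v\<close>. Here \<open>c N\<close> is the order of the mean of \<open>A\<close> and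
  \<open>L N\<close> the norm in the hypotheses; \<open>\<mu> \<noteq> 0\<close> makes them
  comparable.\<close>

lemma microcanonical_expansion:
  fixes A :: "nat \<Rightarrow> 'a \<Rightarrow> real" and g :: "nat \<Rightarrow> real \<Rightarrow> real" and c L :: "nat \<Rightarrow> real" and \<phi> :: "real \<Rightarrow> real"
  assumes A: "\<And>N. 1 \<le> N \<Longrightarrow> A N \<in> borel_measurable (M N)"
    and iA: "\<And>N b. 1 \<le> N \<Longrightarrow> 0 < b \<Longrightarrow> integrable (M N) (\<lambda>x. A N x * exp (- b * H N x))"
    and iA2: "\<And>N. 1 \<le> N \<Longrightarrow> integrable (M N) (\<lambda>x. (A N x)\<^sup>2 * exp (- \<beta> * H N x))"
    and g: "\<And>N. 1 \<le> N \<Longrightarrow> conditional N (A N) (g N)"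
    and L_pos: "\<And>N. 1 \<le> N \<Longrightarrow> 0 < L N"
    and V: "\<And>N. 1 \<le> N \<Longrightarrow> real N / (L N)\<^sup>2 * (E N \<beta> (\<lambda>x. (A N x)\<^sup>2) - (E N \<beta> (A N))\<^sup>2) \<le> V"
    and EA: "\<And>N b. 1 \<le> N \<Longrightarrow> 0 < b \<Longrightarrow> E N b (A N) = c N * \<phi> b"
    and \<phi>: "(\<phi> has_real_derivative \<phi>') (at \<beta>)" and cL: "(\<lambda>N. c N / L N) \<longlonglongrightarrow> \<mu>" "\<mu> \<noteq> 0"
    and a: "0 < a"
    and D: "\<And>N. 2 \<le> N \<Longrightarrow> regular N a (T * L N) (g N)"
    and T0: "0 \<le> T"
  shows "(\<lambda>N. g N (u N) / c N) \<longlonglongrightarrow> \<phi> \<beta>"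
    and "(\<lambda>N. deriv (g N) (u N) / c N + \<phi>' / v N \<beta>) \<longlonglongrightarrow> 0"
proof -
  let ?s = "\<lambda>N. sqrt (real N)"
  \<comment> \<open>With this factor \<open>V\<close> bounds the variance of
    \<open>l (A - E A)\<close>. The numbers \<open>x0\<close>, \<open>x1\<close>, \<open>x2\<close>
    are the Taylor coefficients of \<open>l (g - E A)\<close> in the variable
    \<open>sqrt N (e - u)\<close>, and \<open>r\<close> is the window in that variable.\<close>
  define l where "l N = ?s N / L N" for N
  define x0 where "x0 N = l N * (g N (u N) - E N \<beta> (A N))" for N
  define x1 where "x1 N = l N * deriv (g N) (u N) / ?s N" for N
  define x2 where "x2 N = l N * (deriv ^^ 2) (g N) (u N) / (2 * real N)" for N
  define \<kappa> where "\<kappa> N = - \<phi>' * (c N / L N)" for N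
  define r where "r N = a * sqrt (ln (real N))" for N
  \<comment> \<open>The bound on the third derivative over 3!, times \<open>l\<close> and the factor
    \<open>N powr (-3/2)\<close> from the change of variable: \<open>L\<close> cancels and
    \<open>1 / (sqrt N ln N)\<close> remains.\<close>
  define \<epsilon> where "\<epsilon> N = T / 6 / (?s N * ln (real N))" for N
  have V': "(l N)\<^sup>2 * (E N \<beta> (\<lambda>x. (A N x)\<^sup>2) - (E N \<beta> (A N))\<^sup>2) \<le> V" if "1 \<le> N" for N
    using V[OF that] by (simp add: l_def power_divide)
  have ev2: "\<forall>\<^sub>F N in sequentially. 2 \<le> N" by (rule eventually_ge_at_top)
  have ln_top: "filterlim (\<lambda>N. ln (real N)) at_top sequentially"
    by (rule filterlim_compose[OF ln_at_top filterlim_real_sequentially])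
  have r: "filterlim r at_top sequentially"
    unfolding r_def
    by (rule filterlim_tendsto_pos_mult_at_top[OF tendsto_const a filterlim_compose[OF sqrt_at_top ln_top]])
  have "filterlim (\<lambda>N. ?s N * ln (real N)) at_top sequentially"
    by (rule filterlim_at_top_mult_at_top[OF sqrt_real_at_top ln_top])
  then have \<epsilon>: "\<epsilon> \<longlonglongrightarrow> 0"
    unfolding \<epsilon>_def by (rule real_tendsto_divide_at_top[OF tendsto_const])
  have \<epsilon>0: "\<forall>\<^sub>F N in sequentially. 0 \<le> \<epsilon> N"
    using ev2 by eventually_elim (use T0 in \<open>simp add: \<epsilon>_def\<close>)
  have tilt: "(\<lambda>N. l N * (E N (\<beta>\<^sub>t t N) (A N) - E N \<beta> (A N)) - t * \<kappa> N) \<longlonglongrightarrow> 0" for t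
  proof (cases "t = 0")
    case True
    then show ?thesis by simp
  next
    case False
    \<comment> \<open>The change of the mean is a difference quotient of \<open>\<phi>\<close> with
      step \<open>\<tau>\<close>, the factor \<open>sqrt N\<close> in \<open>l\<close> being the
      inverse step up to \<open>- t\<close>. The step must avoid 0, hence the separate case
      \<open>t = 0\<close>.\<close>
    define \<tau> where "\<tau> N = - t / ?s N" for N
    have \<tau>0: "\<tau> \<longlonglongrightarrow> 0" unfolding \<tau>_def by (rule const_over_sqrt)
    have "((\<lambda>h. (\<phi> (\<beta> + h) - \<phi> \<beta>) / h) \<longlongrightarrow> \<phi>') (at 0)" using \<phi> by (simp add: DERIV_def)
    moreover have "filterlim \<tau> (at 0) sequentially"
      using \<tau>0 ev2 False by (auto simp: filterlim_at \<tau>_def elim!: eventually_mono)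
    ultimately have q: "(\<lambda>N. (\<phi> (\<beta> + \<tau> N) - \<phi> \<beta>) / \<tau> N) \<longlonglongrightarrow> \<phi>'"
      by (rule filterlim_compose)
    have "(\<lambda>N. - t * (c N / L N) * ((\<phi> (\<beta> + \<tau> N) - \<phi> \<beta>) / \<tau> N - \<phi>')) \<longlonglongrightarrow> - t * \<mu> * (\<phi>' - \<phi>')"
      by (intro tendsto_intros cL q)
    then have lim: "(\<lambda>N. - t * (c N / L N) * ((\<phi> (\<beta> + \<tau> N) - \<phi> \<beta>) / \<tau> N - \<phi>')) \<longlonglongrightarrow> 0" by simp
    have "\<forall>\<^sub>F N in sequentially. - t * (c N / L N) * ((\<phi> (\<beta> + \<tau> N) - \<phi> \<beta>) / \<tau> N - \<phi>')
        = l N * (E N (\<beta>\<^sub>t t N) (A N) - E N \<beta> (A N)) - t * \<kappa> N"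
      using ev2 eventually_temperature_window[of "\<bar>t\<bar>"]
    proof eventually_elim
      case (elim N)
      have "\<bar>t / ?s N\<bar> \<le> \<rho>" using elim by (simp add: field_simps)
      then have "0 < \<beta>\<^sub>t t N" using \<rho> by linarith
      then have "E N (\<beta>\<^sub>t t N) (A N) - E N \<beta> (A N) = c N * (\<phi> (\<beta> + \<tau> N) - \<phi> \<beta>)"
        using EA[of N] elim \<beta>_pos by (simp add: \<tau>_def right_diff_distrib)
      then have "l N * (E N (\<beta>\<^sub>t t N) (A N) - E N \<beta> (A N))
          = ?s N * (c N / L N) * (\<phi> (\<beta> + \<tau> N) - \<phi> \<beta>)"
        by (simp add: l_def)
      moreover have "- t / \<tau> N = ?s N" using elim False by (simp add: \<tau>_def)
      then have "- t * (c N / L N) * ((\<phi> (\<beta> + \<tau> N) - \<phi> \<beta>) / \<tau> N)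
          = ?s N * (c N / L N) * (\<phi> (\<beta> + \<tau> N) - \<phi> \<beta>)"
      proof -
        have move: "- t * k * (D / y) = - t / y * k * D" for k D y by simp
        show ?thesis by (simp only: move \<open>- t / \<tau> N = ?s N\<close>)
      qed
      ultimately show ?case by (simp add: \<kappa>_def right_diff_distrib)
    qed
    from Lim_transform_eventually[OF lim this] show ?thesis .
  qed
  have \<kappa>_lim: "\<kappa> \<longlonglongrightarrow> - \<phi>' * \<mu>" unfolding \<kappa>_def by (intro tendsto_intros cL)
  then have "\<forall>\<^sub>F N in sequentially. \<bar>\<kappa> N\<bar> < \<bar>\<phi>' * \<mu>\<bar> + 1"
    by (intro order_tendstoD(2)[OF tendsto_rabs]) auto
  then have \<kappa>: "\<forall>\<^sub>F N in sequentially. \<bar>\<kappa> N\<bar> \<le> \<bar>\<phi>' * \<mu>\<bar> + 1"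
    by eventually_elim simp
  have win: "\<forall>\<^sub>F N in sequentially. \<forall>y. \<bar>y\<bar> \<le> r N \<longrightarrow>
      \<bar>l N * (g N (u N + y / ?s N) - E N \<beta> (A N)) - (x0 N + x1 N * y + x2 N * y\<^sup>2)\<bar> \<le> \<epsilon> N * \<bar>y\<bar> ^ 3"
    using ev2
  proof eventually_elim
    case (elim N)
    have N: "0 < ?s N" "0 < ln (real N)" "0 < L N" "?s N * ?s N = real N"
      using elim L_pos[of N] by auto
    have l: "0 < l N" using N by (simp add: l_def)
    show ?case
    proof safe
      fix y assume y: "\<bar>y\<bar> \<le> r N"
      define e where "e = u N + y / ?s N"
      have ey: "e - u N = y / ?s N" by (simp add: e_def)
      have "\<bar>e - u N\<bar> \<le> a * sqrt (ln (real N) / real N)"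
        unfolding ey using y N by (simp add: r_def real_sqrt_divide divide_right_mono)
      define \<Delta> where "\<Delta> = g N e - (g N (u N) + deriv (g N) (u N) * (y / ?s N)
          + (deriv ^^ 2) (g N) (u N) / 2 * (y / ?s N)\<^sup>2)"
      have "\<bar>\<Delta>\<bar> \<le> T * L N * (?s N / ln (real N)) / 6 * \<bar>y / ?s N\<bar> ^ 3"
        using taylor2_bound[OF D[OF elim] \<open>\<bar>e - u N\<bar> \<le> _\<close>] unfolding ey \<Delta>_def by simp
      then have "l N * \<bar>\<Delta>\<bar> \<le> l N * (T * L N * (?s N / ln (real N)) / 6 * \<bar>y / ?s N\<bar> ^ 3)"
        using l by (intro mult_left_mono) auto
      also have "l N * \<bar>\<Delta>\<bar> = \<bar>l N * \<Delta>\<bar>" using l by (simp add: abs_mult)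
      also have "l N * \<Delta> = l N * (g N e - E N \<beta> (A N)) - (x0 N + x1 N * y + x2 N * y\<^sup>2)"
        unfolding \<Delta>_def x0_def x1_def x2_def by (simp add: power_divide algebra_simps)
      also have "l N * (T * L N * (?s N / ln (real N)) / 6 * \<bar>y / ?s N\<bar> ^ 3) = \<epsilon> N * \<bar>y\<bar> ^ 3"
      proof -
        have "s / k * (T * k * (s / n) / 6 * \<bar>y / s\<bar> ^ 3) = T / 6 / (s * n) * \<bar>y\<bar> ^ 3"
          if "0 < s" "0 < n" "0 < k" for s n k :: real
        proof -
          have "s / k * (T * k * (s / n) / 6 * (Y / s ^ 3)) = T / 6 / (s * n) * Y" for Y
            using that by (simp add: power3_eq_cube)
          then show ?thesis using that by (simp add: power_divide)
        qed
        then show ?thesis unfolding l_def \<epsilon>_def using N by blast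
      qed
      finally show "\<bar>l N * (g N (u N + y / ?s N) - E N \<beta> (A N)) - (x0 N + x1 N * y + x2 N * y\<^sup>2)\<bar>
          \<le> \<epsilon> N * \<bar>y\<bar> ^ 3" by (simp add: e_def)
    qed
  qed
  note lims = conditional_expansion[OF A iA iA2 g V' tilt \<kappa> win \<epsilon> \<epsilon>0 r]
  have Lc: "(\<lambda>N. inverse (c N / L N)) \<longlonglongrightarrow> inverse \<mu>" by (intro tendsto_inverse cL)
  have c0: "\<forall>\<^sub>F N in sequentially. c N / L N \<noteq> 0"
    by (rule tendsto_imp_eventually_ne[OF cL])
  \<comment> \<open>Undoing the normalisation multiplies \<open>x0\<close> by \<open>L / c\<close>
    and by \<open>1 / sqrt N\<close>; for the derivative below no factor \<open>1 / sqrt N\<close>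
    is left, and the limit of \<open>x1\<close> is used in full.\<close>
  have "(\<lambda>N. \<phi> \<beta> + x0 N * inverse (c N / L N) * (1 / ?s N)) \<longlonglongrightarrow> \<phi> \<beta> + 0 * inverse \<mu> * 0"
    by (intro tendsto_intros lims(2) Lc const_over_sqrt)
  then have 1: "(\<lambda>N. \<phi> \<beta> + x0 N * inverse (c N / L N) * (1 / ?s N)) \<longlonglongrightarrow> \<phi> \<beta>" by simp
  have "\<forall>\<^sub>F N in sequentially. \<phi> \<beta> + x0 N * inverse (c N / L N) * (1 / ?s N) = g N (u N) / c N"
    using ev2 c0
  proof eventually_elim
    case (elim N)
    then have "x0 N * inverse (c N / L N) * (1 / ?s N) = (g N (u N) - c N * \<phi> \<beta>) / c N"
      using EA[of N \<beta>] \<beta>_pos by (simp add: x0_def l_def)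
    then show ?case using elim by (simp add: diff_divide_distrib)
  qed
  from Lim_transform_eventually[OF 1 this] show "(\<lambda>N. g N (u N) / c N) \<longlonglongrightarrow> \<phi> \<beta>" .
  have "(\<lambda>N. (x1 N - \<kappa> N / v N \<beta>) * inverse (c N / L N)) \<longlonglongrightarrow> 0 * inverse \<mu>"
    by (intro tendsto_intros lims(1) Lc)
  then have 2: "(\<lambda>N. (x1 N - \<kappa> N / v N \<beta>) * inverse (c N / L N)) \<longlonglongrightarrow> 0" by simp
  have "\<forall>\<^sub>F N in sequentially. (x1 N - \<kappa> N / v N \<beta>) * inverse (c N / L N) = deriv (g N) (u N) / c N + \<phi>' / v N \<beta>"
    using ev2 c0
  proof eventually_elim
    case (elim N)
    then have "x1 N = deriv (g N) (u N) / L N" "c N \<noteq> 0" "L N \<noteq> 0" by (auto simp: x1_def l_def)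
    then have "x1 N * inverse (c N / L N) = deriv (g N) (u N) / c N"
      "\<kappa> N * inverse (c N / L N) = - \<phi>'" by (simp_all add: \<kappa>_def)
    moreover have "(x1 N - \<kappa> N / v N \<beta>) * inverse (c N / L N)
        = x1 N * inverse (c N / L N) - \<kappa> N * inverse (c N / L N) / v N \<beta>"
      by (simp only: left_diff_distrib times_divide_eq_left)
    ultimately show ?case by simp
  qed
  from Lim_transform_eventually[OF 2 this] show "(\<lambda>N. deriv (g N) (u N) / c N + \<phi>' / v N \<beta>) \<longlonglongrightarrow> 0" .
qed

lemma divide_sqrt_eq: "0 \<le> x \<Longrightarrow> x / sqrt y = sqrt (x\<^sup>2 / y)"
  by (simp add: real_sqrt_divide)

lemma affine_ratio_tendsto_1: "(\<lambda>N. (\<nu> * real N + p) / (\<nu> * real N + q)) \<longlonglongrightarrow> 1"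
proof -
  have top: "filterlim (\<lambda>N. q + \<nu> * real N) at_top sequentially"
    by (intro filterlim_tendsto_add_at_top[OF tendsto_const]
        filterlim_tendsto_pos_mult_at_top[OF tendsto_const \<nu>_pos filterlim_real_sequentially])
  have "(\<lambda>N. 1 + (p - q) / (q + \<nu> * real N)) \<longlonglongrightarrow> 1 + 0"
    by (intro tendsto_intros real_tendsto_divide_at_top[OF tendsto_const top])
  moreover have "\<forall>\<^sub>F N in sequentially. 1 + (p - q) / (q + \<nu> * real N) = (\<nu> * real N + p) / (\<nu> * real N + q)"
    using top[unfolded filterlim_at_top_dense, rule_format, of 0]
    by eventually_elim (simp add: field_simps)
  ultimately show ?thesis by (simp add: Lim_transform_eventually)
qed

lemma kinetic_energy_expansion:
  fixes g :: "nat \<Rightarrow> real \<Rightarrow> real"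
  defines "L \<equiv> \<lambda>N. sqrt (E N \<beta> (\<lambda>x. (K N x)\<^sup>2))"
  assumes g: "\<And>N. 1 \<le> N \<Longrightarrow> conditional N (K N) (g N)"
    and a: "0 < a"
    and D: "\<And>N. 2 \<le> N \<Longrightarrow> regular N a (T * L N) (g N)"
    and T0: "0 \<le> T"
  shows "(\<lambda>N. g N (u N) / (\<nu> * real N)) \<longlonglongrightarrow> 1 / \<beta>"
    and "(\<lambda>N. deriv (g N) (u N) / (\<nu> * real N) + (- 1 / \<beta>\<^sup>2) / v N \<beta>) \<longlonglongrightarrow> 0"
proof -
  have L: "L N = sqrt (\<nu> * real N * (\<nu> * real N + 1) / \<beta>\<^sup>2)" if "1 \<le> N" for N
    unfolding L_def scaled_energy.E_K2[OF system[OF that] \<beta>_pos] ..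
  have m: "0 < \<nu> * real N" if "1 \<le> N" for N using \<nu>_pos that by simp
  have cL: "(\<lambda>N. \<nu> * real N / L N) \<longlonglongrightarrow> \<beta>"
  proof -
    have "(\<lambda>N. sqrt (\<beta>\<^sup>2 * ((\<nu> * real N + 0) / (\<nu> * real N + 1)))) \<longlonglongrightarrow> sqrt (\<beta>\<^sup>2 * 1)"
      by (intro tendsto_intros affine_ratio_tendsto_1)
    moreover have "\<forall>\<^sub>F N in sequentially. sqrt (\<beta>\<^sup>2 * ((\<nu> * real N + 0) / (\<nu> * real N + 1))) = \<nu> * real N / L N"
      using eventually_ge_at_top[of 1]
    proof eventually_elim
      case (elim N)
      note m = m[OF elim]
      have "\<nu> * real N / L N = sqrt ((\<nu> * real N)\<^sup>2 / (\<nu> * real N * (\<nu> * real N + 1) / \<beta>\<^sup>2))"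
        unfolding L[OF elim] by (rule divide_sqrt_eq) (use m in simp)
      also have "(\<nu> * real N)\<^sup>2 / (\<nu> * real N * (\<nu> * real N + 1) / \<beta>\<^sup>2) = \<beta>\<^sup>2 * ((\<nu> * real N + 0) / (\<nu> * real N + 1))"
        using m by (simp add: power2_eq_square)
      finally show ?case ..
    qed
    ultimately show ?thesis using \<beta>_pos by (simp add: Lim_transform_eventually)
  qed
  have \<phi>: "((\<lambda>b. 1 / b) has_real_derivative - 1 / \<beta>\<^sup>2) (at \<beta>)"
    using \<beta>_pos by (auto intro!: derivative_eq_intros simp: power2_eq_square)
  have int: "integrable (M N) (\<lambda>x. K N x ^ j * exp (- b * H N x))" if "1 \<le> N" "0 < b" for N b j
    using scaled_energy.integrable_K_power_expH[OF system] that by blast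
  \<comment> \<open>\<open>1 / \<nu>\<close> bounds \<open>N / (\<nu> N + 1)\<close>, which is
    \<open>N\<close> times the variance of \<open>K\<close> over \<open>L^2\<close>.\<close>
  note concl = microcanonical_expansion[where A = K and c = "\<lambda>N. \<nu> * real N" and V = "1 / \<nu>",
      OF scaled_energy.K_measurable[OF system] _ _ g _ _ _ \<phi> cL _ a D T0]
  have "integrable (M N) (\<lambda>x. K N x * exp (- b * H N x))" if "1 \<le> N" "0 < b" for N b
    using int[OF that, of 1] by simp
  moreover have "integrable (M N) (\<lambda>x. (K N x)\<^sup>2 * exp (- \<beta> * H N x))" if "1 \<le> N" for N
    using int[OF that \<beta>_pos] .
  moreover have "0 < L N" if "1 \<le> N" for N
    using L[OF that] m[OF that] \<beta>_pos by simp
  moreover have "real N / (L N)\<^sup>2 * (E N \<beta> (\<lambda>x. (K N x)\<^sup>2) - (E N \<beta> (K N))\<^sup>2) \<le> 1 / \<nu>" if N: "1 \<le> N" for N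
  proof -
    have "(L N)\<^sup>2 = \<nu> * real N * (\<nu> * real N + 1) / \<beta>\<^sup>2" using L[OF N] m[OF N] by simp
    then have "real N / (L N)\<^sup>2 * (\<nu> * real N / \<beta>\<^sup>2) = real N / (\<nu> * real N + 1)"
      using m[OF N] \<beta>_pos \<nu>_pos by simp
    also have "\<dots> \<le> 1 / \<nu>" using \<nu>_pos m[OF N] by (simp add: field_simps)
    finally show ?thesis unfolding scaled_energy.variance_K[OF system[OF N] \<beta>_pos] .
  qed
  moreover have "E N b (K N) = \<nu> * real N * (1 / b)" if "1 \<le> N" "0 < b" for N b
    using scaled_energy.E_K[OF system] that by simp
  ultimately show "(\<lambda>N. g N (u N) / (\<nu> * real N)) \<longlonglongrightarrow> 1 / \<beta>"
    "(\<lambda>N. deriv (g N) (u N) / (\<nu> * real N) + (- 1 / \<beta>\<^sup>2) / v N \<beta>) \<longlonglongrightarrow> 0"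
    using concl \<beta>_pos by blast+
qed

lemma squared_kinetic_energy_expansion:
  fixes g :: "nat \<Rightarrow> real \<Rightarrow> real"
  defines "L \<equiv> \<lambda>N. sqrt (E N \<beta> (\<lambda>x. ((K N x)\<^sup>2)\<^sup>2))"
  assumes g: "\<And>N. 1 \<le> N \<Longrightarrow> conditional N (\<lambda>x. (K N x)\<^sup>2) (g N)"
    and a: "0 < a"
    and D: "\<And>N. 2 \<le> N \<Longrightarrow> regular N a (T * L N) (g N)"
    and T0: "0 \<le> T"
  shows "(\<lambda>N. g N (u N) / (\<nu> * real N * (\<nu> * real N + 1))) \<longlonglongrightarrow> 1 / \<beta>\<^sup>2"
    and "(\<lambda>N. deriv (g N) (u N) / (\<nu> * real N * (\<nu> * real N + 1)) + (- 2 / \<beta> ^ 3) / v N \<beta>) \<longlonglongrightarrow> 0"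
proof -
  define m where "m N = \<nu> * real N" for N
  have m: "0 < m N" if "1 \<le> N" for N using \<nu>_pos that by (simp add: m_def)
  have K4: "E N \<beta> (\<lambda>x. ((K N x)\<^sup>2)\<^sup>2) = m N * (m N + 1) * ((m N + 2) * (m N + 3)) / \<beta> ^ 4" if "1 \<le> N" for N
    using scaled_energy.E_K4[OF system[OF that] \<beta>_pos] by (simp add: m_def mult.assoc flip: power_mult)
  have L: "L N = sqrt (m N * (m N + 1) * ((m N + 2) * (m N + 3)) / \<beta> ^ 4)" if "1 \<le> N" for N
    unfolding L_def K4[OF that] ..
  have cL: "(\<lambda>N. m N * (m N + 1) / L N) \<longlonglongrightarrow> \<beta>\<^sup>2"
  proof -
    have "(\<lambda>N. sqrt (\<beta> ^ 4 * (((m N + 0) / (m N + 2)) * ((m N + 1) / (m N + 3))))) \<longlonglongrightarrow> sqrt (\<beta> ^ 4 * (1 * 1))"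
      unfolding m_def by (intro tendsto_intros affine_ratio_tendsto_1)
    moreover have "\<forall>\<^sub>F N in sequentially. sqrt (\<beta> ^ 4 * (((m N + 0) / (m N + 2)) * ((m N + 1) / (m N + 3))))
        = m N * (m N + 1) / L N"
      using eventually_ge_at_top[of 1]
    proof eventually_elim
      case (elim N)
      note m = m[OF elim]
      have "m N * (m N + 1) / L N = sqrt ((m N * (m N + 1))\<^sup>2 / (m N * (m N + 1) * ((m N + 2) * (m N + 3)) / \<beta> ^ 4))"
        unfolding L[OF elim] by (rule divide_sqrt_eq) (use m in simp)
      also have "(m N * (m N + 1))\<^sup>2 / (m N * (m N + 1) * ((m N + 2) * (m N + 3)) / \<beta> ^ 4)
          = \<beta> ^ 4 * (((m N + 0) / (m N + 2)) * ((m N + 1) / (m N + 3)))"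
      proof -
        have "y\<^sup>2 / (y * z / w) = w * (y / z)" if "y \<noteq> 0" for y z w :: real
          using that by (simp add: power2_eq_square)
        from this[of "m N * (m N + 1)"] show ?thesis using m by simp
      qed
      finally show ?case ..
    qed
    moreover have "sqrt (\<beta> ^ 4) = \<beta>\<^sup>2" by (rule real_sqrt_unique) (simp_all flip: power_mult)
    ultimately show ?thesis by (simp add: Lim_transform_eventually)
  qed
  have \<phi>: "((\<lambda>b. 1 / b\<^sup>2) has_real_derivative - 2 / \<beta> ^ 3) (at \<beta>)"
    using \<beta>_pos by (auto intro!: derivative_eq_intros simp: power2_eq_square power3_eq_cube)
  have int: "integrable (M N) (\<lambda>x. K N x ^ j * exp (- b * H N x))" if "1 \<le> N" "0 < b" for N b j
    using scaled_energy.integrable_K_power_expH[OF system] that by blast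
  \<comment> \<open>The variance of \<open>K^2\<close> contains the factor
    \<open>(m + 2) (m + 3) - m (m + 1) = 4 m + 6\<close>, one power of \<open>m\<close> less than in
    the fourth moment; times \<open>N / L^2\<close> this leaves at most \<open>4 / \<nu>\<close>.
    Taking \<open>m (m + 1)\<close> for \<open>c\<close> makes the mean an exact multiple of
    \<open>1 / b^2\<close>.\<close>
  note concl = microcanonical_expansion[where A = "\<lambda>N x. (K N x)\<^sup>2" and c = "\<lambda>N. m N * (m N + 1)" and V = "4 / \<nu>",
      OF borel_measurable_power[OF scaled_energy.K_measurable[OF system]] _ _ g _ _ _ \<phi> cL _ a D T0]
  have "integrable (M N) (\<lambda>x. (K N x)\<^sup>2 * exp (- b * H N x))" if "1 \<le> N" "0 < b" for N b
    using int[OF that, of 2] .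
  moreover have "integrable (M N) (\<lambda>x. ((K N x)\<^sup>2)\<^sup>2 * exp (- \<beta> * H N x))" if "1 \<le> N" for N
    using int[OF that \<beta>_pos, of 4] by (simp flip: power_mult)
  moreover have "0 < L N" if "1 \<le> N" for N
    using L[OF that] m[OF that] \<beta>_pos by simp
  moreover have "real N / (L N)\<^sup>2 * (E N \<beta> (\<lambda>x. ((K N x)\<^sup>2)\<^sup>2) - (E N \<beta> (\<lambda>x. (K N x)\<^sup>2))\<^sup>2) \<le> 4 / \<nu>" if N: "1 \<le> N" for N
  proof -
    note m = m[OF N]
    have K2: "E N \<beta> (\<lambda>x. (K N x)\<^sup>2) = m N * (m N + 1) / \<beta>\<^sup>2"
      using scaled_energy.E_K2[OF system[OF N] \<beta>_pos] by (simp add: m_def)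
    have L2: "(L N)\<^sup>2 = m N * (m N + 1) * ((m N + 2) * (m N + 3)) / \<beta> ^ 4" using L[OF N] m by simp
    have "E N \<beta> (\<lambda>x. ((K N x)\<^sup>2)\<^sup>2) - (E N \<beta> (\<lambda>x. (K N x)\<^sup>2))\<^sup>2
        = m N * (m N + 1) * ((m N + 2) * (m N + 3)) / \<beta> ^ 4 - (m N * (m N + 1))\<^sup>2 / \<beta> ^ 4"
      unfolding K4[OF N] K2 by (simp add: power_divide flip: power_mult)
    also have "\<dots> = m N * (m N + 1) * (4 * m N + 6) / \<beta> ^ 4"
      by (simp add: power2_eq_square algebra_simps flip: diff_divide_distrib)
    finally have "real N / (L N)\<^sup>2 * (E N \<beta> (\<lambda>x. ((K N x)\<^sup>2)\<^sup>2) - (E N \<beta> (\<lambda>x. (K N x)\<^sup>2))\<^sup>2)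
        = real N * (4 * m N + 6) / ((m N + 2) * (m N + 3))"
      unfolding L2 using m \<beta>_pos by simp
    also have "\<dots> \<le> 4 / \<nu>"
    proof -
      have "m N * (4 * m N + 6) \<le> 4 * ((m N + 2) * (m N + 3))" using m by (simp add: algebra_simps)
      then show ?thesis using \<nu>_pos m by (simp add: divide_le_eq le_divide_eq m_def mult_ac)
    qed
    finally show ?thesis .
  qed
  moreover have "E N b (\<lambda>x. (K N x)\<^sup>2) = m N * (m N + 1) * (1 / b\<^sup>2)" if "1 \<le> N" "0 < b" for N b
    using scaled_energy.E_K2[OF system] that by (simp add: m_def)
  moreover have "\<beta>\<^sup>2 \<noteq> 0" using \<beta>_pos by simp
  ultimately have "(\<lambda>N. g N (u N) / (m N * (m N + 1))) \<longlonglongrightarrow> 1 / \<beta>\<^sup>2"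
    "(\<lambda>N. deriv (g N) (u N) / (m N * (m N + 1)) + (- 2 / \<beta> ^ 3) / v N \<beta>) \<longlonglongrightarrow> 0"
    using concl by blast+
  then show "(\<lambda>N. g N (u N) / (\<nu> * real N * (\<nu> * real N + 1))) \<longlonglongrightarrow> 1 / \<beta>\<^sup>2"
    "(\<lambda>N. deriv (g N) (u N) / (\<nu> * real N * (\<nu> * real N + 1)) + (- 2 / \<beta> ^ 3) / v N \<beta>) \<longlonglongrightarrow> 0"
    unfolding m_def .
qed

lemma microcanonical_variance_limit:
  fixes g G :: "nat \<Rightarrow> real \<Rightarrow> real"
  assumes g: "\<And>N. 1 \<le> N \<Longrightarrow> conditional N (K N) (g N)"
    and G: "\<And>N. 1 \<le> N \<Longrightarrow> conditional N (\<lambda>x. (K N x)\<^sup>2) (G N)"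
    and a: "0 < a" "0 < a'"
    and Dg: "\<And>N. 2 \<le> N \<Longrightarrow> regular N a (T * sqrt (E N \<beta> (\<lambda>x. (K N x)\<^sup>2))) (g N)"
    and DG: "\<And>N. 2 \<le> N \<Longrightarrow> regular N a' (T' * sqrt (E N \<beta> (\<lambda>x. ((K N x)\<^sup>2)\<^sup>2))) (G N)"
    and T: "0 \<le> T" "0 \<le> T'"
  shows "(\<lambda>N. (G N (u N) - (g N (u N))\<^sup>2) / real N - (\<nu> / \<beta>\<^sup>2 - \<nu>\<^sup>2 / (\<beta> ^ 4 * v N \<beta>))) \<longlonglongrightarrow> 0"
proof -
  define m where "m N = \<nu> * real N" for N
  define x where "x N = g N (u N) / m N" for N
  define x' where "x' N = deriv (g N) (u N) / m N" for N
  define y where "y N = G N (u N) / (m N * (m N + 1))" for N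
  define y' where "y' N = deriv (G N) (u N) / (m N * (m N + 1))" for N
  \<comment> \<open>\<open>v\<close> need not converge as N grows, so \<open>x'\<close> and
    \<open>y'\<close> are compared with multiples of \<open>w\<close>. Of \<open>w\<close> only
    boundedness is used; it follows from the lower bound on \<open>v\<close>.\<close>
  define w where "w N = 1 / v N \<beta>" for N
  define p where "p N = x' N - w N / \<beta>\<^sup>2" for N
  define q where "q N = y' N - 2 * w N / \<beta> ^ 3" for N
  have x: "x \<longlonglongrightarrow> 1 / \<beta>" and "(\<lambda>N. x' N + (- 1 / \<beta>\<^sup>2) / v N \<beta>) \<longlonglongrightarrow> 0"
    using kinetic_energy_expansion[OF g a(1) Dg T(1)] by (simp_all add: x_def[abs_def] x'_def m_def)
  then have p: "p \<longlonglongrightarrow> 0" by (simp add: p_def[abs_def] w_def mult.commute)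
  have y: "y \<longlonglongrightarrow> 1 / \<beta>\<^sup>2" and "(\<lambda>N. y' N + (- 2 / \<beta> ^ 3) / v N \<beta>) \<longlonglongrightarrow> 0"
    using squared_kinetic_energy_expansion[OF G a(2) DG T(2)] by (simp_all add: y_def[abs_def] y'_def m_def)
  then have q: "q \<longlonglongrightarrow> 0" by (simp add: q_def[abs_def] w_def mult.commute)
  have w_bd: "Bseq w"
  proof (rule BseqI'[where K = "max (\<bar>w 0\<bar>) (\<beta>\<^sup>2 / \<nu>)"])
    show "norm (w N) \<le> max (\<bar>w 0\<bar>) (\<beta>\<^sup>2 / \<nu>)" for N
    proof (cases "N = 0")
      case False
      have pos: "0 < \<nu> / \<beta>\<^sup>2" using \<nu>_pos \<beta>_pos by simp
      have ge: "\<nu> / \<beta>\<^sup>2 \<le> v N \<beta>" using v_ge[of N] False by simp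
      have "inverse (v N \<beta>) \<le> inverse (\<nu> / \<beta>\<^sup>2)" by (rule le_imp_inverse_le[OF ge pos])
      moreover have "0 < v N \<beta>" using ge pos by linarith
      ultimately show ?thesis by (simp add: w_def inverse_eq_divide le_max_iff_disj)
    qed simp
  qed
  have ode: "(g N (u N) * deriv (G N) (u N) - G N (u N) * deriv (g N) (u N)) / real N
      + m N * G N (u N) - (m N + 1) * (g N (u N))\<^sup>2 = 0" if N: "2 \<le> N" for N
  proof -
    interpret S: scaled_energy "M N" "K N" "U N" "\<nu> * real N" using N system by simp
    \<comment> \<open>A common window for \<open>g\<close> and \<open>G\<close>. It has positive
      width because \<open>2 \<le> N\<close> makes \<open>ln N\<close> positive.\<close>
    define \<delta> where "\<delta> = min a a' * sqrt (ln (real N) / real N)"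
    have pos: "0 < sqrt (ln (real N) / real N)" using N by simp
    then have \<delta>: "0 < \<delta>" using a by (simp add: \<delta>_def)
    have in_window: "\<bar>e - u N\<bar> \<le> a * sqrt (ln (real N) / real N)" "\<bar>e - u N\<bar> \<le> a' * sqrt (ln (real N) / real N)"
      if "\<bar>e - u N\<bar> < \<delta>" for e
      using that mult_right_mono[of "min a a'" a "sqrt (ln (real N) / real N)"]
        mult_right_mono[of "min a a'" a' "sqrt (ln (real N) / real N)"] pos
      unfolding \<delta>_def by linarith+
    have D: "(g N has_real_derivative deriv (g N) e) (at e)" "(deriv (g N) has_real_derivative deriv (deriv (g N)) e) (at e)"
      "(G N has_real_derivative deriv (G N) e) (at e)" "(deriv (G N) has_real_derivative deriv (deriv (G N)) e) (at e)"
      if e: "\<bar>e - u N\<bar> < \<delta>" for e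
    proof -
      have "\<forall>k<3. ((deriv ^^ k) (g N) has_real_derivative (deriv ^^ Suc k) (g N) e) (at e)"
        "\<forall>k<3. ((deriv ^^ k) (G N) has_real_derivative (deriv ^^ Suc k) (G N) e) (at e)"
        using Dg[OF N] DG[OF N] in_window[OF e] unfolding regular_near_def by blast+
      from this[THEN spec, of 0] this[THEN spec, of 1] show
        "(g N has_real_derivative deriv (g N) e) (at e)" "(deriv (g N) has_real_derivative deriv (deriv (g N)) e) (at e)"
        "(G N has_real_derivative deriv (G N) e) (at e)" "(deriv (G N) has_real_derivative deriv (deriv (G N)) e) (at e)"
        by simp_all
    qed
    have "continuous_on {e. \<bar>e - u N\<bar> < \<delta>} (deriv (g N))" "continuous_on {e. \<bar>e - u N\<bar> < \<delta>} (deriv (G N))"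
      using D(2,4) by (auto intro!: continuous_at_imp_continuous_on DERIV_isCont)
    then show ?thesis
      using S.microcanonical_ode[OF \<beta>_pos _ g G \<delta> refl D(1) D(3)] N by (simp add: m_def)
  qed
  have times_w: "(\<lambda>N. z N * w N) \<longlonglongrightarrow> 0" if "z \<longlonglongrightarrow> 0" for z
    using bounded_bilinear.Zfun_prod_Bfun[OF bounded_bilinear_mult _ w_bd] that
    by (simp add: tendsto_Zfun_iff)
  \<comment> \<open>\<open>z\<close> is the error of replacing \<open>x\<close> and \<open>y\<close>
    by their limits in the coefficient of \<open>w\<close>; with the limits that coefficient is
    \<open>2 / \<beta>^4 - 1 / \<beta>^4\<close>.\<close>
  define z where "z N = 2 / \<beta> ^ 3 * (x N - 1 / \<beta>) - 1 / \<beta>\<^sup>2 * (y N - 1 / \<beta>\<^sup>2)" for N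
  have "z \<longlonglongrightarrow> 2 / \<beta> ^ 3 * (1 / \<beta> - 1 / \<beta>) - 1 / \<beta>\<^sup>2 * (1 / \<beta>\<^sup>2 - 1 / \<beta>\<^sup>2)"
    unfolding z_def by (intro tendsto_diff tendsto_mult tendsto_const x y)
  then have zw: "(\<lambda>N. z N * w N) \<longlonglongrightarrow> 0" by (intro times_w) simp
  have inv: "(\<lambda>N. 1 / real N) \<longlonglongrightarrow> 0" by (rule lim_1_over_n)
  \<comment> \<open>For \<open>2 \<le> N\<close> this is exactly the difference in the statement,
    arranged as a sum of visibly null sequences.\<close>
  let ?R = "\<lambda>N. \<nu> * ((x N)\<^sup>2 - 1 / \<beta>\<^sup>2) - \<nu> * (\<nu> + 1 / real N) * (x N * q N - y N * p N + z N * w N)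
      - \<nu> / \<beta> ^ 4 * (1 / real N * w N)"
  have "?R
    \<longlonglongrightarrow> \<nu> * ((1 / \<beta>)\<^sup>2 - 1 / \<beta>\<^sup>2) - \<nu> * (\<nu> + 0) * (1 / \<beta> * 0 - 1 / \<beta>\<^sup>2 * 0 + 0) - \<nu> / \<beta> ^ 4 * 0"
    by (intro tendsto_diff tendsto_mult tendsto_add tendsto_power tendsto_const x y p q zw inv times_w)
  then have lim: "?R \<longlonglongrightarrow> 0"
    by (simp add: power_divide)
  have "\<forall>\<^sub>F N in sequentially. ?R N
    = (G N (u N) - (g N (u N))\<^sup>2) / real N - (\<nu> / \<beta>\<^sup>2 - \<nu>\<^sup>2 / (\<beta> ^ 4 * v N \<beta>))"
    using eventually_ge_at_top[of 2]
  proof eventually_elim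
    case (elim N)
    have N: "0 < real N" using elim by simp
    have m: "0 < m N" using \<nu>_pos N by (simp add: m_def)
    then have m1: "m N + 1 \<noteq> 0" by simp
    have gs: "g N (u N) = x N * m N" "deriv (g N) (u N) = x' N * m N"
      "G N (u N) = y N * (m N * (m N + 1))" "deriv (G N) (u N) = y' N * (m N * (m N + 1))"
      using m m1 by (simp_all add: x_def x'_def y_def y'_def)
    have "(m N)\<^sup>2 * (m N + 1) * ((x N * y' N - y N * x' N) / real N + (y N - (x N)\<^sup>2)) = 0"
      using ode[OF elim] unfolding gs by (simp add: power2_eq_square algebra_simps)
    then have yx: "y N - (x N)\<^sup>2 = - ((x N * y' N - y N * x' N) / real N)"
      using m m1 by auto
    \<comment> \<open>\<open>G\<close> is measured in units of \<open>m (m + 1)\<close> and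
      \<open>g^2\<close> in units of \<open>m^2\<close>; the mismatch \<open>m x^2\<close> is the
      source of the term \<open>\<nu> / \<beta>^2\<close>.\<close>
    have "G N (u N) - (g N (u N))\<^sup>2 = m N * (m N + 1) * (y N - (x N)\<^sup>2) + m N * (x N)\<^sup>2"
      unfolding gs by (simp add: power2_eq_square algebra_simps)
    moreover have "(m N * (m N + 1) * (- (d / real N)) + m N * (x N)\<^sup>2) / real N
        = \<nu> * (x N)\<^sup>2 - \<nu> * (\<nu> + 1 / real N) * d" for d
      unfolding m_def using N by (simp add: field_simps)
    ultimately have "(G N (u N) - (g N (u N))\<^sup>2) / real N
        = \<nu> * (x N)\<^sup>2 - \<nu> * (\<nu> + 1 / real N) * (x N * y' N - y N * x' N)"
      by (simp only: yx)
    also have "x N * y' N - y N * x' N = x N * q N - y N * p N + z N * w N + w N / \<beta> ^ 4"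
      unfolding p_def q_def z_def divide_inverse
      by (simp add: algebra_simps power2_eq_square power3_eq_cube power4_eq_xxxx)
    finally show ?case
      by (simp add: w_def algebra_simps power2_eq_square add_divide_distrib)
  qed
  from Lim_transform_eventually[OF lim this] show ?thesis .
qed

end

section \<open>The phase space measure\<close>

lemma smooth_on_imp_continuous_on: "smooth_on I F S \<Longrightarrow> continuous_on S F"
  by (metis smooth_on_def Ck_on.simps(1))

lemma smooth_on_vec_imp_continuous_on:
  fixes f :: "real ^ 'n \<Rightarrow> real"
  assumes "smooth_on_vec f W"
  shows "continuous_on W f"
proof -
  have 1: "continuous_on {x. vec_lambda x \<in> W} (\<lambda>x. f (vec_lambda x))"
    using assms unfolding smooth_on_vec_def by (rule smooth_on_imp_continuous_on)
  have 2: "continuous_on W (\<lambda>y i. y $ i)"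
    by (intro continuous_on_coordinatewise_then_product continuous_intros)
  have "continuous_on W (\<lambda>y. f (vec_lambda (\<lambda>i. y $ i)))"
    by (rule continuous_on_compose2[OF 1 2]) auto
  then show ?thesis by simp
qed

lemma borel_measurable_if_continuous_on:
  fixes f :: "'a::topological_space \<Rightarrow> 'b::real_normed_vector"
  assumes "open S" "continuous_on S f"
  shows "(\<lambda>x. if x \<in> S then f x else 0) \<in> borel_measurable borel"
  by (rule borel_measurable_continuous_on_if) (use assms in auto)

locale manifold_volume =
  fixes \<A> :: "('q :: {second_countable_topology, t2_space}, 'n :: finite) chart set" and vol :: "'q measure"
  assumes atlas: "smooth_atlas \<A>" and volume: "volume_measure \<A> vol"
begin

lemma sets_vol[measurable_cong]: "sets vol = sets borel"
  using volume by (simp add: volume_measure_def)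

lemma space_vol: "space vol = UNIV"
  using sets_eq_imp_space_eq[OF sets_vol] by simp

lemma chart:
  assumes "c \<in> \<A>"
  shows "open (fst c)" "open (chart_image c)" "continuous_on (fst c) (snd c)"
    "q \<in> fst c \<Longrightarrow> chart_inv c (snd c q) = q" "q \<in> fst c \<Longrightarrow> snd c q \<in> chart_image c"
proof -
  have h: "homeomorphism (fst c) (chart_image c) (snd c) (chart_inv c)" "open (fst c)" "open (chart_image c)"
    using atlas assms unfolding smooth_atlas_def by blast+
  then show "open (fst c)" "open (chart_image c)" "continuous_on (fst c) (snd c)"
    "q \<in> fst c \<Longrightarrow> chart_inv c (snd c q) = q" "q \<in> fst c \<Longrightarrow> snd c q \<in> chart_image c"
    by (auto simp: homeomorphism_def chart_image_def)
qed

text \<open>The Lindelof property. Countability serves to exhaust the manifold by sets of finite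
  volume and to glue measurable pieces.\<close>

lemma countable_atlas: "\<exists>\<C>\<subseteq>\<A>. countable \<C> \<and> (\<Union>c\<in>\<C>. fst c) = UNIV"
proof -
  have op: "open S" if "S \<in> fst ` \<A>" for S using that chart(1) by blast
  obtain F' where F': "F' \<subseteq> fst ` \<A>" "countable F'" "\<Union>F' = \<Union>(fst ` \<A>)"
    using Lindelof[OF op] by metis
  have "\<Union>(fst ` \<A>) = UNIV" using atlas unfolding smooth_atlas_def by blast
  then have F'U: "\<Union>F' = UNIV" using F'(3) by simp
  obtain \<C> where "\<C> \<subseteq> \<A>" "countable \<C>" "F' = fst ` \<C>"
    using countable_subset_image[of F' fst \<A>] F'(1,2) by metis
  with F'U show ?thesis by blast
qed

lemma chart_density:
  assumes "c \<in> \<A>"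
  obtains \<rho> where "continuous_on (chart_image c) \<rho>" "\<And>x. x \<in> chart_image c \<Longrightarrow> 0 < \<rho> x"
    "\<And>A. A \<in> sets borel \<Longrightarrow> A \<subseteq> fst c \<Longrightarrow>
      emeasure vol A = (\<integral>\<^sup>+x. ennreal (\<rho> x) * indicator (snd c ` A) x \<partial>lborel)"
proof -
  obtain \<rho> where "smooth_on_vec \<rho> (chart_image c)" "\<forall>x\<in>chart_image c. 0 < \<rho> x"
    "\<forall>A\<in>sets borel. A \<subseteq> fst c \<longrightarrow>
      emeasure vol A = (\<integral>\<^sup>+x. ennreal (\<rho> x) * indicator (snd c ` A) x \<partial>lborel)"
    using volume assms unfolding volume_measure_def by blast
  then show ?thesis by (intro that smooth_on_vec_imp_continuous_on) blast+
qed

lemma sigma_finite_vol: "sigma_finite_measure vol"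
proof -
  obtain \<C> where \<C>: "\<C> \<subseteq> \<A>" "countable \<C>" "(\<Union>c\<in>\<C>. fst c) = UNIV"
    using countable_atlas by blast
  have "\<exists>S. countable S \<and> S \<subseteq> sets vol \<and> \<Union>S = fst c \<and> (\<forall>A\<in>S. emeasure vol A \<noteq> \<infinity>)" if c: "c \<in> \<C>" for c
  proof -
    have c': "c \<in> \<A>" using c \<C> by blast
    note ch = chart[OF c']
    obtain \<rho> where \<rho>: "continuous_on (chart_image c) \<rho>"
      "\<And>A. A \<in> sets borel \<Longrightarrow> A \<subseteq> fst c \<Longrightarrow>
        emeasure vol A = (\<integral>\<^sup>+x. ennreal (\<rho> x) * indicator (snd c ` A) x \<partial>lborel)"
      using chart_density[OF c'] by metis
    \<comment> \<open>On a sublevel set of \<open>f\<close> both the coordinates and the density are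
      bounded, so its volume is finite; the sublevel sets exhaust the chart domain.\<close>
    define f where "f q = (if q \<in> fst c then max (norm (snd c q)) (\<rho> (snd c q)) else 0)" for q
    have "continuous_on (fst c) (\<lambda>q. \<rho> (snd c q))"
      by (rule continuous_on_compose2[OF \<rho>(1) ch(3)]) (auto intro: ch(5))
    then have [measurable]: "f \<in> borel_measurable borel"
      unfolding f_def using ch by (intro borel_measurable_if_continuous_on continuous_intros) auto
    define A where "A k = fst c \<inter> {q. f q \<le> real k}" for k
    have A: "A k \<in> sets borel" for k
      unfolding A_def using ch(1) by (intro sets.Int) auto
    have "emeasure vol (A k) \<le> (\<integral>\<^sup>+x. ennreal (real k) * indicator (cball 0 (real k)) x \<partial>(lborel :: (real ^ 'n) measure))" for k
      unfolding \<rho>(2)[OF A, unfolded A_def, OF Int_lower1, folded A_def]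
      by (intro nn_integral_mono) (auto simp: A_def f_def indicator_def intro!: ennreal_leI)
    also have "\<dots> k = ennreal (real k) * emeasure lborel (cball 0 (real k) :: (real ^ 'n) set)" for k
      by (simp add: nn_integral_cmult_indicator)
    also have "\<dots> k < \<infinity>" for k
      using emeasure_lborel_cball_finite[of "0 :: real ^ 'n"] by (simp add: ennreal_mult_less_top)
    finally have fin: "emeasure vol (A k) \<noteq> \<infinity>" for k by (metis less_irrefl)
    have "\<Union>(range A) = fst c"
      unfolding A_def by (auto intro: real_arch_simple)
    then show ?thesis using A fin sets_vol by (intro exI[of _ "range A"]) auto
  qed
  then obtain S where S: "\<And>c. c \<in> \<C> \<Longrightarrow> countable (S c) \<and> S c \<subseteq> sets vol \<and> \<Union>(S c) = fst c \<and> (\<forall>A\<in>S c. emeasure vol A \<noteq> \<infinity>)"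
    by metis
  show ?thesis
  proof
    show "\<exists>A. countable A \<and> A \<subseteq> sets vol \<and> \<Union> A = space vol \<and> (\<forall>a\<in>A. emeasure vol a \<noteq> \<infinity>)"
    proof (intro exI[of _ "\<Union>(S ` \<C>)"] conjI)
      show "countable (\<Union>(S ` \<C>))" using S \<C>(2) by (intro countable_UN) blast+
      have "\<Union>(\<Union>(S ` \<C>)) = (\<Union>c\<in>\<C>. \<Union>(S c))" by blast
      also have "\<dots> = UNIV" using S \<C>(3) by (metis (no_types, lifting) SUP_cong)
      finally show "\<Union>(\<Union>(S ` \<C>)) = space vol" by (simp add: space_vol)
    qed (use S in blast)+
  qed
qed

lemma vol_nonzero: "emeasure vol (space vol) \<noteq> 0"
proof
  assume 0: "emeasure vol (space vol) = 0"
  \<comment> \<open>\<open>undefined\<close> serves as a point of the manifold, which exists because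
    types are nonempty.\<close>
  obtain c where c: "c \<in> \<A>" "undefined \<in> fst c"
    using atlas unfolding smooth_atlas_def by blast
  note ch = chart[OF c(1)]
  obtain \<rho> where \<rho>: "continuous_on (chart_image c) \<rho>" "\<And>x. x \<in> chart_image c \<Longrightarrow> 0 < \<rho> x"
      "\<And>A. A \<in> sets borel \<Longrightarrow> A \<subseteq> fst c \<Longrightarrow>
        emeasure vol A = (\<integral>\<^sup>+x. ennreal (\<rho> x) * indicator (snd c ` A) x \<partial>lborel)"
    using chart_density[OF c(1)] by metis
  \<comment> \<open>Continuity of \<open>\<rho>\<close> is known only on the chart image; extended
    by 0 it is measurable everywhere and has the required integral.\<close>
  define \<rho>' where "\<rho>' x = (if x \<in> chart_image c then \<rho> x else 0)" for x
  have [measurable]: "\<rho>' \<in> borel_measurable borel"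
    unfolding \<rho>'_def using ch(2) \<rho>(1) by (rule borel_measurable_if_continuous_on)
  have "emeasure vol (fst c) = 0"
    using emeasure_space[of vol "fst c"] unfolding 0 by simp
  moreover have "(\<integral>\<^sup>+x. ennreal (\<rho>' x) \<partial>lborel) = (\<integral>\<^sup>+x. ennreal (\<rho> x) * indicator (snd c ` fst c) x \<partial>lborel)"
    by (intro nn_integral_cong) (auto simp: \<rho>'_def chart_image_def indicator_def)
  ultimately have "(\<integral>\<^sup>+x. ennreal (\<rho>' x) \<partial>lborel) = 0"
    using \<rho>(3)[of "fst c"] ch(1) by simp
  then have "AE x in lborel. ennreal (\<rho>' x) = 0"
    by (subst (asm) nn_integral_0_iff_AE) auto
  then have "AE x in lborel. x \<notin> chart_image c"
    by eventually_elim (use \<rho>(2) in \<open>fastforce simp: \<rho>'_def ennreal_eq_0_iff\<close>)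
  then have "chart_image c \<in> null_sets lborel"
    using ch(2) by (simp add: AE_iff_null_sets)
  then have "negligible (chart_image c)"
    by (auto simp: negligible_iff_null_sets intro: null_sets_completionI)
  moreover have "chart_image c \<noteq> {}" using ch(5)[OF c(2)] by blast
  ultimately show False using open_not_negligible[OF ch(2)] by blast
qed

lemma continuous_on_block: "continuous_on S (\<lambda>x :: nat \<times> 'n \<Rightarrow> real. block x j)"
  unfolding block_def
  by (intro continuous_on_vec_lambda continuous_on_subset[OF continuous_on_product_coordinates subset_UNIV])

lemma chart_coordinate_measurable:
  assumes "c \<in> \<A>"
  shows "(\<lambda>q. if q \<in> fst c then snd c q $ a else 0) \<in> borel_measurable borel"
  by (intro borel_measurable_if_continuous_on chart[OF assms] continuous_intros)

text \<open>Smoothness of the potential is known only in charts, one for each particle.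
  Measurability is therefore checked on countably many products of chart domains that cover the
  space of positions.\<close>

lemma potential_measurable_first:
  assumes V: "smooth_potential \<A> N V" and N: "1 \<le> N"
  shows "(\<lambda>y. V (y 0) (\<lambda>j\<in>{..<N-1}. y (Suc j))) \<in> borel_measurable (\<Pi>\<^sub>M i\<in>{..<N}. vol)"
proof -
  let ?M = "\<Pi>\<^sub>M i\<in>{..<N}. vol"
  let ?W = "\<lambda>y. V (y 0) (\<lambda>j\<in>{..<N-1}. y (Suc j))"
  obtain \<C> where \<C>: "\<C> \<subseteq> \<A>" "countable \<C>" "(\<Union>c\<in>\<C>. fst c) = UNIV"
    using countable_atlas by blast
  define R where "R c = {y \<in> space ?M. \<forall>j<N. y j \<in> fst (c j)}" for c :: "nat \<Rightarrow> ('q, 'n) chart"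
  have Rm: "R c \<in> sets ?M" if "c \<in> {..<N} \<rightarrow>\<^sub>E \<C>" for c
  proof -
    have "{y \<in> space ?M. y j \<in> fst (c j)} \<in> sets ?M" if j: "j < N" for j
    proof -
      have "fst (c j) \<in> sets vol"
        using \<open>c \<in> {..<N} \<rightarrow>\<^sub>E \<C>\<close> j \<C>(1) chart(1)[of "c j"] sets_vol by auto
      moreover have "(\<lambda>y. y j) \<in> measurable ?M vol"
        using j by (intro measurable_component_singleton) simp
      ultimately have "(\<lambda>y. y j) -` fst (c j) \<inter> space ?M \<in> sets ?M" by (rule measurable_sets[rotated])
      then show ?thesis by (simp add: vimage_def Int_def conj_commute)
    qed
    then have "{y \<in> space ?M. \<forall>j\<in>{..<N}. y j \<in> fst (c j)} \<in> sets ?M"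
      by (intro sets.sets_Collect_finite_All) auto
    then show ?thesis unfolding R_def by (simp only: Ball_def lessThan_iff)
  qed
  show ?thesis
  proof (rule measurable_piecewise_restrict[of "R ` ({..<N} \<rightarrow>\<^sub>E \<C>)"])
    show "countable (R ` ({..<N} \<rightarrow>\<^sub>E \<C>))"
      using \<C>(2) by (intro countable_image countable_PiE) auto
    show "\<Omega> \<inter> space ?M \<in> sets ?M" if "\<Omega> \<in> R ` ({..<N} \<rightarrow>\<^sub>E \<C>)" for \<Omega>
      using that Rm by auto
    show "space ?M \<subseteq> \<Union>(R ` ({..<N} \<rightarrow>\<^sub>E \<C>))"
    proof
      fix y assume y: "y \<in> space ?M"
      have "\<forall>j. \<exists>c\<in>\<C>. y j \<in> fst c" using \<C>(3) by blast
      then obtain c where "\<And>j. c j \<in> \<C> \<and> y j \<in> fst (c j)" by metis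
      then have "y \<in> R (restrict c {..<N})" "restrict c {..<N} \<in> {..<N} \<rightarrow>\<^sub>E \<C>"
        using y by (auto simp: R_def)
      then show "y \<in> \<Union>(R ` ({..<N} \<rightarrow>\<^sub>E \<C>))" by blast
    qed
    fix \<Omega> assume "\<Omega> \<in> R ` ({..<N} \<rightarrow>\<^sub>E \<C>)"
    then obtain c where c: "c \<in> {..<N} \<rightarrow>\<^sub>E \<C>" "\<Omega> = R c" by blast
    have cA: "c j \<in> \<A>" if "j < N" for j using c(1) \<C>(1) that by auto
    define F where "F x = V (chart_inv (c 0) (block x 0)) (\<lambda>j\<in>{..<N-1}. chart_inv (c (Suc j)) (block x (Suc j)))" for x
    define S where "S = {x. \<forall>j<N. block x j \<in> chart_image (c j)}"
    have contF: "continuous_on S F"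
      using V cA unfolding smooth_potential_def F_def[abs_def] S_def
      by (intro smooth_on_imp_continuous_on) blast
    have "S = (\<Inter>j\<in>{..<N}. (\<lambda>x. block x j) -` chart_image (c j))" by (auto simp: S_def)
    also have "open \<dots>"
      by (intro open_INT ballI open_vimage continuous_on_block finite_lessThan chart(2)[OF cA]) simp
    finally have Fm: "(\<lambda>x. if x \<in> S then F x else 0) \<in> borel_measurable borel"
      using contF by (rule borel_measurable_if_continuous_on)
    \<comment> \<open>The coordinates of all particles as one family; the value 0 off the chart
      domains makes every entry measurable on the whole space, and only its values on
      \<open>R c\<close> matter.\<close>
    define x where "x y = (\<lambda>(j, a). if j < N then (if y j \<in> fst (c j) then snd (c j) (y j) $ a else 0) else 0)"
      for y :: "nat \<Rightarrow> 'q"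
    have xm: "x \<in> measurable ?M borel"
    proof (rule measurable_coordinatewise_then_product)
      fix i :: "nat \<times> 'n"
      obtain j a where i: "i = (j, a)" by force
      show "(\<lambda>y. x y i) \<in> borel_measurable ?M"
      proof (cases "j < N")
        case True
        have "(\<lambda>y. y j) \<in> measurable ?M borel"
          using True measurable_component_singleton[of j "{..<N}" "\<lambda>_. vol"] measurable_cong_sets[OF refl sets_vol]
          by auto
        from measurable_compose[OF this chart_coordinate_measurable[OF cA[OF True], of a]] show ?thesis
          using True by (simp add: x_def i)
      qed (simp add: x_def i)
    qed
    have blk: "block (x y) j = snd (c j) (y j)" if "y \<in> R c" "j < N" for y j
      using that by (simp add: block_def x_def R_def vec_eq_iff)
    have W: "(if x y \<in> S then F (x y) else 0) = ?W y" if y: "y \<in> R c" for y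
    proof -
      have y': "y j \<in> fst (c j)" if "j < N" for j using y that by (simp add: R_def)
      have inv: "chart_inv (c j) (block (x y) j) = y j" if "j < N" for j
        using blk[OF y that] chart(4)[OF cA[OF that] y'[OF that]] by simp
      have "x y \<in> S"
        unfolding S_def using blk[OF y] chart(5)[OF cA y'] by auto
      moreover have "(\<lambda>j\<in>{..<N-1}. chart_inv (c (Suc j)) (block (x y) (Suc j))) = (\<lambda>j\<in>{..<N-1}. y (Suc j))"
        by (rule restrict_ext) (simp add: inv)
      ultimately show ?thesis using inv[of 0] N by (simp add: F_def)
    qed
    have "(\<lambda>y. if x y \<in> S then F (x y) else 0) \<in> borel_measurable (restrict_space ?M \<Omega>)"
      by (intro measurable_restrict_space1 measurable_compose[OF xm Fm])
    then show "?W \<in> borel_measurable (restrict_space ?M \<Omega>)"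
      using W c(2) by (subst (asm) measurable_cong) (auto simp: space_restrict_space)
  qed
qed

lemma potential_measurable:
  assumes V: "smooth_potential \<A> N V" and N: "1 \<le> N" and i: "i < N"
  shows "(\<lambda>q. V (q i) (others N i q)) \<in> borel_measurable (\<Pi>\<^sub>M i\<in>{..<N}. vol)"
proof -
  \<comment> \<open>Particle \<open>i\<close> moves to slot 0 and the others follow in order: slot
    \<open>j \<ge> 1\<close> receives particle \<open>j - 1\<close> as long as that one precedes
    \<open>i\<close>, and particle \<open>j\<close> afterwards.\<close>
  define y where "y q = (\<lambda>j\<in>{..<N}. q (if j = 0 then i else if j - 1 < i then j - 1 else j))" for q :: "nat \<Rightarrow> 'q"
  have "y \<in> measurable (\<Pi>\<^sub>M i\<in>{..<N}. vol) (\<Pi>\<^sub>M i\<in>{..<N}. vol)"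
    unfolding y_def using i by (intro measurable_restrict measurable_component_singleton) auto
  from measurable_compose[OF this potential_measurable_first[OF V N]]
  have "(\<lambda>q. V (y q 0) (\<lambda>j\<in>{..<N-1}. y q (Suc j))) \<in> borel_measurable (\<Pi>\<^sub>M i\<in>{..<N}. vol)" .
  also have "(\<lambda>q. V (y q 0) (\<lambda>j\<in>{..<N-1}. y q (Suc j))) = (\<lambda>q. V (q i) (others N i q))"
  proof
    fix q
    have "(\<lambda>j\<in>{..<N-1}. y q (Suc j)) = others N i q"
      unfolding others_def by (rule restrict_ext) (auto simp: y_def)
    then show "V (y q 0) (\<lambda>j\<in>{..<N-1}. y q (Suc j)) = V (q i) (others N i q)"
      using N by (simp add: y_def)
  qed
  finally show ?thesis .
qed

end

section \<open>Dilation of Lebesgue measure on momentum space\<close>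

lemma emeasure_lborel_scaleR:
  fixes A :: "'e :: euclidean_space set"
  assumes c: "0 < c" and A: "A \<in> sets borel"
  shows "emeasure lborel A = ennreal (c ^ DIM('e)) * emeasure lborel ((\<lambda>x. c *\<^sub>R x) -` A)"
proof -
  have "emeasure (lborel :: 'e measure) A
      = emeasure (density (distr lborel borel (\<lambda>x. 0 + c *\<^sub>R x)) (\<lambda>_. ennreal (\<bar>c\<bar> ^ DIM('e)))) A"
    using lborel_affine[of c "0 :: 'e"] c by simp
  also have "\<dots> = ennreal (c ^ DIM('e)) * emeasure lborel ((\<lambda>x. c *\<^sub>R x) -` A)"
    using A c by (subst emeasure_density_const) (auto simp: emeasure_distr)
  finally show ?thesis .
qed

text \<open>Boxes determine the finite product of sigma-finite measures, and on a box each component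
  contributes a factor \<open>c ^ DIM('e)\<close>.\<close>

lemma PiM_lborel_scaleR:
  fixes c :: real and I :: "'i set"
  defines "P \<equiv> \<Pi>\<^sub>M i\<in>I. (lborel :: 'e :: euclidean_space measure)"
  assumes c: "0 < c" and I: "finite I"
  shows "density (distr P P (\<lambda>p. \<lambda>i\<in>I. c *\<^sub>R p i)) (\<lambda>_. ennreal (c ^ (DIM('e) * card I))) = P"
    (is "density (distr P P ?T) _ = P")
proof -
  interpret product_sigma_finite "\<lambda>_ :: 'i. lborel :: 'e measure" by standard
  have T: "?T \<in> measurable P P"
    unfolding P_def by (intro measurable_restrict) measurable
  show ?thesis
    unfolding P_def
  proof (rule PiM_eqI[OF I], fold P_def)
    show "sets (density (distr P P ?T) (\<lambda>_. ennreal (c ^ (DIM('e) * card I)))) = sets P" by simp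
    fix A :: "'i \<Rightarrow> 'e set" assume A: "\<And>i. i \<in> I \<Longrightarrow> A i \<in> sets lborel"
    have PA: "Pi\<^sub>E I A \<in> sets P" unfolding P_def using A I by (intro sets_PiM_I_finite) auto
    have vimage: "(\<lambda>x. c *\<^sub>R x) -` A i \<in> sets lborel" if "i \<in> I" for i
    proof -
      have "(\<lambda>x. c *\<^sub>R x) -` A i \<inter> space borel \<in> sets (borel :: 'e measure)"
        using A[OF that] by (intro measurable_sets[of _ borel borel]) simp_all
      then show ?thesis by simp
    qed
    have "?T -` Pi\<^sub>E I A \<inter> space P = (\<Pi>\<^sub>E i\<in>I. (\<lambda>x. c *\<^sub>R x) -` A i)"
      by (auto simp: P_def space_PiM PiE_iff extensional_def)
    then have "emeasure (density (distr P P ?T) (\<lambda>_. ennreal (c ^ (DIM('e) * card I)))) (Pi\<^sub>E I A)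
        = ennreal (c ^ (DIM('e) * card I)) * emeasure P (\<Pi>\<^sub>E i\<in>I. (\<lambda>x. c *\<^sub>R x) -` A i)"
      using PA T by (subst emeasure_density_const) (auto simp: emeasure_distr)
    also have "\<dots> = (\<Prod>i\<in>I. ennreal (c ^ DIM('e))) * (\<Prod>i\<in>I. emeasure lborel ((\<lambda>x. c *\<^sub>R x) -` A i))"
      unfolding P_def using vimage I c by (simp add: emeasure_PiM power_mult ennreal_power)
    also have "\<dots> = (\<Prod>i\<in>I. emeasure lborel (A i))"
      unfolding prod.distrib[symmetric] using A c by (intro prod.cong refl emeasure_lborel_scaleR[symmetric]) auto
    finally show "emeasure (density (distr P P ?T) (\<lambda>_. ennreal (c ^ (DIM('e) * card I)))) (Pi\<^sub>E I A)
        = (\<Prod>i\<in>I. emeasure lborel (A i))" .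
  qed
qed

lemma nn_integral_PiM_lborel_scaleR:
  fixes c :: real and I :: "'i set"
  defines "P \<equiv> \<Pi>\<^sub>M i\<in>I. (lborel :: 'e :: euclidean_space measure)"
  assumes c: "0 < c" and I: "finite I" and f: "f \<in> borel_measurable P"
  shows "(\<integral>\<^sup>+p. f p \<partial>P) = ennreal (c ^ (DIM('e) * card I)) * (\<integral>\<^sup>+p. f (\<lambda>i\<in>I. c *\<^sub>R p i) \<partial>P)"
proof -
  have T: "(\<lambda>p. \<lambda>i\<in>I. c *\<^sub>R p i) \<in> measurable P P"
    unfolding P_def by (intro measurable_restrict) measurable
  have "(\<integral>\<^sup>+p. f p \<partial>P) = (\<integral>\<^sup>+p. f p \<partial>density (distr P P (\<lambda>p. \<lambda>i\<in>I. c *\<^sub>R p i)) (\<lambda>_. ennreal (c ^ (DIM('e) * card I))))"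
    unfolding P_def by (simp only: PiM_lborel_scaleR[OF c I])
  also have "\<dots> = ennreal (c ^ (DIM('e) * card I)) * (\<integral>\<^sup>+p. f (\<lambda>i\<in>I. c *\<^sub>R p i) \<partial>P)"
    using f T by (simp add: nn_integral_density nn_integral_cmult nn_integral_distr)
  finally show ?thesis .
qed

definition potential_energy ::
    "(nat \<Rightarrow> 'q \<Rightarrow> (nat \<Rightarrow> 'q) \<Rightarrow> real) \<Rightarrow> nat \<Rightarrow> ('n :: finite, 'q) state \<Rightarrow> real" where
  "potential_energy V N = (\<lambda>(p, q). \<Sum>i<N. V N (q i) (others N i q))"

lemma hamiltonian_eq: "hamiltonian V N \<omega> = kinetic_energy N \<omega> + potential_energy V N \<omega>"
  by (simp add: hamiltonian_def kinetic_energy_def potential_energy_def sum.distrib split: prod.split)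

lemma kinetic_energy_scaleR:
  "kinetic_energy N (\<lambda>i\<in>{..<N}. c *\<^sub>R p i, q) = c\<^sup>2 * kinetic_energy N (p, q)"
  by (simp add: kinetic_energy_def sum_distrib_left power_mult_distrib)

lemma kinetic_energy_nonneg: "0 \<le> kinetic_energy N \<omega>"
  by (simp add: kinetic_energy_def sum_nonneg split: prod.split)

section \<open>The scaling law on phase space\<close>

context manifold_volume
begin

abbreviation "momenta N \<equiv> \<Pi>\<^sub>M i\<in>{..<N :: nat}. (lborel :: (real ^ 'n) measure)"
abbreviation "positions N \<equiv> \<Pi>\<^sub>M i\<in>{..<N :: nat}. vol"
abbreviation "phase N \<equiv> (phase_measure vol N :: ('n, 'q) state measure)"

lemma sigma_finite_factors: "sigma_finite_measure (momenta N)" "sigma_finite_measure (positions N)"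
proof -
  interpret p: product_sigma_finite "\<lambda>_ :: nat. lborel :: (real ^ 'n) measure" by standard
  interpret q: product_sigma_finite "\<lambda>_ :: nat. vol"
    using sigma_finite_vol by (simp add: product_sigma_finite_def)
  show "sigma_finite_measure (momenta N)" by (rule p.sigma_finite) simp
  show "sigma_finite_measure (positions N)" by (rule q.sigma_finite) simp
qed

lemma kinetic_energy_measurable: "kinetic_energy N \<in> borel_measurable (phase N)"
proof -
  have "(\<lambda>\<omega>. (norm (fst \<omega> j))\<^sup>2 / 2) \<in> borel_measurable (phase N)" if "j < N" for j
  proof -
    have "(\<lambda>p. p j) \<in> measurable (momenta N) lborel"
      using that by (intro measurable_component_singleton) simp
    from measurable_compose[OF measurable_fst this]
    have "(\<lambda>\<omega>. fst \<omega> j) \<in> borel_measurable (phase N)" unfolding phase_measure_def by simp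
    then show ?thesis by measurable
  qed
  then show ?thesis
    unfolding kinetic_energy_def case_prod_beta by (intro borel_measurable_sum) auto
qed

lemma potential_energy_measurable:
  assumes "smooth_potential \<A> N (V N)" "1 \<le> N"
  shows "potential_energy V N \<in> borel_measurable (phase N)"
proof -
  have "(\<lambda>\<omega>. V N (snd \<omega> i) (others N i (snd \<omega>))) \<in> borel_measurable (phase N)" if "i < N" for i
    unfolding phase_measure_def
    by (rule measurable_compose[OF measurable_snd potential_measurable[OF assms that]])
  then show ?thesis
    unfolding potential_energy_def case_prod_beta by (intro borel_measurable_sum) auto
qed

lemma phase_nonzero: "emeasure (phase N) (space (phase N)) \<noteq> 0"
proof -
  interpret p: product_sigma_finite "\<lambda>_ :: nat. lborel :: (real ^ 'n) measure" by standard
  interpret q: product_sigma_finite "\<lambda>_ :: nat. vol"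
    using sigma_finite_vol by (simp add: product_sigma_finite_def)
  interpret Q: sigma_finite_measure "positions N" by (rule sigma_finite_factors)
  have "emeasure (momenta N) (space (momenta N)) = (\<Prod>i<N. emeasure lborel (UNIV :: (real ^ 'n) set))"
    unfolding space_PiM by (subst p.emeasure_PiM) auto
  moreover have "emeasure (positions N) (space (positions N)) = (\<Prod>i<N. emeasure vol (space vol))"
    unfolding space_PiM by (subst q.emeasure_PiM) auto
  ultimately show ?thesis
    unfolding phase_measure_def space_pair_measure
    using vol_nonzero by (subst Q.emeasure_pair_measure_Times) auto
qed

text \<open>By Fubini with the positions outside, all momenta are dilated by \<open>sqrt s\<close>
  at fixed \<open>q\<close>. This multiplies the kinetic energy by \<open>s\<close>, leaves the
  potential energy alone and produces a factor \<open>s powr (n N / 2)\<close>, which is then moved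
  to the other side.\<close>

lemma nn_integral_phase_scaled:
  assumes V: "smooth_potential \<A> N (V N)" "1 \<le> N" and s: "0 < s" and \<Phi>: "\<Phi> \<in> borel_measurable borel"
  shows "(\<integral>\<^sup>+\<omega>. \<Phi> (s * kinetic_energy N \<omega>, potential_energy V N \<omega>) \<partial>phase N)
    = ennreal (s powr - (real CARD('n) / 2 * real N)) * (\<integral>\<^sup>+\<omega>. \<Phi> (kinetic_energy N \<omega>, potential_energy V N \<omega>) \<partial>phase N)"
proof -
  interpret pair_sigma_finite "momenta N" "positions N"
    using sigma_finite_factors by (simp add: pair_sigma_finite_def)
  note [measurable] = kinetic_energy_measurable[of N, unfolded phase_measure_def]
    potential_energy_measurable[of N V, OF V, unfolded phase_measure_def] \<Phi>
  define F where "F t \<omega> = \<Phi> (t * kinetic_energy N \<omega>, potential_energy V N \<omega>)" for t and \<omega> :: "('n, 'q) state"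
  have Fm[measurable]: "F t \<in> borel_measurable (momenta N \<Otimes>\<^sub>M positions N)" for t
    unfolding F_def
    by (rule measurable_compose[OF _ \<Phi>]) (unfold borel_prod[symmetric], measurable)
  define c where "c = sqrt s"
  have c: "0 < c" "c\<^sup>2 = s" using s by (simp_all add: c_def)
  define k where "k = c ^ (DIM(real ^ 'n) * card {..<N})"
  have k: "k = s powr (real CARD('n) / 2 * real N)"
    unfolding k_def c_def using s
    by (simp add: powr_half_sqrt[symmetric] powr_powr powr_realpow[symmetric])
  have U: "potential_energy V N (\<lambda>i\<in>{..<N}. c *\<^sub>R p i, q) = potential_energy V N (p, q)" for p :: "nat \<Rightarrow> real ^ 'n" and q
    by (simp add: potential_energy_def)
  have inner: "(\<integral>\<^sup>+p. F 1 (p, q) \<partial>momenta N) = ennreal k * (\<integral>\<^sup>+p. F s (p, q) \<partial>momenta N)"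
    if q: "q \<in> space (positions N)" for q
  proof -
    have "(\<lambda>p. F 1 (p, q)) \<in> borel_measurable (momenta N)" using q by measurable
    from nn_integral_PiM_lborel_scaleR[OF c(1) finite_lessThan this]
    have "(\<integral>\<^sup>+p. F 1 (p, q) \<partial>momenta N) = ennreal k * (\<integral>\<^sup>+p. F 1 (\<lambda>i\<in>{..<N}. c *\<^sub>R p i, q) \<partial>momenta N)"
      by (simp only: k_def)
    then show ?thesis by (simp only: F_def kinetic_energy_scaleR U c(2) mult_1)
  qed
  have "(\<integral>\<^sup>+\<omega>. F 1 \<omega> \<partial>phase N) = (\<integral>\<^sup>+q. (\<integral>\<^sup>+p. F 1 (p, q) \<partial>momenta N) \<partial>positions N)"
    unfolding phase_measure_def by (rule nn_integral_snd[OF Fm, symmetric])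
  also have "\<dots> = (\<integral>\<^sup>+q. ennreal k * (\<integral>\<^sup>+p. F s (p, q) \<partial>momenta N) \<partial>positions N)"
    using inner by (rule nn_integral_cong)
  also have "\<dots> = ennreal k * (\<integral>\<^sup>+q. (\<integral>\<^sup>+p. F s (p, q) \<partial>momenta N) \<partial>positions N)"
    by (rule nn_integral_cmult) measurable
  also have "(\<integral>\<^sup>+q. (\<integral>\<^sup>+p. F s (p, q) \<partial>momenta N) \<partial>positions N) = (\<integral>\<^sup>+\<omega>. F s \<omega> \<partial>phase N)"
    unfolding phase_measure_def by (rule nn_integral_snd[OF Fm])
  finally have "ennreal (s powr - (real CARD('n) / 2 * real N)) * (\<integral>\<^sup>+\<omega>. F 1 \<omega> \<partial>phase N)
      = ennreal (s powr - (real CARD('n) / 2 * real N)) * (ennreal k * (\<integral>\<^sup>+\<omega>. F s \<omega> \<partial>phase N))" by simp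
  also have "\<dots> = ennreal (s powr - (real CARD('n) / 2 * real N) * k) * (\<integral>\<^sup>+\<omega>. F s \<omega> \<partial>phase N)"
    using c(1) by (simp add: k_def ennreal_mult mult.assoc)
  also have "s powr - (real CARD('n) / 2 * real N) * k = 1"
    unfolding k powr_add[symmetric] using s by simp
  finally show ?thesis by (simp add: F_def)
qed

lemma phase_scaled_energy:
  assumes V: "smooth_potential \<A> N (V N)" "1 \<le> N"
    and fin: "\<And>b. 0 < b \<Longrightarrow> partition_function TYPE('n) vol V N b < \<infinity>"
  shows "scaled_energy (phase N) (kinetic_energy N) (potential_energy V N) (real CARD('n) / 2 * real N)"
proof
  note m[measurable] = kinetic_energy_measurable[of N] potential_energy_measurable[of N V, OF V]
  show "kinetic_energy N \<in> borel_measurable (phase N)" "potential_energy V N \<in> borel_measurable (phase N)"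
    by (rule m)+
  show "0 < real CARD('n) / 2 * real N" using V by simp
  show "(\<integral>\<^sup>+\<omega>. ennreal (exp (- b * (kinetic_energy N \<omega> + potential_energy V N \<omega>))) \<partial>phase N) < \<infinity>" if "0 < b" for b
    using fin[OF that] by (simp add: partition_function_def hamiltonian_eq)
  show "distr (phase N) borel (\<lambda>\<omega>. (s * kinetic_energy N \<omega>, potential_energy V N \<omega>)) =
      density (distr (phase N) borel (\<lambda>\<omega>. (kinetic_energy N \<omega>, potential_energy V N \<omega>)))
        (\<lambda>_. ennreal (s powr - (real CARD('n) / 2 * real N)))"
    (is "?L = ?R") if s: "0 < s" for s
  proof (rule measure_eqI)
    have [measurable]: "(\<lambda>\<omega>. (t * kinetic_energy N \<omega>, potential_energy V N \<omega>)) \<in> borel_measurable (phase N)"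
      "(\<lambda>\<omega>. (kinetic_energy N \<omega>, potential_energy V N \<omega>)) \<in> borel_measurable (phase N)" for t
      unfolding borel_prod[symmetric] by measurable
    fix A assume "A \<in> sets (?L)"
    then have A[measurable]: "A \<in> sets borel" by simp
    have "emeasure (?L) A
        = (\<integral>\<^sup>+\<omega>. indicator A (s * kinetic_energy N \<omega>, potential_energy V N \<omega>) \<partial>phase N)"
      by (simp add: nn_integral_distr flip: nn_integral_indicator)
    also have "\<dots> = ennreal (s powr - (real CARD('n) / 2 * real N))
        * (\<integral>\<^sup>+\<omega>. indicator A (kinetic_energy N \<omega>, potential_energy V N \<omega>) \<partial>phase N)"
      by (rule nn_integral_phase_scaled[of N V, OF V s]) measurable
    also have "\<dots> = emeasure (?R) A"
      by (subst emeasure_density_const) (simp_all add: nn_integral_distr flip: nn_integral_indicator)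
    finally show "emeasure (?L) A =
      emeasure (?R) A" .
  qed simp
qed (use kinetic_energy_nonneg phase_nonzero in auto)

end

section \<open>The particle system\<close>

text \<open>The lower derivatives are required on neighbourhoods, and these contain the point
  itself.\<close>

lemma times_differentiable_at_DERIV:
  "times_differentiable_at n g x \<Longrightarrow> k < n \<Longrightarrow> ((deriv ^^ k) g has_real_derivative (deriv ^^ Suc k) g x) (at x)"
proof (induction n arbitrary: x)
  case (Suc n)
  then have near: "\<forall>\<^sub>F y in nhds x. times_differentiable_at n g y"
    and D: "(deriv ^^ n) g field_differentiable at x" by simp_all
  show ?case
  proof (cases "k = n")
    case True
    then show ?thesis using D by (simp add: DERIV_deriv_iff_field_differentiable)
  next
    case False
    then show ?thesis using Suc eventually_nhds_x_imp_x[OF near] by simp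
  qed
qed simp

locale particle_system = manifold_volume \<A> vol
  for \<A> :: "('q :: {second_countable_topology, t2_space}, 'n :: finite) chart set" and vol :: "'q measure" +
  fixes V :: "nat \<Rightarrow> 'q \<Rightarrow> (nat \<Rightarrow> 'q) \<Rightarrow> real" and N :: nat
  assumes potential: "smooth_potential \<A> N (V N)" and N: "1 \<le> N"
    and finite_partition_function: "\<And>b. 0 < b \<Longrightarrow> partition_function TYPE('n) vol V N b < \<infinity>"
begin

sublocale S: scaled_energy "phase N" "kinetic_energy N" "potential_energy V N" "real CARD('n) / 2 * real N"
  using potential N finite_partition_function by (rule phase_scaled_energy)

lemma hamiltonian_eq_H: "hamiltonian V N = S.H"
  by (simp add: fun_eq_iff hamiltonian_eq S.H_def)

lemma energy_per_particle_eq: "energy_per_particle V N = (\<lambda>\<omega>. S.H \<omega> / real N)"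
  by (simp add: fun_eq_iff energy_per_particle_def hamiltonian_eq_H)

lemma free_energy_eq: "free_energy TYPE('n) vol V N b = ln (S.Z b) / real N"
  by (simp add: free_energy_def partition_function_def S.Z_def integral_eq_nn_integral hamiltonian_eq_H)

lemma canonical_eq:
  assumes b: "0 < b"
  shows "canonical vol V N b = S.canon b"
proof -
  have "exp (- b * S.H \<omega> - ln (S.Z b)) = exp (- b * S.H \<omega>) / S.Z b" for \<omega>
    using S.Z_pos[OF b] by (simp add: exp_diff)
  then show ?thesis
    using N by (simp add: canonical_def S.canon_def hamiltonian_eq_H free_energy_eq)
qed

lemma mean_energy_eq:
  assumes b: "0 < b"
  shows "mean_energy TYPE('n) vol V N b = S.E b S.H / real N"
  using S.E_eq_canon[OF S.H_measurable b]
  by (simp add: mean_energy_def canonical_eq[OF b] energy_per_particle_eq)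

lemma L2_norm_eq:
  assumes "0 < b" and [measurable]: "A \<in> borel_measurable (phase N)"
  shows "L2_norm_canonical vol V N b A = sqrt (S.E b (\<lambda>\<omega>. (A \<omega>)\<^sup>2))"
  using assms by (simp add: L2_norm_canonical_def canonical_eq S.E_eq_canon)

lemma deriv_free_energy: "0 < b \<Longrightarrow> deriv (free_energy TYPE('n) vol V N) b = - S.E b S.H / real N"
  using DERIV_imp_deriv[OF DERIV_cdivide[OF S.DERIV_ln_Z, of b "real N"]]
  by (simp add: free_energy_eq[abs_def])

lemma deriv2_free_energy:
  assumes b: "0 < b"
  shows "(deriv ^^ 2) (free_energy TYPE('n) vol V N) b = S.v (real N) b"
proof -
  have "\<forall>\<^sub>F b' in nhds b. deriv (free_energy TYPE('n) vol V N) b' = - (S.E b' S.H / real N)"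
    using b eventually_nhds_in_open[of "{0<..}" b]
    by (auto elim!: eventually_mono simp: deriv_free_energy)
  then have "deriv (deriv (free_energy TYPE('n) vol V N)) b = deriv (\<lambda>b. - (S.E b S.H / real N)) b"
    by (rule deriv_cong_ev) simp
  also have "\<dots> = S.v (real N) b"
    using DERIV_imp_deriv[OF DERIV_minus[OF S.DERIV_mean[OF b]], of "real N"] N by simp
  finally show ?thesis by (simp add: numeral_2_eq_2)
qed

text \<open>If the energy had no density, \<^const>\<open>energy_density\<close> would be the zero function, and
  testing against the constant \<open>1\<close> would give \<open>A\<close> the mean \<open>0\<close>.\<close>

lemma microcanonical_average_imp_conditional_version:
  assumes b: "0 < b" and A[measurable]: "A \<in> borel_measurable (phase N)"
    and iA: "integrable (phase N) (\<lambda>\<omega>. A \<omega> * exp (- b * S.H \<omega>))" and EA: "S.E b A \<noteq> 0"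
    and mc: "microcanonical_average vol V N b A g"
  shows "S.conditional_version b (real N) A g"
proof -
  let ?P = "S.canon b"
  let ?h = "\<lambda>\<omega>. S.H \<omega> / real N"
  define D where "D = distr ?P lborel ?h"
  define R where "R = RN_deriv lborel D"
  have ed: "energy_density TYPE('n) vol V N b = (\<lambda>u. enn2real (R u))"
    by (simp add: fun_eq_iff energy_density_def R_def D_def canonical_eq[OF b] energy_per_particle_eq)
  have g[measurable]: "g \<in> borel_measurable borel" using mc by (simp add: microcanonical_average_def)
  have test: "integrable lborel (\<lambda>u. F u * g u * enn2real (R u))"
      "(\<integral>\<omega>. A \<omega> * F (?h \<omega>) \<partial>?P) = (\<integral>u. F u * g u * enn2real (R u) \<partial>lborel)"
    if "F \<in> borel_measurable borel" "integrable ?P (\<lambda>\<omega>. A \<omega> * F (?h \<omega>))" for F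
    using mc that unfolding microcanonical_average_def canonical_eq[OF b] energy_per_particle_eq ed by blast+
  have iP: "integrable ?P A" using iA b by (simp add: S.integrable_canon)
  have h[measurable]: "?h \<in> measurable ?P lborel" by measurable
  have "\<exists>f. f \<in> borel_measurable lborel \<and> density lborel f = D"
  proof (rule ccontr)
    assume no_density: "\<not> ?thesis"
    have "R = (\<lambda>_. 0)" unfolding R_def RN_deriv_def by (rule if_not_P[OF no_density])
    then show False using test(2)[of "\<lambda>_. 1"] iP EA b by (simp add: S.E_eq_canon)
  qed
  then have RD: "density lborel R = D" unfolding R_def by (metis RN_derivI)
  have Rm[measurable]: "R \<in> borel_measurable borel" unfolding R_def by simp
  have "emeasure ?P (space ?P) < \<infinity>"
    using S.integrable_canon_const[OF b, of 1] by (simp add: integrable_iff_bounded)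
  moreover have "(\<integral>\<^sup>+u. R u \<partial>lborel) = emeasure D (space D)"
    unfolding RD[symmetric] by (simp add: emeasure_density)
  moreover have "emeasure D (space D) = emeasure ?P (space ?P)"
    unfolding D_def by (subst emeasure_distr) auto
  \<comment> \<open>The canonical measure has finite mass, so the density is finite almost
    everywhere and its conversion to real numbers loses nothing.\<close>
  ultimately have "AE u in lborel. R u \<noteq> \<infinity>"
    by (intro nn_integral_PInf_AE) auto
  then have "density lborel R = density lborel (\<lambda>u. ennreal (enn2real (R u)))"
    by (intro density_cong) (auto elim!: eventually_mono simp: less_top)
  then have D: "D = density lborel (\<lambda>u. ennreal (enn2real (R u)))" using RD by simp
  show ?thesis
    unfolding S.conditional_version_def
  proof (intro conjI ballI impI)
    show "g \<in> borel_measurable borel" by (rule g)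
    fix F :: "real \<Rightarrow> real" assume F[measurable]: "F \<in> borel_measurable borel" and "\<exists>B. \<forall>y. \<bar>F y\<bar> \<le> B"
    then obtain B where B: "\<And>y. \<bar>F y\<bar> \<le> B" by blast
    have iF: "integrable ?P (\<lambda>\<omega>. A \<omega> * F (?h \<omega>))"
      by (rule Bochner_Integration.integrable_bound[OF integrable_mult_left[OF iP, of B]])
         (auto intro!: AE_I2 mult_left_mono order_trans[OF B] simp: abs_mult)
    have "integrable D (\<lambda>u. g u * F u)" "(\<integral>u. g u * F u \<partial>D) = (\<integral>\<omega>. A \<omega> * F (?h \<omega>) \<partial>?P)"
      unfolding D using test[OF F iF] by (simp_all add: integrable_density integral_density mult_ac)
    then have P: "integrable ?P (\<lambda>\<omega>. g (?h \<omega>) * F (?h \<omega>))"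
      "(\<integral>\<omega>. A \<omega> * F (?h \<omega>) \<partial>?P) = (\<integral>\<omega>. g (?h \<omega>) * F (?h \<omega>) \<partial>?P)"
      unfolding D_def by (simp_all add: integrable_distr_eq integral_distr)
    show "integrable (phase N) (\<lambda>\<omega>. g (?h \<omega>) * F (?h \<omega>) * exp (- b * S.H \<omega>))"
      using P(1) b by (simp add: S.integrable_canon)
    have "S.E b (\<lambda>\<omega>. A \<omega> * F (?h \<omega>)) = S.E b (\<lambda>\<omega>. g (?h \<omega>) * F (?h \<omega>))"
      using P(2) b by (simp add: S.E_eq_canon)
    then show "(\<integral>\<omega>. A \<omega> * F (?h \<omega>) * exp (- b * S.H \<omega>) \<partial>phase N)
        = (\<integral>\<omega>. g (?h \<omega>) * F (?h \<omega>) * exp (- b * S.H \<omega>) \<partial>phase N)"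
      using S.Z_pos[OF b] by (simp add: S.E_def)
  qed
qed

text \<open>Chain rule: the inverse temperature has slope \<open>- b^2\<close> in the temperature,
  and the mean energy has slope \<open>- v\<close> in the inverse temperature, where
  \<open>v\<close> is the second derivative of the free energy.\<close>

lemma DERIV_mean_energy_temperature:
  assumes b: "0 < b"
  shows "((\<lambda>T. mean_energy TYPE('n) vol V N (1 / T)) has_real_derivative heat_capacity TYPE('n) vol V N b) (at (1 / b))"
proof (rule has_field_derivative_transform_within_open[where S = "{0<..}"])
  have "((\<lambda>T. 1 / T) has_real_derivative - b\<^sup>2) (at (1 / b))"
    using b by (auto intro!: derivative_eq_intros simp: power2_eq_square)
  then have "((\<lambda>T. S.E (1 / T) S.H / real N) has_real_derivative - S.v (real N) b * - b\<^sup>2) (at (1 / b))"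
    using S.DERIV_mean[OF b, of "real N"] N by (intro DERIV_chain2) auto
  then show "((\<lambda>T. S.E (1 / T) S.H / real N) has_real_derivative heat_capacity TYPE('n) vol V N b) (at (1 / b))"
    by (simp add: heat_capacity_def deriv2_free_energy[OF b] mult.commute)
qed (use b in \<open>auto simp: mean_energy_eq\<close>)

end

section \<open>Uniform bounds near \<beta> and the limit\<close>

lemma derivative_bounds_imp_lipschitz:
  fixes f :: "real \<Rightarrow> real"
  assumes "\<And>b. \<bar>b - a\<bar> \<le> \<rho> \<Longrightarrow> (f has_real_derivative f' b) (at b)"
    and "\<And>b. \<bar>b - a\<bar> \<le> \<rho> \<Longrightarrow> \<bar>f' b\<bar> \<le> B" and "0 \<le> \<rho>" and "\<bar>b - a\<bar> \<le> \<rho>"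
  shows "\<bar>f b - f a\<bar> \<le> B * \<bar>b - a\<bar>"
proof -
  have near: "\<bar>b' - a\<bar> \<le> \<rho>" if "b' \<in> {a - \<rho>..a + \<rho>}" for b' using that by auto
  have "norm (f b - f a) \<le> B * norm (b - a)"
    by (rule field_differentiable_bound[of "{a - \<rho>..a + \<rho>}" f f' B])
       (use assms near in \<open>auto intro: has_field_derivative_at_within\<close>)
  then show ?thesis by simp
qed

theorem mainTheorem5:
  fixes \<A> :: "('q :: {second_countable_topology, t2_space}, 'n :: finite) chart set"
    and vol :: "'q measure"
    and V :: "nat \<Rightarrow> 'q \<Rightarrow> (nat \<Rightarrow> 'q) \<Rightarrow> real"
    and mc :: "nat \<Rightarrow> (('n, 'q) state \<Rightarrow> real) \<Rightarrow> real \<Rightarrow> real"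
    and J :: "real set" and C :: "real \<Rightarrow> real" and \<beta> :: real
  defines "f \<equiv> free_energy TYPE('n) vol V"
    and "u \<equiv> mean_energy TYPE('n) vol V"
    and "K \<equiv> (kinetic_energy :: nat \<Rightarrow> ('n, 'q) state \<Rightarrow> real)"
    and "n \<equiv> real CARD('n)"
  assumes manifold: "smooth_atlas \<A>" "volume_measure \<A> vol"
    and potential: "\<And>N. N \<ge> 1 \<Longrightarrow> smooth_potential \<A> N (V N)"
    and finite_f: "\<And>\<beta>' N. \<beta>' > 0 \<Longrightarrow> N \<ge> 1 \<Longrightarrow> partition_function TYPE('n) vol V N \<beta>' < \<infinity>"
    and J: "open J" "is_interval J" "J \<subseteq> {0<..}"
    and f_diff: "\<And>\<beta>' N. \<beta>' \<in> J \<Longrightarrow> N \<ge> 1 \<Longrightarrow> times_differentiable_at 4 (f N) \<beta>'"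
    and f_bound: "\<And>\<beta>' N j. \<beta>' \<in> J \<Longrightarrow> N \<ge> 1 \<Longrightarrow> j \<le> 4 \<Longrightarrow> \<bar>(deriv ^^ j) (f N) \<beta>'\<bar> \<le> C \<beta>'"
    and C_bound: "\<And>a b. {a..b} \<subseteq> J \<Longrightarrow> bounded (C ` {a..b})"
    and \<beta>: "\<beta> \<in> J"
    and mc: "\<And>D N. D \<in> {K, \<lambda>N \<omega>. (K N \<omega>)\<^sup>2} \<Longrightarrow> N \<ge> 1 \<Longrightarrow>
        microcanonical_average vol V N \<beta> (D N) (mc N (D N))"
    and i: "\<And>D N. D \<in> {K, \<lambda>N \<omega>. (K N \<omega>)\<^sup>2} \<Longrightarrow> N \<ge> 1 \<Longrightarrow>
        integrable (canonical vol V N \<beta>) (\<lambda>\<omega>. (D N \<omega>)\<^sup>2)"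
    and ii: "\<And>D. D \<in> {K, \<lambda>N \<omega>. (K N \<omega>)\<^sup>2} \<Longrightarrow>
        \<exists>c>0. \<forall>N\<ge>1. times_differentiable_at 2 (mc N (D N)) (u N \<beta>) \<and>
          (\<forall>j\<le>2. \<bar>(deriv ^^ j) (mc N (D N)) (u N \<beta>)\<bar>
                  \<le> c * real N powr (real j / 2) * L2_norm_canonical vol V N \<beta> (D N))"
    \<comment> \<open>For \<open>N = 1\<close> the bound in the next hypothesis is \<open>1 / log 1 = \<infinity>\<close>.\<close>
    and iii: "\<And>D. D \<in> {K, \<lambda>N \<omega>. (K N \<omega>)\<^sup>2} \<Longrightarrow>
        \<exists>b>0. \<exists>c>0. \<forall>N\<ge>2. \<forall>e. \<bar>e - u N \<beta>\<bar> \<le> b * sqrt (ln (real N) / real N) \<longrightarrow>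
          times_differentiable_at 3 (mc N (D N)) e \<and>
          \<bar>(deriv ^^ 3) (mc N (D N)) e\<bar>
            \<le> c * (sqrt (real N) / ln (real N)) * L2_norm_canonical vol V N \<beta> (D N)"
  shows "(\<lambda>N. microcanonical_variance mc N (K N) (u N \<beta>) / real N
             - (n / (2 * \<beta>\<^sup>2) - n\<^sup>2 / (4 * \<beta> ^ 4 * (deriv ^^ 2) (f N) \<beta>))) \<longlonglongrightarrow> 0
    \<and> (\<lambda>N. microcanonical_variance mc N (K N) (u N \<beta>) / real N
             - n / (2 * \<beta>\<^sup>2) * (1 - n / (2 * heat_capacity TYPE('n) vol V N \<beta>))) \<longlonglongrightarrow> 0
    \<and> (\<forall>N\<ge>1. ((\<lambda>T. u N (1 / T)) has_real_derivative heat_capacity TYPE('n) vol V N \<beta>)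
                 (at (1 / \<beta>)))"
proof -
  have \<beta>0: "0 < \<beta>" using J \<beta> by auto
  have particles: "particle_system \<A> vol V N" if "1 \<le> N" for N
    using manifold potential[OF that] finite_f that by unfold_locales auto
  define M where "M N = (phase_measure vol N :: ('n, 'q) state measure)" for N
  define U where "U N = (potential_energy V N :: ('n, 'q) state \<Rightarrow> real)" for N
  have scaled: "scaled_energy (M N) (K N) (U N) (n / 2 * real N)" if "1 \<le> N" for N
  proof -
    interpret particle_system \<A> vol V N using that by (rule particles)
    show ?thesis unfolding M_def K_def U_def n_def by (rule S.scaled_energy_axioms)
  qed
  have f2: "(deriv ^^ 2) (f N) b = scaled_energy.v (M N) (K N) (U N) (real N) b" if "1 \<le> N" "0 < b" for N b
  proof -
    interpret particle_system \<A> vol V N using that by (intro particles)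
    show ?thesis unfolding f_def M_def K_def U_def by (rule deriv2_free_energy[OF that(2)])
  qed
  obtain \<rho>0 where \<rho>0: "0 < \<rho>0" "cball \<beta> \<rho>0 \<subseteq> J"
    using J(1) \<beta> open_contains_cball by blast
  \<comment> \<open>Within this radius the points stay in \<open>J\<close>; the cap
    \<open>\<beta> / 2\<close> gives \<open>\<rho> < \<beta>\<close>, so that shifted inverse
    temperatures are positive.\<close>
  define \<rho> where "\<rho> = min \<rho>0 (\<beta> / 2)"
  have \<rho>: "0 < \<rho>" "\<rho> < \<beta>" using \<rho>0 \<beta>0 by (auto simp: \<rho>_def)
  have inJ: "b \<in> J" if "\<bar>b - \<beta>\<bar> \<le> \<rho>" for b
    using that \<rho>0(2) by (auto simp: \<rho>_def subset_iff dist_real_def abs_minus_commute)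
  then have "{\<beta> - \<rho>..\<beta> + \<rho>} \<subseteq> J" by auto
  from C_bound[OF this] obtain B where "\<forall>b\<in>{\<beta> - \<rho>..\<beta> + \<rho>}. \<bar>C b\<bar> \<le> B"
    unfolding bounded_iff by auto
  then have B: "\<bar>C b\<bar> \<le> B" if "\<bar>b - \<beta>\<bar> \<le> \<rho>" for b
    using that by (auto simp: abs_le_iff)
  have f_le: "\<bar>(deriv ^^ j) (f N) b\<bar> \<le> B" if "1 \<le> N" "\<bar>b - \<beta>\<bar> \<le> \<rho>" "j \<le> 4" for N b j
    using f_bound[OF inJ[OF that(2)] that(1,3)] B[OF that(2)] by linarith
  \<comment> \<open>The bound on the third derivative of \<open>f\<close> limits the oscillation of
    \<open>f''\<close>, which is the variance \<open>v\<close> by \<open>f2\<close>.\<close>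
  have lip: "\<bar>(deriv ^^ 2) (f N) b - (deriv ^^ 2) (f N) \<beta>\<bar> \<le> B * \<bar>b - \<beta>\<bar>" if N: "1 \<le> N" and b: "\<bar>b - \<beta>\<bar> \<le> \<rho>" for N b
  proof (rule derivative_bounds_imp_lipschitz[OF _ _ _ b])
    fix b' assume b': "\<bar>b' - \<beta>\<bar> \<le> \<rho>"
    show "((deriv ^^ 2) (f N) has_real_derivative (deriv ^^ Suc 2) (f N) b') (at b')"
      by (rule times_differentiable_at_DERIV[OF f_diff[OF inJ[OF b'] N]]) simp
    show "\<bar>(deriv ^^ Suc 2) (f N) b'\<bar> \<le> B" by (rule f_le[OF N b']) simp
  qed (use \<rho> in simp)
  interpret energy_family M K U "n / 2" \<beta> \<rho> B
  proof (rule energy_family.intro)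
    show "scaled_energy (M N) (K N) (U N) (n / 2 * real N)" if "1 \<le> N" for N using that by (rule scaled)
    show "0 < n / 2" by (simp add: n_def)
    show "0 < \<rho>" "\<rho> < \<beta>" by (rule \<rho>)+
    fix N b assume N: "1 \<le> (N :: nat)" and b: "\<bar>b - \<beta>\<bar> \<le> \<rho>"
    have b0: "0 < b" using b \<rho> by linarith
    show "scaled_energy.v (M N) (K N) (U N) (real N) b \<le> B"
      using f_le[OF N b, of 2] f2[OF N b0] by simp
    show "\<bar>scaled_energy.v (M N) (K N) (U N) (real N) b - scaled_energy.v (M N) (K N) (U N) (real N) \<beta>\<bar> \<le> B * \<bar>b - \<beta>\<bar>"
      using lip[OF N b] f2[OF N b0] f2[OF N \<beta>0] by simp
  qed
  let ?K2 = "\<lambda>N \<omega>. (K N \<omega>)\<^sup>2"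
  have u_eq: "u N \<beta> = E N \<beta> (H N) / real N" if "1 \<le> N" for N
  proof -
    interpret particle_system \<A> vol V N using that by (rule particles)
    show ?thesis unfolding u_def M_def K_def U_def by (rule mean_energy_eq[OF \<beta>0])
  qed
  have cond: "conditional N (K N) (mc N (K N))"
    "conditional N (?K2 N) (mc N (?K2 N))" if N: "1 \<le> N" for N
  proof -
    interpret particle_system \<A> vol V N using N by (rule particles)
    \<comment> \<open>A nonzero mean is what lets
      \<open>microcanonical_average_imp_conditional_version\<close> conclude that the energy has a
      density.\<close>
    have "0 < real CARD('n) / 2 * real N" using N by simp
    then have "S.E \<beta> (kinetic_energy N) \<noteq> 0" "S.E \<beta> (\<lambda>\<omega>. (kinetic_energy N \<omega>)\<^sup>2) \<noteq> 0"
      unfolding S.E_K[OF \<beta>0] S.E_K2[OF \<beta>0] using \<beta>0 by (smt (verit) divide_pos_pos mult_pos_pos zero_less_power)+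
    then show "conditional N (K N) (mc N (K N))"
      "conditional N (?K2 N) (mc N (?K2 N))"
      using microcanonical_average_imp_conditional_version[OF \<beta>0 _ _ _ mc[OF _ N, of K, unfolded K_def]]
        microcanonical_average_imp_conditional_version[OF \<beta>0 _ _ _ mc[OF _ N, of ?K2, unfolded K_def]]
        S.integrable_K_expH[OF \<beta>0] S.integrable_K_power_expH[OF \<beta>0, of 2]
      unfolding M_def K_def U_def by auto
  qed
  have L2: "L2_norm_canonical vol V N \<beta> (K N) = sqrt (E N \<beta> (\<lambda>x. (K N x)\<^sup>2))"
    "L2_norm_canonical vol V N \<beta> (?K2 N) = sqrt (E N \<beta> (\<lambda>x. ((K N x)\<^sup>2)\<^sup>2))" if N: "1 \<le> N" for N
  proof -
    interpret particle_system \<A> vol V N using N by (rule particles)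
    show "L2_norm_canonical vol V N \<beta> (K N) = sqrt (E N \<beta> (\<lambda>x. (K N x)\<^sup>2))"
      "L2_norm_canonical vol V N \<beta> (?K2 N) = sqrt (E N \<beta> (\<lambda>x. ((K N x)\<^sup>2)\<^sup>2))"
      unfolding M_def K_def U_def by (intro L2_norm_eq \<beta>0; measurable)+
  qed
  have reg: "\<exists>b>0. \<exists>c>0. \<forall>N\<ge>2. regular N b (c * L2_norm_canonical vol V N \<beta> (D N)) (mc N (D N))"
    if D: "D \<in> {K, ?K2}" for D
  proof -
    obtain b c where bc: "0 < b" "0 < c"
      "\<And>N e. 2 \<le> N \<Longrightarrow> \<bar>e - u N \<beta>\<bar> \<le> b * sqrt (ln (real N) / real N) \<Longrightarrow>
          times_differentiable_at 3 (mc N (D N)) e \<and>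
          \<bar>(deriv ^^ 3) (mc N (D N)) e\<bar>
            \<le> c * (sqrt (real N) / ln (real N)) * L2_norm_canonical vol V N \<beta> (D N)"
      using iii[OF D] by blast
    have "regular N b (c * L2_norm_canonical vol V N \<beta> (D N)) (mc N (D N))"
      if N: "2 \<le> N" for N
      using bc(3)[OF N] times_differentiable_at_DERIV u_eq[of N] N unfolding regular_near_def by (force simp: mult_ac)
    then show ?thesis using bc(1,2) by blast
  qed
  \<comment> \<open>\<open>K\<close> and \<open>K^2\<close> come with windows of their own;
    \<open>microcanonical_variance_limit\<close> admits different ones.\<close>
  obtain b c where bc: "0 < b" "0 < c" "\<And>N. 2 \<le> N \<Longrightarrow> regular N b (c * L2_norm_canonical vol V N \<beta> (K N)) (mc N (K N))"
    using reg[OF insertI1] by blast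
  obtain b' c' where bc': "0 < b'" "0 < c'" "\<And>N. 2 \<le> N \<Longrightarrow> regular N b' (c' * L2_norm_canonical vol V N \<beta> (?K2 N)) (mc N (?K2 N))"
    using reg[of ?K2] by blast
  have lim: "(\<lambda>N. (mc N (?K2 N) (E N \<beta> (H N) / real N) - (mc N (K N) (E N \<beta> (H N) / real N))\<^sup>2) / real N
      - (n / 2 / \<beta>\<^sup>2 - (n / 2)\<^sup>2 / (\<beta> ^ 4 * v N \<beta>))) \<longlonglongrightarrow> 0"
    by (rule microcanonical_variance_limit[OF cond bc(1) bc'(1) _ _ less_imp_le[OF bc(2)] less_imp_le[OF bc'(2)]])
       (use bc(3) bc'(3) L2 in simp_all)
  have 1: "(\<lambda>N. microcanonical_variance mc N (K N) (u N \<beta>) / real N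
      - (n / (2 * \<beta>\<^sup>2) - n\<^sup>2 / (4 * \<beta> ^ 4 * (deriv ^^ 2) (f N) \<beta>))) \<longlonglongrightarrow> 0"
  proof (rule Lim_transform_eventually[OF lim])
    show "\<forall>\<^sub>F N in sequentially. (mc N (?K2 N) (E N \<beta> (H N) / real N) - (mc N (K N) (E N \<beta> (H N) / real N))\<^sup>2) / real N
      - (n / 2 / \<beta>\<^sup>2 - (n / 2)\<^sup>2 / (\<beta> ^ 4 * v N \<beta>))
      = microcanonical_variance mc N (K N) (u N \<beta>) / real N
      - (n / (2 * \<beta>\<^sup>2) - n\<^sup>2 / (4 * \<beta> ^ 4 * (deriv ^^ 2) (f N) \<beta>))"
      using eventually_ge_at_top[of 1]
      by eventually_elim (simp add: microcanonical_variance_def u_eq f2 \<beta>0 power_divide mult.assoc)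
  qed
  \<comment> \<open>Valid for every \<open>N\<close>: if the second derivative vanished, both
    quotients containing it would be 0.\<close>
  have "n / (2 * \<beta>\<^sup>2) - n\<^sup>2 / (4 * \<beta> ^ 4 * (deriv ^^ 2) (f N) \<beta>)
      = n / (2 * \<beta>\<^sup>2) * (1 - n / (2 * heat_capacity TYPE('n) vol V N \<beta>))" for N
    unfolding heat_capacity_def f_def
    by (simp add: right_diff_distrib power2_eq_square power4_eq_xxxx mult_ac)
  with 1 have 2: "(\<lambda>N. microcanonical_variance mc N (K N) (u N \<beta>) / real N
      - n / (2 * \<beta>\<^sup>2) * (1 - n / (2 * heat_capacity TYPE('n) vol V N \<beta>))) \<longlonglongrightarrow> 0"
    by simp
  have 3: "((\<lambda>T. u N (1 / T)) has_real_derivative heat_capacity TYPE('n) vol V N \<beta>) (at (1 / \<beta>))" if "1 \<le> N" for N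
  proof -
    interpret particle_system \<A> vol V N using that by (rule particles)
    show ?thesis unfolding u_def by (rule DERIV_mean_energy_temperature[OF \<beta>0])
  qed
  show ?thesis using 1 2 3 by blast
qed

end
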